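(* Let $u\ge1$ be an integer, $H$ a graph with $\mathrm{dom}(H)\ge u$, and $\Delta\ge\omega\ge\omega_0(H^{\downarrow u})+u$. Then every $\{K_u\vee I_{\Delta+1},K_{\omega+1}\}$-free graph $G$ satisfies $\mathcal{N}(H,G)\le\frac{\mathcal{N}(H^{\downarrow u},\mathrm{T}_{\omega-u}(\Delta))}{\binom{\mathrm{dom}(H)}{u}}k^u(G)$; consequently, for every $p\ge1$, \[ P_u(H,\Delta,\omega)\le\frac{\mathcal{N}(H^{\downarrow u},\mathrm{T}_{\omega-u}(\Delta))}{\binom{\mathrm{dom}(H)}{u}}\quad\text{and}\quad \mathrm{ex}_u(p,H,\{K_u\vee I_{\Delta+1},K_{\omega+1}\})\le\frac{\mathcal{N}(H^{\downarrow u},\mathrm{T}_{\omega-u}(\Delta))}{\binom{\mathrm{dom}(H)}{u}}\,p. \] If moreover $\Delta$ is a multiple of $\omega-u$, then \[ P_u(H,\Delta,\omega)=\frac{\mathcal{N}(H^{\downarrow u},\mathrm{T}_{\omega-u}(\Delta))}{\binom{\mathrm{dom}(H)}{u}}=\rho_u\Big(H,\mathrm{T}_\omega\Big(\frac{\omega\Delta}{\omega-u}\Big)\Big). \]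
   Context: All graphs are finite and simple. $\mathcal{N}(H,G)$ is the number of (not necessarily induced) subgraphs of $G$ isomorphic to $H$; $k^u(G)=\mathcal{N}(K_u,G)$; $\rho_u(H,G)=\mathcal{N}(H,G)/k^u(G)$. $\mathrm{T}_r(n)$ is the Turán graph (complete $r$-partite on $n$ vertices with part sizes $\lfloor n/r\rfloor$ or $\lceil n/r\rceil$). $K_u\vee I_{\Delta+1}$ is the complete split graph: a $u$-clique, an independent set of $\Delta+1$ vertices, and all edges between them. A dominating vertex of $H$ is one adjacent to all other vertices; $\mathrm{dom}(H)$ is the number of dominating vertices; $H^{\downarrow u}$ is $H$ with $u$ dominating vertices deleted. For a graph $J$, $\omega_0(J)$ is the least positive integer such that for every integer $r\ge\omega_0(J)$ and every $n\ge1$, every $n$-vertex $K_{r+1}$-free graph $G$ satisfies $\mathcal{N}(J,G)\le\mathcal{N}(J,\mathrm{T}_r(n))$ (it exists by a theorem of Morrison et al.). $\mathrm{ex}_u(p,H,\mathcal{F})\in[0,\infty]$ is the supremum of $\mathcal{N}(H,G)$ over graphs $G$ with $k^u(G)=p$ having no subgraph isomorphic to a member of $\mathcal{F}$, and $P_u(H,\Delta,\omega)=\lim_{p\to\infty}\mathrm{ex}_u(p,H,\{K_u\vee I_{\Delta+1},K_{\omega+1}\})/p$, which exists and equals the supremum of $\rho_u(H,G)$ over $\{K_u\vee I_{\Delta+1},K_{\omega+1}\}$-free graphs $G$ with $k^u(G)\ge1$. *)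

theory Defs
  imports Complex_Main "HOL-Library.Extended_Nonnegative_Real"
begin

type_synonym 'a graph = "'a set \<times> 'a set set"

definition verts :: "'a graph \<Rightarrow> 'a set" where "verts G = fst G"
definition edges :: "'a graph \<Rightarrow> 'a set set" where "edges G = snd G"

definition wf_graph :: "'a graph \<Rightarrow> bool" where
  "wf_graph G \<longleftrightarrow> finite (verts G) \<and> (\<forall>e\<in>edges G. e \<subseteq> verts G \<and> card e = 2)"

definition subgraphs :: "'a graph \<Rightarrow> 'a graph set" where
  "subgraphs G = {K. verts K \<subseteq> verts G \<and> edges K \<subseteq> edges G \<and> (\<forall>e\<in>edges K. e \<subseteq> verts K)}"

definition isomorphic :: "'b graph \<Rightarrow> 'a graph \<Rightarrow> bool" where
  "isomorphic H K \<longleftrightarrow> (\<exists>f. bij_betw f (verts H) (verts K) \<and> edges K = (\<lambda>e. f ` e) ` edges H)"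

definition count_copies :: "'b graph \<Rightarrow> 'a graph \<Rightarrow> nat" where
  "count_copies H G = card {K \<in> subgraphs G. isomorphic H K}"

definition complete_graph :: "nat \<Rightarrow> nat graph" where
  "complete_graph n = ({0..<n}, {{i, j} | i j. i < n \<and> j < n \<and> i \<noteq> j})"

definition kcount :: "nat \<Rightarrow> 'a graph \<Rightarrow> nat" where
  "kcount u G = count_copies (complete_graph u) G"

definition rho :: "nat \<Rightarrow> 'b graph \<Rightarrow> 'a graph \<Rightarrow> real" where
  "rho u H G = real (count_copies H G) / real (kcount u G)"

definition turan :: "nat \<Rightarrow> nat \<Rightarrow> nat graph" where
  "turan r n = ({0..<n}, {{i, j} | i j. i < n \<and> j < n \<and> i mod r \<noteq> j mod r})"

definition split_graph :: "nat \<Rightarrow> nat \<Rightarrow> nat graph" where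
  "split_graph u D = ({0..<u+D+1},
     {{i, j} | i j. i < u + D + 1 \<and> j < u + D + 1 \<and> i \<noteq> j \<and> (i < u \<or> j < u)})"

definition dominating_vertices :: "'a graph \<Rightarrow> 'a set" where
  "dominating_vertices H = {v \<in> verts H. \<forall>w\<in>verts H. w \<noteq> v \<longrightarrow> {v, w} \<in> edges H}"

definition dom_num :: "'a graph \<Rightarrow> nat" where
  "dom_num H = card (dominating_vertices H)"

definition delete_verts :: "'a graph \<Rightarrow> 'a set \<Rightarrow> 'a graph" where
  "delete_verts H S = (verts H - S, {e \<in> edges H. e \<inter> S = {}})"

definition free :: "'c graph set \<Rightarrow> 'a graph \<Rightarrow> bool" where
  "free F G \<longleftrightarrow> (\<forall>X\<in>F. count_copies X G = 0)"

text \<open>omega_0(J) (host graphs taken on vertex type nat; this is no loss, by isomorphism invariance).\<close>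
definition omega0 :: "'b graph \<Rightarrow> nat" where
  "omega0 J = (LEAST w. w \<ge> 1 \<and> (\<forall>r\<ge>w. \<forall>n\<ge>1. \<forall>G :: nat graph.
      wf_graph G \<and> card (verts G) = n \<and> free {complete_graph (r+1)} G \<longrightarrow>
      count_copies J G \<le> count_copies J (turan r n)))"

definition ex_u :: "nat \<Rightarrow> nat \<Rightarrow> 'b graph \<Rightarrow> nat graph set \<Rightarrow> ennreal" where
  "ex_u u p H F = (SUP G \<in> {G :: nat graph. wf_graph G \<and> kcount u G = p \<and> free F G}.
      ennreal (real (count_copies H G)))"

definition P_u :: "nat \<Rightarrow> 'b graph \<Rightarrow> nat \<Rightarrow> nat \<Rightarrow> ennreal" where
  "P_u u H D w = lim (\<lambda>p. ex_u u p H {split_graph u D, complete_graph (w+1)} / of_nat p)"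

end

theory Submission
  imports Defs "HOL-Library.FuncSet"
begin

text \<open>
  Fix the embedding of \<open>u\<close> dominating vertices of \<open>H\<close>: its image is a \<open>u\<close>-clique of \<open>G\<close>, and the rest of
  \<open>H\<close> embeds into the common neighbourhood of that clique, which has at most \<open>\<Delta>\<close> vertices and clique
  number at most \<open>\<omega> - u\<close>. So the Turan graph on \<open>\<Delta>\<close> vertices bounds the number of extensions, once
  \<open>\<omega>\<^sub>0\<close> is known to exist, and applying the same double count to \<open>H\<close> itself computes its
  automorphisms.

  Existence of \<open>\<omega>\<^sub>0\<close> (every graph \<open>J\<close> is eventually Turan-good) follows from cloning arguments. Let
  \<open>G\<close> be an extremal \<open>K\<^bsub>r+1\<^esub>\<close>-free graph on \<open>n > r\<close> vertices with \<open>r\<close> large. Replacing a vertex by a clone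
  of another one shows that every vertex has only \<open>O(n/r)\<close> non-neighbours. Hence a prescribed placement
  of two labels of \<open>J\<close>, which has \<open>h\<close> vertices, extends to an embedding in \<open>(1 - O(1/r)) n\<^bsup>h-2\<^esup>\<close> ways. If \<open>x, y\<close> and \<open>y, z\<close> are non-adjacent but \<open>x, z\<close> are adjacent, compare \<open>G\<close> with three
  modifications: \<open>y\<close> becomes a clone of \<open>x\<close>; \<open>y\<close> becomes a clone of \<open>z\<close>; both \<open>x\<close> and \<open>z\<close> become clones of \<open>y\<close>.
  Embeddings hitting at most one of \<open>x, y, z\<close> are counted equally by three copies of \<open>G\<close> and by the
  three modifications, and the modifications have one more edge inside \<open>{x, y, z}\<close>, which wins to
  second order. So \<open>G\<close> is complete multipartite, and the same second order comparison shows that the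
  count is strictly concave in the sizes of two parts, so that \<open>G\<close> is balanced.
\<close>

section \<open>Embeddings\<close>

text \<open>Labels and hosts are sets with a relation instead of a \<open>graph\<close>, so that an
  adjacency can be restricted to a common neighbourhood or pulled back along a map without building
  a new graph. Extensionality on \<open>P\<close> makes each embedding a single element of a finite
  set.\<close>

definition emb :: "'b set \<Rightarrow> ('b \<Rightarrow> 'b \<Rightarrow> bool) \<Rightarrow> 'a set \<Rightarrow> ('a \<Rightarrow> 'a \<Rightarrow> bool) \<Rightarrow> ('b \<Rightarrow> 'a) set" where
  "emb P R V E = {f \<in> P \<rightarrow>\<^sub>E V. inj_on f P \<and> (\<forall>a\<in>P. \<forall>b\<in>P. R a b \<longrightarrow> E (f a) (f b))}"

lemma emb_I:
  "\<lbrakk>\<And>p. p \<in> P \<Longrightarrow> f p \<in> V; f \<in> extensional P; inj_on f P;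
    \<And>a b. \<lbrakk>a \<in> P; b \<in> P; R a b\<rbrakk> \<Longrightarrow> E (f a) (f b)\<rbrakk> \<Longrightarrow> f \<in> emb P R V E"
  by (auto simp: emb_def PiE_def)

lemma emb_D:
  assumes "f \<in> emb P R V E"
  shows "p \<in> P \<Longrightarrow> f p \<in> V" "f \<in> extensional P" "inj_on f P"
    "\<lbrakk>a \<in> P; b \<in> P; R a b\<rbrakk> \<Longrightarrow> E (f a) (f b)" "f ` P \<subseteq> V"
  using assms by (auto simp: emb_def PiE_def)

lemma finite_emb: "\<lbrakk>finite P; finite V\<rbrakk> \<Longrightarrow> finite (emb P R V E)"
  by (rule finite_subset[of _ "P \<rightarrow>\<^sub>E V"]) (auto simp: emb_def finite_PiE)

lemma emb_mono:
  "\<lbrakk>V \<subseteq> V'; \<And>x y. \<lbrakk>x \<in> V; y \<in> V; E x y\<rbrakk> \<Longrightarrow> E' x y\<rbrakk> \<Longrightarrow> emb P R V E \<subseteq> emb P R V' E'"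
  by (auto simp: emb_def PiE_def Pi_def)

lemma emb_cong:
  assumes "\<And>x y. \<lbrakk>x \<in> V; y \<in> V\<rbrakk> \<Longrightarrow> E x y \<longleftrightarrow> E' x y"
  shows "emb P R V E = emb P R V E'"
  using assms by (intro equalityI emb_mono) auto

text \<open>Composition with an injective homomorphism of hosts is injective on embeddings.\<close>

lemma card_emb_host_le:
  assumes fin: "finite P" "finite V'" and \<phi>: "inj_on \<phi> V" "\<phi> ` V \<subseteq> V'"
    and E: "\<And>x y. \<lbrakk>x \<in> V; y \<in> V; E x y\<rbrakk> \<Longrightarrow> E' (\<phi> x) (\<phi> y)"
  shows "card (emb P R V E) \<le> card (emb P R V' E')"
proof (rule card_inj_on_le[where f = "\<lambda>f. restrict (\<phi> \<circ> f) P"])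
  show "inj_on (\<lambda>f. restrict (\<phi> \<circ> f) P) (emb P R V E)"
  proof (rule inj_onI)
    fix f g assume f: "f \<in> emb P R V E" and g: "g \<in> emb P R V E"
      and eq: "restrict (\<phi> \<circ> f) P = restrict (\<phi> \<circ> g) P"
    show "f = g"
    proof (rule extensionalityI[OF emb_D(2)[OF f] emb_D(2)[OF g]])
      fix p assume p: "p \<in> P"
      from fun_cong[OF eq, of p] p have "\<phi> (f p) = \<phi> (g p)" by simp
      then show "f p = g p" using \<phi>(1) emb_D(1)[OF f p] emb_D(1)[OF g p] by (auto dest: inj_onD)
    qed
  qed
  show "(\<lambda>f. restrict (\<phi> \<circ> f) P) ` emb P R V E \<subseteq> emb P R V' E'"
  proof (clarify, rule emb_I)
    fix f assume f: "f \<in> emb P R V E"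
    show "inj_on (restrict (\<phi> \<circ> f) P) P"
      using emb_D(1,3)[OF f] \<phi>(1) by (auto simp: inj_on_def)
  qed (use \<phi>(2) E in \<open>auto simp: emb_def PiE_def Pi_def\<close>)
  show "finite (emb P R V' E')" using fin by (rule finite_emb)
qed

lemma card_emb_host_eq:
  assumes fin: "finite P" "finite V" and \<phi>: "bij_betw \<phi> V V'"
    and E: "\<And>x y. \<lbrakk>x \<in> V; y \<in> V\<rbrakk> \<Longrightarrow> E' (\<phi> x) (\<phi> y) \<longleftrightarrow> E x y"
  shows "card (emb P R V E) = card (emb P R V' E')"
proof (rule antisym)
  have fin': "finite V'" using fin \<phi> by (simp add: bij_betw_finite)
  show "card (emb P R V E) \<le> card (emb P R V' E')"
    using fin(1) fin' \<phi> E by (intro card_emb_host_le[where \<phi> = \<phi>]) (auto simp: bij_betw_def)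
  let ?\<psi> = "inv_into V \<phi>"
  have \<psi>: "bij_betw ?\<psi> V' V" by (rule bij_betw_inv_into[OF \<phi>])
  have inv: "\<phi> (?\<psi> y) = y" "?\<psi> y \<in> V" if "y \<in> V'" for y
    using that \<phi> \<psi> by (auto simp: bij_betw_def f_inv_into_f)
  show "card (emb P R V' E') \<le> card (emb P R V E)"
  proof (rule card_emb_host_le[where \<phi> = ?\<psi>])
    fix x y assume "x \<in> V'" "y \<in> V'" "E' x y"
    then show "E (?\<psi> x) (?\<psi> y)" using E[of "?\<psi> x" "?\<psi> y"] inv by simp
  qed (use \<psi> fin in \<open>auto simp: bij_betw_def\<close>)
qed

text \<open>Precomposition with \<open>\<beta>\<close> reverses the direction: fewer label edges
  leave more embeddings.\<close>

lemma card_emb_label_le: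
  assumes fin: "finite P" "finite V" and \<beta>: "bij_betw \<beta> P' P"
    and R: "\<And>a b. \<lbrakk>a \<in> P'; b \<in> P'; R' a b\<rbrakk> \<Longrightarrow> R (\<beta> a) (\<beta> b)"
  shows "card (emb P R V E) \<le> card (emb P' R' V E)"
proof (rule card_inj_on_le[where f = "\<lambda>f. restrict (f \<circ> \<beta>) P'"])
  have im: "\<beta> ` P' = P" and inj: "inj_on \<beta> P'" using \<beta> by (auto simp: bij_betw_def)
  show "inj_on (\<lambda>f. restrict (f \<circ> \<beta>) P') (emb P R V E)"
  proof (rule inj_onI)
    fix f g assume f: "f \<in> emb P R V E" and g: "g \<in> emb P R V E"
      and eq: "restrict (f \<circ> \<beta>) P' = restrict (g \<circ> \<beta>) P'"
    show "f = g"
    proof (rule extensionalityI[OF emb_D(2)[OF f] emb_D(2)[OF g]])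
      fix p assume "p \<in> P"
      then obtain q where "q \<in> P'" "p = \<beta> q" using im by blast
      then show "f p = g p" using fun_cong[OF eq, of q] by simp
    qed
  qed
  show "(\<lambda>f. restrict (f \<circ> \<beta>) P') ` emb P R V E \<subseteq> emb P' R' V E"
  proof (clarify, rule emb_I)
    fix f assume f: "f \<in> emb P R V E"
    show "inj_on (restrict (f \<circ> \<beta>) P') P'"
      using emb_D(3)[OF f] inj im by (auto simp: inj_on_def)
  qed (use im R in \<open>auto simp: emb_def PiE_def Pi_def\<close>)
  show "finite (emb P' R' V E)"
    using fin \<beta> by (intro finite_emb) (auto simp: bij_betw_finite)
qed

lemma card_emb_label_eq:
  assumes fin: "finite P" "finite V" and \<beta>: "bij_betw \<beta> P' P"
    and R: "\<And>a b. \<lbrakk>a \<in> P'; b \<in> P'\<rbrakk> \<Longrightarrow> R (\<beta> a) (\<beta> b) \<longleftrightarrow> R' a b"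
  shows "card (emb P R V E) = card (emb P' R' V E)"
proof (rule antisym)
  show "card (emb P R V E) \<le> card (emb P' R' V E)"
    using fin \<beta> R by (intro card_emb_label_le) auto
  let ?\<psi> = "inv_into P' \<beta>"
  have \<psi>: "bij_betw ?\<psi> P P'" by (rule bij_betw_inv_into[OF \<beta>])
  have inv: "\<beta> (?\<psi> y) = y" "?\<psi> y \<in> P'" if "y \<in> P" for y
    using that \<beta> \<psi> by (auto simp: bij_betw_def f_inv_into_f)
  show "card (emb P' R' V E) \<le> card (emb P R V E)"
  proof (rule card_emb_label_le[OF _ _ \<psi>])
    fix x y assume "x \<in> P" "y \<in> P" "R x y"
    then show "R' (?\<psi> x) (?\<psi> y)" using R[of "?\<psi> x" "?\<psi> y"] inv by simp
  qed (use \<beta> fin in \<open>auto simp: bij_betw_finite\<close>)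
qed

text \<open>Greedy extension: each new label avoids the non-neighbours, hence also the images, of the
  labels already placed.\<close>

lemma card_emb_extensions_ge:
  assumes fin: "finite V" "finite P0" and "finite A" and disj: "A \<inter> P0 = {}"
    and W: "W \<subseteq> V" and k: "\<And>v. v \<in> V \<Longrightarrow> card {w \<in> W. \<not> E v w} \<le> k"
    and E: "symp E" "irreflp E" and R: "irreflp R"
    and f0: "f0 \<in> emb P0 R V E" and m: "card (P0 \<union> A) \<le> m"
  shows "(card W - m * k) ^ card A \<le>
    card {f \<in> emb (P0 \<union> A) R V E. (\<forall>p\<in>P0. f p = f0 p) \<and> f ` A \<subseteq> W}"
  using \<open>finite A\<close> disj m
proof (induction A rule: finite_induct)
  case empty
  have "f0 \<in> {f \<in> emb P0 R V E. \<forall>p\<in>P0. f p = f0 p}" using f0 by simp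
  then have "card {f \<in> emb P0 R V E. \<forall>p\<in>P0. f p = f0 p} > 0"
    by (subst card_gt_0_iff) (auto intro!: finite_emb fin)
  then show ?case by simp
next
  case (insert a A)
  let ?X = "{f \<in> emb (P0 \<union> A) R V E. (\<forall>p\<in>P0. f p = f0 p) \<and> f ` A \<subseteq> W}"
  let ?Y = "{f \<in> emb (P0 \<union> insert a A) R V E. (\<forall>p\<in>P0. f p = f0 p) \<and> f ` insert a A \<subseteq> W}"
  let ?F = "\<lambda>f. {w \<in> W. \<forall>p\<in>P0 \<union> A. E (f p) w}"
  have finW: "finite W" using W fin(1) by (rule finite_subset)
  have a: "a \<notin> P0 \<union> A" using insert.hyps insert.prems by auto
  have cm: "card (P0 \<union> A) \<le> m"
    using insert.prems(2) a insert.hyps fin(2) by simp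
  have IH: "(card W - m * k) ^ card A \<le> card ?X"
    using insert.IH insert.prems cm by auto
  have finX: "finite ?X" by (rule finite_subset[OF _ finite_emb[of "P0 \<union> A" V R E]]) (use fin insert in auto)
  \<comment> \<open>Each of the at most \<open>m\<close> labels already placed rules out at most
    \<open>k\<close> vertices of \<open>W\<close>; the truncated difference is 0 when
    \<open>W\<close> is too small.\<close>
  have fib: "card W - m * k \<le> card (?F f)" if f: "f \<in> ?X" for f
  proof -
    have "card W - card (?F f) = card (W - ?F f)" using finW by (subst card_Diff_subset) auto
    also have "W - ?F f = (\<Union>p\<in>P0 \<union> A. {w \<in> W. \<not> E (f p) w})" by auto
    also have "card \<dots> \<le> (\<Sum>p\<in>P0 \<union> A. card {w \<in> W. \<not> E (f p) w})"
      by (rule card_UN_le) (use fin insert in auto)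
    also have "\<dots> \<le> (\<Sum>p\<in>P0 \<union> A. k)"
    proof (rule sum_mono)
      fix p assume "p \<in> P0 \<union> A"
      then show "card {w \<in> W. \<not> E (f p) w} \<le> k" using f by (intro k) (auto dest: emb_D(1))
    qed
    also have "\<dots> \<le> m * k" using cm by simp
    finally show ?thesis using card_mono[OF finW, of "?F f"] by auto
  qed
  have "(card W - m * k) ^ card (insert a A) = (card W - m * k) ^ card A * (card W - m * k)"
    using insert.hyps by simp
  also have "\<dots> \<le> card ?X * (card W - m * k)" using IH by simp
  also have "\<dots> = (\<Sum>f\<in>?X. card W - m * k)" by simp
  also have "\<dots> \<le> (\<Sum>f\<in>?X. card (?F f))" by (rule sum_mono) (rule fib)
  also have "\<dots> = card (Sigma ?X ?F)" using finX finW by (subst card_SigmaI) auto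
  also have "\<dots> \<le> card ?Y"
  proof (rule card_inj_on_le[where f = "\<lambda>(f, w). f(a := w)"])
    show "inj_on (\<lambda>(f, w). f(a := w)) (Sigma ?X ?F)"
    proof (rule inj_onI, clarify)
      fix f w g w' assume f: "f \<in> emb (P0 \<union> A) R V E" and g: "g \<in> emb (P0 \<union> A) R V E"
        and eq: "f(a := w) = g(a := w')"
      have "w = w'" using fun_cong[OF eq, of a] by simp
      moreover have "f = g"
      proof
        fix p show "f p = g p"
          using fun_cong[OF eq, of p] a emb_D(2)[OF f] emb_D(2)[OF g]
          by (cases "p = a") (auto simp: extensional_def)
      qed
      ultimately show "f = g \<and> w = w'" by simp
    qed
    show "(\<lambda>(f, w). f(a := w)) ` Sigma ?X ?F \<subseteq> ?Y"
    proof (clarify, intro conjI)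
      fix f w assume f: "f \<in> emb (P0 \<union> A) R V E" "\<forall>p\<in>P0. f p = f0 p" "f ` A \<subseteq> W"
        and w: "w \<in> W" "\<forall>p\<in>P0 \<union> A. E (f p) w"
      have w': "E w (f p)" "f p \<noteq> w" if "p \<in> P0 \<union> A" for p
        using w(2) that E by (auto dest: sympD irreflpD)
      show "f(a := w) \<in> emb (P0 \<union> insert a A) R V E"
      proof (rule emb_I)
        show "f(a := w) \<in> extensional (P0 \<union> insert a A)"
          using emb_D(2)[OF f(1)] by (auto simp: extensional_def)
        show "inj_on (f(a := w)) (P0 \<union> insert a A)"
          using emb_D(3)[OF f(1)] w'(2) a by (auto simp: inj_on_def)
      next
        fix p assume "p \<in> P0 \<union> insert a A"
        then show "(f(a := w)) p \<in> V" using emb_D(1)[OF f(1)] w W by auto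
      next
        fix p q assume pq: "p \<in> P0 \<union> insert a A" "q \<in> P0 \<union> insert a A" "R p q"
        then have "p \<noteq> q" using R by (auto dest: irreflpD)
        then show "E ((f(a := w)) p) ((f(a := w)) q)"
          using pq emb_D(4)[OF f(1)] w(2) w'(1) by auto
      qed
      show "\<forall>p\<in>P0. (f(a := w)) p = f0 p" using f(2) a by auto
      show "(f(a := w)) ` insert a A \<subseteq> W" using f(3) w(1) insert.hyps by auto
    qed
    show "finite ?Y"
      by (rule finite_subset[OF _ finite_emb[of "P0 \<union> insert a A" V R E]]) (use fin insert in auto)
  qed
  finally show ?case .
qed

subsection \<open>Embeddings classified by the vertices of a small set they hit\<close>

lemma card_fixed_le:
  assumes "finite P" "finite V" "X \<subseteq> P"
  shows "card {f \<in> P \<rightarrow>\<^sub>E V. \<forall>x\<in>X. f x = g x} \<le> card V ^ (card P - card X)"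
proof -
  have "card {f \<in> P \<rightarrow>\<^sub>E V. \<forall>x\<in>X. f x = g x} \<le> card ((P - X) \<rightarrow>\<^sub>E V)"
  proof (rule card_inj_on_le[where f = "\<lambda>f. restrict f (P - X)"])
    show "inj_on (\<lambda>f. restrict f (P - X)) {f \<in> P \<rightarrow>\<^sub>E V. \<forall>x\<in>X. f x = g x}"
    proof (rule inj_onI, clarify)
      fix f f' assume f: "f \<in> P \<rightarrow>\<^sub>E V" "\<forall>x\<in>X. f x = g x" and f': "f' \<in> P \<rightarrow>\<^sub>E V" "\<forall>x\<in>X. f' x = g x"
        and eq: "restrict f (P - X) = restrict f' (P - X)"
      show "f = f'"
      proof (rule PiE_ext[OF f(1) f'(1)])
        fix p assume "p \<in> P"
        then show "f p = f' p" using fun_cong[OF eq, of p] f(2) f'(2) by (cases "p \<in> X") auto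
      qed
    qed
    show "(\<lambda>f. restrict f (P - X)) ` {f \<in> P \<rightarrow>\<^sub>E V. \<forall>x\<in>X. f x = g x} \<subseteq> (P - X) \<rightarrow>\<^sub>E V"
      by (auto simp: PiE_def Pi_def)
    show "finite ((P - X) \<rightarrow>\<^sub>E V)" using assms by (intro finite_PiE) auto
  qed
  also have "\<dots> = card V ^ (card P - card X)"
    using assms by (simp add: card_PiE card_Diff_subset finite_subset)
  finally show ?thesis .
qed

text \<open>Prescribing the exact trace on \<open>Q\<close>, not just an inclusion, makes the
  classes for different \<open>T\<close> disjoint, so that their sizes add up to the number of all
  embeddings.\<close>

definition hits :: "'b set \<Rightarrow> ('b \<Rightarrow> 'b \<Rightarrow> bool) \<Rightarrow> 'a set \<Rightarrow> ('a \<Rightarrow> 'a \<Rightarrow> bool) \<Rightarrow> 'a set \<Rightarrow> 'a set \<Rightarrow> ('b \<Rightarrow> 'a) set"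
  where "hits P R V E Q T = {f \<in> emb P R V E. f ` P \<inter> Q = T}"

lemma finite_hits: "\<lbrakk>finite P; finite V\<rbrakk> \<Longrightarrow> finite (hits P R V E Q T)"
  by (simp add: hits_def finite_emb)

lemma card_emb_eq_sum_hits:
  assumes "finite P" "finite V" "finite Q"
  shows "card (emb P R V E) = (\<Sum>T\<in>Pow Q. card (hits P R V E Q T))"
proof -
  have "emb P R V E = (\<Union>T\<in>Pow Q. hits P R V E Q T)" by (auto simp: hits_def)
  also have "card \<dots> = (\<Sum>T\<in>Pow Q. card (hits P R V E Q T))"
    by (rule card_UN_disjoint) (use assms in \<open>auto simp: finite_hits\<close>, auto simp: hits_def)
  finally show ?thesis .
qed

lemma card_emb_split2:
  fixes R :: "'b \<Rightarrow> 'b \<Rightarrow> bool" and E :: "'a \<Rightarrow> 'a \<Rightarrow> bool"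
  assumes "finite P" "finite V" "x \<noteq> y"
  defines "c \<equiv> \<lambda>T. card (hits P R V E {x, y} T)"
  shows "card (emb P R V E) = c {} + c {x} + c {y} + c {x, y}"
proof -
  have "Pow {x, y} = {{}, {x}, {y}, {x, y}}" by auto
  then show ?thesis
    using assms by (simp add: card_emb_eq_sum_hits[where Q = "{x, y}"] doubleton_eq_iff)
qed

lemma card_emb_split3:
  fixes R :: "'b \<Rightarrow> 'b \<Rightarrow> bool" and E :: "'a \<Rightarrow> 'a \<Rightarrow> bool"
  assumes "finite P" "finite V" "x \<noteq> y" "y \<noteq> z" "x \<noteq> z"
  defines "c \<equiv> \<lambda>T. card (hits P R V E {x, y, z} T)"
  shows "card (emb P R V E) =
    c {} + c {x} + c {y} + c {z} + c {x, y} + c {y, z} + c {x, z} + c {x, y, z}"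
proof -
  have P: "Pow {x, y, z} = {{}, {x}, {y}, {z}, {x, y}, {y, z}, {x, z}, {x, y, z}}"
    by (auto simp: Pow_insert)
  have "{x, y} \<noteq> {y, z}" "{x, y} \<noteq> {x, z}" "{y, z} \<noteq> {x, z}" "{x, y} \<noteq> {x, y, z}"
    "{y, z} \<noteq> {x, y, z}" "{x, z} \<noteq> {x, y, z}" "{x} \<noteq> {y, z}" "{x} \<noteq> {x, y, z}" "{x} \<noteq> {x, y}"
    "{x} \<noteq> {x, z}" "{y} \<noteq> {x, z}" "{y} \<noteq> {x, y}" "{y} \<noteq> {y, z}" "{y} \<noteq> {x, y, z}"
    "{z} \<noteq> {x, z}" "{z} \<noteq> {x, y}" "{z} \<noteq> {y, z}" "{z} \<noteq> {x, y, z}"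
    using assms(3-5) by (metis insert_iff empty_iff)+
  then show ?thesis
    using assms(1-5) unfolding c_def
    by (subst card_emb_eq_sum_hits[where Q = "{x, y, z}"]) (simp_all add: P)
qed

text \<open>Embeddings that avoid \<open>Q\<close> never test an adjacency at a vertex of
  \<open>Q\<close>, so modifications confined to such adjacencies leave this class
  unchanged.\<close>

lemma hits_empty_cong:
  assumes "\<And>u v. \<lbrakk>u \<in> V - Q; v \<in> V - Q\<rbrakk> \<Longrightarrow> E u v \<longleftrightarrow> E' u v"
  shows "hits P R V E Q {} = hits P R V E' Q {}"
proof -
  have "hits P R V E1 Q {} \<subseteq> hits P R V E2 Q {}"
    if "\<And>u v. \<lbrakk>u \<in> V - Q; v \<in> V - Q\<rbrakk> \<Longrightarrow> E1 u v \<Longrightarrow> E2 u v" for E1 E2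
  proof
    fix f assume "f \<in> hits P R V E1 Q {}"
    then have f: "f \<in> emb P R V E1" and q: "f ` P \<inter> Q = {}" by (auto simp: hits_def)
    have W: "f p \<in> V - Q" if "p \<in> P" for p using emb_D(1)[OF f that] q that by auto
    have "f \<in> emb P R V E2"
      by (rule emb_I) (use W emb_D[OF f] that in auto)
    then show "f \<in> hits P R V E2 Q {}" using q by (simp add: hits_def)
  qed
  from this[of E E'] this[of E' E] show ?thesis using assms by blast
qed

text \<open>The single label placed on \<open>q\<close> is moved to \<open>q'\<close>. Adjacency
  inside \<open>Q\<close> is never tested, since only one label lands there and \<open>R\<close> has
  no loops; hence only the neighbourhoods outside \<open>Q\<close> have to be compared.\<close>

lemma card_hits_single_le:
  assumes fin: "finite P" "finite V" and q: "q \<in> Q" "q' \<in> Q" "q' \<in> V" and R: "irreflp R"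
    and E: "\<And>u v. \<lbrakk>u \<in> V - Q; v \<in> V - Q; E u v\<rbrakk> \<Longrightarrow> E' u v"
    and Eq: "\<And>v. \<lbrakk>v \<in> V - Q; E q v\<rbrakk> \<Longrightarrow> E' q' v" "\<And>v. \<lbrakk>v \<in> V - Q; E v q\<rbrakk> \<Longrightarrow> E' v q'"
  shows "card (hits P R V E Q {q}) \<le> card (hits P R V E' Q {q'})"
proof (rule card_inj_on_le[where f = "\<lambda>f. restrict (\<lambda>p. if f p = q then q' else f p) P"])
  let ?s = "\<lambda>f. restrict (\<lambda>p. if f p = q then q' else f p) P"
  have W: "f p \<in> V - Q" if "f \<in> hits P R V E Q {q}" "p \<in> P" "f p \<noteq> q" for f p
  proof -
    have f: "f \<in> emb P R V E" "f ` P \<inter> Q = {q}" using that(1) by (simp_all add: hits_def)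
    have "f p \<notin> Q" using f(2) that(2,3) by blast
    then show ?thesis using emb_D(1)[OF f(1) that(2)] by simp
  qed
  show "inj_on ?s (hits P R V E Q {q})"
  proof (rule inj_onI)
    fix f g assume f: "f \<in> hits P R V E Q {q}" and g: "g \<in> hits P R V E Q {q}" and eq: "?s f = ?s g"
    have ext: "f \<in> extensional P" "g \<in> extensional P"
      using f g by (auto simp: hits_def dest: emb_D(2))
    show "f = g"
    proof (rule extensionalityI[OF ext])
      fix p assume p: "p \<in> P"
      then show "f p = g p"
        using fun_cong[OF eq, of p] W[OF f p] W[OF g p] q(2) by (auto split: if_splits)
    qed
  qed
  show "?s ` hits P R V E Q {q} \<subseteq> hits P R V E' Q {q'}"
  proof clarify
    fix f assume f: "f \<in> hits P R V E Q {q}"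
    then have f': "f \<in> emb P R V E" and fQ: "f ` P \<inter> Q = {q}" by (simp_all add: hits_def)
    have "q \<in> f ` P" using fQ by blast
    then obtain p0 where p0: "p0 \<in> P" "f p0 = q" by auto
    have uniq: "p = p0" if "p \<in> P" "f p = q" for p
      using emb_D(3)[OF f'] that p0 by (auto dest: inj_onD)
    have "?s f \<in> emb P R V E'"
    proof (rule emb_I)
      fix p assume "p \<in> P"
      then show "?s f p \<in> V" using q(3) emb_D(1)[OF f'] by auto
    next
      show "inj_on (?s f) P"
      proof (rule inj_onI)
        fix a b assume ab: "a \<in> P" "b \<in> P" "?s f a = ?s f b"
        then show "a = b"
          using W[OF f, of a] W[OF f, of b] q(2) emb_D(3)[OF f'] uniq
          by (auto split: if_splits dest: inj_onD)
      qed
    next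
      fix a b assume ab: "a \<in> P" "b \<in> P" "R a b"
      have "E (f a) (f b)" using emb_D(4)[OF f' ab] .
      moreover have "a \<noteq> b" using ab(3) R by (auto dest: irreflpD)
      ultimately show "E' (?s f a) (?s f b)"
        using ab W[OF f, of a] W[OF f, of b] E Eq uniq[of a] uniq[of b] by auto
    qed simp
    moreover have "?s f ` P \<inter> Q = {q'}"
    proof
      show "?s f ` P \<inter> Q \<subseteq> {q'}" using W[OF f] by auto
      show "{q'} \<subseteq> ?s f ` P \<inter> Q" using p0 q(2) by (auto intro!: image_eqI[of _ _ p0])
    qed
    ultimately show "?s f \<in> hits P R V E' Q {q'}" by (simp add: hits_def)
  qed
  show "finite (hits P R V E' Q {q'})" by (rule finite_hits[OF fin])
qed

lemma card_hits_single_eq: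
  assumes fin: "finite P" "finite V" and q: "q \<in> Q" "q' \<in> Q" "q \<in> V" "q' \<in> V" and R: "irreflp R"
    and sym: "symp E" "symp E'"
    and E: "\<And>u v. \<lbrakk>u \<in> V - Q; v \<in> V - Q\<rbrakk> \<Longrightarrow> E u v \<longleftrightarrow> E' u v"
    and Eq: "\<And>v. v \<in> V - Q \<Longrightarrow> E q v \<longleftrightarrow> E' q' v"
  shows "card (hits P R V E Q {q}) = card (hits P R V E' Q {q'})"
proof (rule antisym)
  show "card (hits P R V E Q {q}) \<le> card (hits P R V E' Q {q'})"
    by (rule card_hits_single_le[OF fin q(1,2,4) R]) (use E Eq sym in \<open>blast dest: sympD\<close>)+
  show "card (hits P R V E' Q {q'}) \<le> card (hits P R V E Q {q})"
    by (rule card_hits_single_le[OF fin q(2,1,3) R]) (use E Eq sym in \<open>blast dest: sympD\<close>)+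
qed

text \<open>The ordered pairs of labels that may be sent to a given pair of host vertices, \<open>adj\<close> telling whether
  the latter are adjacent.\<close>

definition placements :: "'b set \<Rightarrow> ('b \<Rightarrow> 'b \<Rightarrow> bool) \<Rightarrow> bool \<Rightarrow> ('b \<times> 'b) set" where
  "placements P R adj = {(a, b) \<in> P \<times> P. a \<noteq> b \<and> (R a b \<longrightarrow> adj)}"

lemma finite_placements: "finite P \<Longrightarrow> finite (placements P R adj)"
  by (rule finite_subset[of _ "P \<times> P"]) (auto simp: placements_def)

lemma placements_le: "finite P \<Longrightarrow> card (placements P R adj) \<le> card P ^ 2"
  by (rule order_trans[OF card_mono[of "P \<times> P"]]) (auto simp: placements_def power2_eq_square)

text \<open>An edge of \<open>R\<close> may be placed on adjacent vertices only. This gap of at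
  least 1 is the gain against which all error terms are weighed later.\<close>

lemma placements_less:
  assumes "finite P" "irreflp R" "a \<in> P" "b \<in> P" "R a b"
  shows "card (placements P R False) < card (placements P R True)"
proof (rule psubset_card_mono)
  have "(a, b) \<in> placements P R True - placements P R False"
    using assms by (auto simp: placements_def dest: irreflpD)
  then show "placements P R False \<subset> placements P R True" by (auto simp: placements_def)
qed (use assms in \<open>simp add: finite_placements\<close>)

text \<open>Union bound over the labels landing on \<open>q\<close> and \<open>q'\<close>; the
  remaining \<open>card P - 2\<close> labels are sent anywhere.\<close>

lemma card_hits_pair_le:
  assumes fin: "finite P" "finite V" and q: "q \<noteq> q'"
  shows "card (hits P R V E Q {q, q'}) \<le>
    card (placements P R (E q q')) * card V ^ (card P - 2)"
proof -
  let ?F = "\<lambda>(a, b). {f \<in> P \<rightarrow>\<^sub>E V. \<forall>x\<in>{a, b}. f x = (if x = a then q else q')}"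
  have "hits P R V E Q {q, q'} \<subseteq> (\<Union>ab\<in>placements P R (E q q'). ?F ab)"
  proof
    fix f assume "f \<in> hits P R V E Q {q, q'}"
    then have f: "f \<in> emb P R V E" and fQ: "f ` P \<inter> Q = {q, q'}" by (simp_all add: hits_def)
    from fQ have "q \<in> f ` P" "q' \<in> f ` P" by blast+
    then obtain a b where ab: "a \<in> P" "b \<in> P" "f a = q" "f b = q'" by blast
    have "(a, b) \<in> placements P R (E q q')"
      using ab q emb_D(4)[OF f ab(1,2)] by (auto simp: placements_def)
    moreover have "f \<in> ?F (a, b)" using ab q f by (auto simp: emb_def)
    ultimately show "f \<in> (\<Union>ab\<in>placements P R (E q q'). ?F ab)" by blast
  qed
  then have "card (hits P R V E Q {q, q'}) \<le> card (\<Union>ab\<in>placements P R (E q q'). ?F ab)"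
    by (rule card_mono[rotated]) (use fin in \<open>auto simp: finite_placements intro!: finite_PiE\<close>)
  also have "\<dots> \<le> (\<Sum>ab\<in>placements P R (E q q'). card (?F ab))"
    by (rule card_UN_le) (simp add: fin finite_placements)
  also have "\<dots> \<le> (\<Sum>ab\<in>placements P R (E q q'). card V ^ (card P - 2))"
  proof (rule sum_mono)
    fix i assume i: "i \<in> placements P R (E q q')"
    obtain a b where ab: "i = (a, b)" by fastforce
    with i have "{a, b} \<subseteq> P" "card {a, b} = 2" by (auto simp: placements_def)
    then show "card (?F i) \<le> card V ^ (card P - 2)"
      unfolding ab prod.case using card_fixed_le[OF fin, of "{a, b}" "\<lambda>x. if x = a then q else q'"]
      by (simp only:)
  qed
  finally show ?thesis by simp
qed

text \<open>Every placement extends greedily into \<open>V - Q\<close>, which keeps the trace on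
  \<open>Q\<close> equal to \<open>{q, q'}\<close>. Injectivity recovers the placement from the
  embedding, so the families for different placements do not overlap.\<close>

lemma card_hits_pair_ge:
  assumes fin: "finite P" "finite V" and Q: "Q \<subseteq> V" "q \<in> Q" "q' \<in> Q" "q \<noteq> q'"
    and k: "\<And>v. v \<in> V \<Longrightarrow> card {w \<in> V - Q. \<not> E v w} \<le> k"
    and E: "symp E" "irreflp E" and R: "symp R" "irreflp R"
  shows "card (placements P R (E q q')) * (card (V - Q) - card P * k) ^ (card P - 2)
    \<le> card (hits P R V E Q {q, q'})"
proof -
  let ?f0 = "\<lambda>a b. restrict (\<lambda>p. if p = a then q else q') {a, b}"
  let ?F = "\<lambda>(a, b). {f \<in> emb ({a, b} \<union> (P - {a, b})) R V E. (\<forall>p\<in>{a, b}. f p = ?f0 a b p) \<and>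
    f ` (P - {a, b}) \<subseteq> V - Q}"
  have PA: "{a, b} \<union> (P - {a, b}) = P" if "(a, b) \<in> placements P R (E q q')" for a b
    using that by (auto simp: placements_def)
  have F: "f \<in> emb P R V E" "f a = q" "f b = q'" "f ` (P - {a, b}) \<subseteq> V - Q"
    if "(a, b) \<in> placements P R (E q q')" "f \<in> ?F (a, b)" for a b f
  proof -
    have "a \<noteq> b" using that(1) by (simp add: placements_def)
    then show "f \<in> emb P R V E" "f a = q" "f b = q'" "f ` (P - {a, b}) \<subseteq> V - Q"
      using that(2) unfolding prod.case PA[OF that(1)] by simp_all
  qed
  have finF: "finite (?F (a, b))" if "(a, b) \<in> placements P R (E q q')" for a b
    unfolding prod.case PA[OF that] by (simp add: finite_emb[OF fin])
  have "card (placements P R (E q q')) * (card (V - Q) - card P * k) ^ (card P - 2)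
    = (\<Sum>ab\<in>placements P R (E q q'). (card (V - Q) - card P * k) ^ (card P - 2))" by simp
  also have "\<dots> \<le> (\<Sum>ab\<in>placements P R (E q q'). card (?F ab))"
  proof (rule sum_mono)
    fix i assume "i \<in> placements P R (E q q')"
    moreover obtain a b where i: "i = (a, b)" by fastforce
    ultimately have ab: "(a, b) \<in> placements P R (E q q')" by simp
    then have ab': "a \<in> P" "b \<in> P" "a \<noteq> b" "R a b \<longrightarrow> E q q'" "R b a \<longrightarrow> E q' q"
      using E(1) R(1) by (auto simp: placements_def dest: sympD)
    have "card (P - {a, b}) = card P - 2" using ab' fin by (subst card_Diff_subset) auto
    moreover have "?f0 a b \<in> emb {a, b} R V E"
      by (rule emb_I) (use ab' Q R(2) in \<open>auto simp: inj_on_def dest: irreflpD\<close>)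
    ultimately show "(card (V - Q) - card P * k) ^ (card P - 2) \<le> card (?F i)"
      using card_emb_extensions_ge[of V "{a, b}" "P - {a, b}" "V - Q" E k R "?f0 a b" "card P"]
      unfolding i prod.case PA[OF ab] using fin E R(2) k by simp
  qed
  also have "\<dots> = card (\<Union>ab\<in>placements P R (E q q'). ?F ab)"
  proof (rule card_UN_disjoint[symmetric])
    show "\<forall>i\<in>placements P R (E q q'). finite (?F i)" using finF by (intro ballI) (simp only: split_paired_all)
    show "\<forall>i\<in>placements P R (E q q'). \<forall>j\<in>placements P R (E q q'). i \<noteq> j \<longrightarrow> ?F i \<inter> ?F j = {}"
    proof (intro ballI impI, rule ccontr)
      fix i j assume ij: "i \<in> placements P R (E q q')" "j \<in> placements P R (E q q')"
        and ne: "i \<noteq> j" and "?F i \<inter> ?F j \<noteq> {}"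
      then obtain f where fij: "f \<in> ?F i" "f \<in> ?F j" by blast
      obtain a b c d where abcd: "i = (a, b)" "j = (c, d)" by fastforce
      note ab = ij(1)[unfolded abcd] and cd = ij(2)[unfolded abcd] and f = fij[unfolded abcd]
      have "a \<in> P" "b \<in> P" "c \<in> P" "d \<in> P" using ab cd by (auto simp: placements_def)
      then have "a = c" "b = d"
        using F(2,3)[OF ab f(1)] F(2,3)[OF cd f(2)] emb_D(3)[OF F(1)[OF ab f(1)]]
        by (auto dest: inj_onD)
      then show False using ne abcd by simp
    qed
  qed (simp add: fin finite_placements)
  also have "\<dots> \<le> card (hits P R V E Q {q, q'})"
  proof (rule card_mono[OF finite_hits[OF fin]], rule subsetI)
    fix f assume "f \<in> (\<Union>ab\<in>placements P R (E q q'). ?F ab)"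
    then obtain i where i: "i \<in> placements P R (E q q')" "f \<in> ?F i" by blast
    obtain a b where "i = (a, b)" by fastforce
    note ab = i(1)[unfolded this] and f = i(2)[unfolded this]
    have "a \<in> P" "b \<in> P" using ab by (auto simp: placements_def)
    then have "f ` P \<inter> Q = {q, q'}" using F(2-4)[OF ab f] Q by blast
    then show "f \<in> hits P R V E Q {q, q'}" using F(1)[OF ab f] by (simp add: hits_def)
  qed
  finally show ?thesis .
qed

text \<open>Three prescribed labels leave at most \<open>card V ^ (card P - 3)\<close> choices. The
  factor \<open>card V\<close> on the left brings the exponent to \<open>card P - 2\<close>, the
  order of the pair terms, and avoids a truncated exponent when there are fewer than three
  labels.\<close>

lemma card_hits_triple_le:
  assumes fin: "finite P" "finite V" and q: "x \<noteq> y" "y \<noteq> z" "x \<noteq> z"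
  shows "card V * card (hits P R V E Q {x, y, z}) \<le> card P ^ 3 * card V ^ (card P - 2)"
proof -
  let ?I = "{(a, b, c) \<in> P \<times> P \<times> P. a \<noteq> b \<and> b \<noteq> c \<and> a \<noteq> c}"
  let ?F = "\<lambda>(a, b, c). {f \<in> P \<rightarrow>\<^sub>E V. \<forall>p\<in>{a, b, c}. f p = (if p = a then x else if p = b then y else z)}"
  have finI: "finite ?I" by (rule finite_subset[of _ "P \<times> P \<times> P"]) (use fin in auto)
  have "hits P R V E Q {x, y, z} \<subseteq> (\<Union>t\<in>?I. ?F t)"
  proof
    fix f assume "f \<in> hits P R V E Q {x, y, z}"
    then have f: "f \<in> emb P R V E" and fQ: "f ` P \<inter> Q = {x, y, z}" by (simp_all add: hits_def)
    from fQ have "x \<in> f ` P" "y \<in> f ` P" "z \<in> f ` P" by blast+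
    then obtain a b c where abc: "a \<in> P" "b \<in> P" "c \<in> P" "f a = x" "f b = y" "f c = z" by blast
    then have "(a, b, c) \<in> ?I" using q by auto
    moreover have "f \<in> ?F (a, b, c)" using abc q f by (auto simp: emb_def)
    ultimately show "f \<in> (\<Union>t\<in>?I. ?F t)" by blast
  qed
  then have "card (hits P R V E Q {x, y, z}) \<le> card (\<Union>t\<in>?I. ?F t)"
    by (rule card_mono[rotated]) (use fin finI in \<open>auto intro!: finite_PiE\<close>)
  also have "\<dots> \<le> (\<Sum>t\<in>?I. card (?F t))"
    by (rule card_UN_le[OF finI])
  finally have "card V * card (hits P R V E Q {x, y, z}) \<le> (\<Sum>t\<in>?I. card V * card (?F t))"
    by (simp add: sum_distrib_left[symmetric])
  also have "\<dots> \<le> (\<Sum>t\<in>?I. card V ^ (card P - 2))"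
  proof (rule sum_mono)
    fix t assume "t \<in> ?I"
    then obtain a b c where t: "t = (a, b, c)"
      and abc: "a \<in> P" "b \<in> P" "c \<in> P" "a \<noteq> b" "b \<noteq> c" "a \<noteq> c" by blast
    then have "{a, b, c} \<subseteq> P" and c3: "card {a, b, c} = 3" by auto
    then have "3 \<le> card P" using card_mono[OF fin(1)] by metis
    then have "card P - 2 = Suc (card P - 3)" by simp
    moreover have "card (?F (a, b, c)) \<le> card V ^ (card P - 3)"
      unfolding prod.case c3[symmetric] by (rule card_fixed_le[OF fin \<open>{a, b, c} \<subseteq> P\<close>])
    ultimately show "card V * card (?F t) \<le> card V ^ (card P - 2)" unfolding t by (simp only: power_Suc mult_le_mono2)
  qed
  also have "\<dots> \<le> card P ^ 3 * card V ^ (card P - 2)"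
  proof -
    have "card ?I \<le> card (P \<times> P \<times> P)" by (rule card_mono) (use fin in auto)
    then have "card ?I \<le> card P ^ 3" by (simp add: power3_eq_cube mult.assoc card_cartesian_product)
    then show ?thesis by (simp only: sum_constant of_nat_id mult_le_mono1)
  qed
  finally show ?thesis .
qed

section \<open>Every graph is eventually Turan-good\<close>

text \<open>A mean value estimate: lowering the base by \<open>t\<close> costs at most
  \<open>m * t\<close> times the next lower power. Written additively, it also covers
  \<open>t > n\<close>, where \<open>n - t\<close> is 0.\<close>

lemma power_le_power_diff:
  fixes n t m :: nat
  shows "n ^ m \<le> (n - t) ^ m + m * t * n ^ (m - 1)"
proof (induction m)
  case (Suc m)
  have *: "n * n ^ (m - 1) * m = n ^ m * m" by (cases m) auto
  have "n ^ Suc m \<le> n * (n - t) ^ m + n * (m * t * n ^ (m - 1))"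
    using mult_le_mono2[OF Suc.IH, of n] by (simp add: algebra_simps)
  also have "n * (m * t * n ^ (m - 1)) = m * t * n ^ m" using * by (simp add: algebra_simps)
  also have "n * (n - t) ^ m \<le> (n - t) * (n - t) ^ m + t * (n - t) ^ m"
    unfolding add_mult_distrib[symmetric] by (rule mult_le_mono1) simp
  also have "t * (n - t) ^ m \<le> t * n ^ m" by (intro mult_le_mono2 power_mono) auto
  finally show ?case by (simp add: algebra_simps)
qed simp

text \<open>The power loses at most the fraction \<open>1 / (20 * h ^ 2)\<close> of its value. As
  there are at most \<open>h ^ 2\<close> placements, the constant 20 keeps the total error of the
  later comparisons below the gain of a single placement.\<close>

lemma power_diff_approx:
  fixes n t h :: nat
  assumes "20 * h ^ 3 * t \<le> n" "0 < n"
  shows "20 * h ^ 2 * n ^ (h - 2) \<le> 20 * h ^ 2 * (n - t) ^ (h - 2) + n ^ (h - 2)"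
proof -
  define N where "N = n ^ (h - 2)"
  define L where "L = (n - t) ^ (h - 2)"
  have "n * N \<le> n * L + n * ((h - 2) * t * n ^ (h - 2 - 1))"
    using mult_le_mono2[OF power_le_power_diff[of n "h - 2" t], of n]
    by (simp add: N_def L_def algebra_simps)
  also have "n * ((h - 2) * t * n ^ (h - 2 - 1)) = (h - 2) * t * N"
    by (cases "h - 2") (auto simp: N_def)
  also have "\<dots> \<le> h * t * N" by simp
  finally have "20 * h ^ 2 * (n * N) \<le> 20 * h ^ 2 * (n * L + h * t * N)" by (rule mult_le_mono2) simp
  also have "\<dots> = n * (20 * h ^ 2 * L) + 20 * h ^ 3 * t * N"
    by (simp add: algebra_simps power2_eq_square power3_eq_cube)
  also have "\<dots> \<le> n * (20 * h ^ 2 * L) + n * N" using assms(1) by simp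
  finally have "n * (20 * h ^ 2 * N) \<le> n * (20 * h ^ 2 * L + N)" by (simp add: algebra_simps)
  then show ?thesis using assms(2) by (simp add: N_def L_def)
qed

section \<open>Hosts with bounded clique number, and cloning of vertices\<close>

definition clique_le :: "nat \<Rightarrow> 'a set \<Rightarrow> ('a \<Rightarrow> 'a \<Rightarrow> bool) \<Rightarrow> bool" where
  "clique_le r V E \<longleftrightarrow> (\<forall>C\<subseteq>V. (\<forall>a\<in>C. \<forall>b\<in>C. a \<noteq> b \<longrightarrow> E a b) \<longrightarrow> card C \<le> r)"

text \<open>Symmetry and irreflexivity are global while the clique bound refers to \<open>V\<close>,
  so one adjacency can be used on several vertex sets, for example on a common neighbourhood with a
  smaller bound.\<close>

definition host :: "nat \<Rightarrow> 'a set \<Rightarrow> ('a \<Rightarrow> 'a \<Rightarrow> bool) \<Rightarrow> bool" where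
  "host r V E \<longleftrightarrow> symp E \<and> irreflp E \<and> clique_le r V E"

text \<open>All cloning operations are pullbacks along a vertex map. Vertices with the same image
  become non-adjacent because \<open>E\<close> is irreflexive, so \<open>s\<close> is injective on
  every clique of the new graph and carries it to a clique of the old one.\<close>

lemma host_pullback:
  assumes E: "host r V E" and s: "\<And>v. v \<in> V \<Longrightarrow> s v \<in> V"
  shows "host r V (\<lambda>u v. E (s u) (s v))"
proof -
  have irr: "\<not> E x x" for x using E by (auto simp: host_def dest: irreflpD)
  have "clique_le r V (\<lambda>u v. E (s u) (s v))"
    unfolding clique_le_def
  proof (intro allI impI)
    fix C assume C: "C \<subseteq> V" "\<forall>a\<in>C. \<forall>b\<in>C. a \<noteq> b \<longrightarrow> E (s a) (s b)"
    have "inj_on s C"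
    proof (rule inj_onI, rule ccontr)
      fix a b assume "a \<in> C" "b \<in> C" "s a = s b" "a \<noteq> b"
      then show False using C(2) irr[of "s a"] by metis
    qed
    moreover have "s ` C \<subseteq> V" using C(1) s by auto
    moreover have "\<forall>a\<in>s ` C. \<forall>b\<in>s ` C. a \<noteq> b \<longrightarrow> E a b" using C(2) by auto
    ultimately show "card C \<le> r"
      using E by (auto simp: host_def clique_le_def card_image[symmetric])
  qed
  then show ?thesis using E by (auto simp: host_def symp_def irreflp_def)
qed

text \<open>The edge is what separates placements on adjacent pairs from those on non-adjacent
  pairs; edgeless label graphs are treated apart in
  \<open>turan_maximises_embeddings\<close>.\<close>

locale label_graph =
  fixes P :: "'b set" and R :: "'b \<Rightarrow> 'b \<Rightarrow> bool"
  assumes finP: "finite P" and symR: "symp R" and irrR: "irreflp R"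
    and edge: "\<exists>a\<in>P. \<exists>b\<in>P. R a b"
begin

abbreviation "h \<equiv> card P"
abbreviation "pF \<equiv> card (placements P R False)"
abbreviation "pT \<equiv> card (placements P R True)"

lemma pT_le: "pT \<le> h ^ 2" by (rule placements_le[OF finP])

lemma pF_less_pT: "pF < pT"
  using edge placements_less[OF finP irrR] by blast

text \<open>The base is weakened to \<open>card V - (3 + h * k)\<close> so that one quantity serves
  for sets \<open>Q\<close> of two and of three vertices.\<close>

lemma hits_pair_ge:
  assumes V: "finite V" and Q: "Q \<subseteq> V" "q \<in> Q" "q' \<in> Q" "q \<noteq> q'" "card Q \<le> 3"
    and E: "symp E" "irreflp E" and k: "\<And>v. v \<in> V \<Longrightarrow> card {w \<in> V - Q. \<not> E v w} \<le> k"
  shows "card (placements P R (E q q')) * (card V - (3 + h * k)) ^ (h - 2) \<le> card (hits P R V E Q {q, q'})"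
proof -
  have "card V - (3 + h * k) \<le> card (V - Q) - h * k"
    using Q(1,5) V by (subst card_Diff_subset) (auto intro: finite_subset)
  then have "(card V - (3 + h * k)) ^ (h - 2) \<le> (card (V - Q) - h * k) ^ (h - 2)"
    by (rule power_mono) simp
  then show ?thesis
    using card_hits_pair_ge[OF finP V Q(1-4) k E symR irrR] by (meson le_trans mult_le_mono2)
qed

lemma nonadjacency_transitive:
  fixes V :: "'a set"
  assumes V: "finite V" and E: "host r V E"
    and max: "\<And>E'. host r V E' \<Longrightarrow> card (emb P R V E') \<le> card (emb P R V E)"
    and k: "\<And>v. v \<in> V \<Longrightarrow> card {w \<in> V. \<not> E v w} \<le> k"
    and n: "20 * h ^ 3 * (3 + h * k) \<le> card V"
    and xyz: "x \<in> V" "y \<in> V" "z \<in> V" "x \<noteq> y" "y \<noteq> z" "x \<noteq> z" "\<not> E x y" "\<not> E y z"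
  shows "\<not> E x z"
proof
  assume xz: "E x z"
  have symE: "symp E" and irrE: "irreflp E" using E by (auto simp: host_def)
  have irr: "\<not> E v v" for v using irrE by (auto dest: irreflpD)
  let ?Q = "{x, y, z}"
  \<comment> \<open>\<open>pb s\<close> turns each vertex into a clone of its image under
    \<open>s\<close>.\<close>
  define pb where "pb = (\<lambda>(s :: 'a \<Rightarrow> 'a) u v. E (s u) (s v))"
  have Q: "?Q \<subseteq> V" "card ?Q \<le> 3" using xyz by auto
  have zx: "E z x" using xz symE by (auto dest: sympD)
  have host: "host r V (pb s)" if "\<And>v. v \<in> V \<Longrightarrow> s v \<in> V" for s
    unfolding pb_def by (rule host_pullback[OF E that])
  define c where "c = (\<lambda>E T. card (hits P R V E ?Q T))"
  define N where "N = card V ^ (h - 2)"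
  define L where "L = (card V - (3 + h * k)) ^ (h - 2)"
  have split: "card (emb P R V E) = c E {} + c E {x} + c E {y} + c E {z} +
     c E {x, y} + c E {y, z} + c E {x, z} + c E {x, y, z}" for E
    unfolding c_def by (rule card_emb_split3[OF finP V xyz(4-6)])
  have pb0: "c (pb s) {} = c E {}" if "\<And>v. v \<notin> ?Q \<Longrightarrow> s v = v" for s
    unfolding c_def by (subst hits_empty_cong[of V ?Q "pb s" E]) (auto simp: pb_def that)
  have pb1: "c (pb s) {q} = c E {s q}"
    if s: "\<And>v. v \<notin> ?Q \<Longrightarrow> s v = v" and sQ: "\<And>v. v \<in> ?Q \<Longrightarrow> s v \<in> ?Q" and q: "q \<in> ?Q" for s q
    unfolding c_def
  proof (rule card_hits_single_eq[OF finP V q sQ[OF q] _ _ irrR])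
    show "symp (pb s)" using symE by (auto simp: pb_def symp_def)
  qed (use symE Q q sQ[OF q] s in \<open>auto simp: pb_def\<close>)
  \<comment> \<open>\<open>s\<close> is the identity outside \<open>?Q\<close>, so the
    non-neighbours of \<open>v\<close> there after cloning are non-neighbours of \<open>s v\<close>
    in \<open>E\<close>, and the bound \<open>k\<close> survives.\<close>
  have pb2: "card (placements P R (E (s q) (s q'))) * L \<le> c (pb s) {q, q'}"
    if s: "\<And>v. v \<notin> ?Q \<Longrightarrow> s v = v" and sQ: "\<And>v. v \<in> ?Q \<Longrightarrow> s v \<in> ?Q"
      and q: "q \<in> ?Q" "q' \<in> ?Q" "q \<noteq> q'" for s q q'
  proof -
    have "card {w \<in> V - ?Q. \<not> pb s v w} \<le> k" if v: "v \<in> V" for v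
    proof -
      have "s v \<in> V" using s[of v] sQ[of v] v Q by (cases "v \<in> ?Q") auto
      have "card {w \<in> V - ?Q. \<not> pb s v w} \<le> card {w \<in> V. \<not> E (s v) w}"
        by (rule card_mono) (use V s in \<open>auto simp: pb_def\<close>)
      then show ?thesis using k[OF \<open>s v \<in> V\<close>] by simp
    qed
    moreover have "symp (pb s)" "irreflp (pb s)" using symE irrE by (auto simp: pb_def symp_def irreflp_def)
    ultimately have "card (placements P R (pb s q q')) * L \<le> c (pb s) {q, q'}"
      unfolding c_def L_def using hits_pair_ge[OF V Q(1) q Q(2)] by blast
    then show ?thesis by (simp add: pb_def)
  qed
  define s1 where "s1 = id(y := x)"
  define s2 where "s2 = id(y := z)"
  define s3 where "s3 = id(x := y, z := y)"
  have s1: "s1 x = x" "s1 y = x" "s1 z = z" "\<And>v. v \<notin> ?Q \<Longrightarrow> s1 v = v" "\<And>v. v \<in> ?Q \<Longrightarrow> s1 v \<in> ?Q"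
    using xyz by (auto simp: s1_def)
  have s2: "s2 x = x" "s2 y = z" "s2 z = z" "\<And>v. v \<notin> ?Q \<Longrightarrow> s2 v = v" "\<And>v. v \<in> ?Q \<Longrightarrow> s2 v \<in> ?Q"
    using xyz by (auto simp: s2_def)
  have s3: "s3 x = y" "s3 y = y" "s3 z = y" "\<And>v. v \<notin> ?Q \<Longrightarrow> s3 v = v" "\<And>v. v \<in> ?Q \<Longrightarrow> s3 v \<in> ?Q"
    using xyz by (auto simp: s3_def)
  text \<open>In the sum of these three inequalities the terms for single vertices add up to those of three
    copies of \<open>E\<close>, while an edge inside \<open>{x, y, z}\<close> occurs four times instead of three.\<close>
  have G1: "c E {} + 2 * c E {x} + c E {z} + (pF + 2 * pT) * L \<le> card (emb P R V (pb s1))"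
    using pb0[of s1] pb1[of s1 x] pb1[of s1 y] pb1[of s1 z] pb2[of s1 x y] pb2[of s1 y z] pb2[of s1 x z]
      s1 xyz xz irr
    unfolding split[of "pb s1"] by (simp add: algebra_simps)
  have G2: "c E {} + c E {x} + 2 * c E {z} + (pF + 2 * pT) * L \<le> card (emb P R V (pb s2))"
    using pb0[of s2] pb1[of s2 x] pb1[of s2 y] pb1[of s2 z] pb2[of s2 x y] pb2[of s2 y z] pb2[of s2 x z]
      s2 xyz xz zx irr
    unfolding split[of "pb s2"] by (simp add: algebra_simps)
  have G3: "c E {} + 3 * c E {y} + 3 * pF * L \<le> card (emb P R V (pb s3))"
    using pb0[of s3] pb1[of s3 x] pb1[of s3 y] pb1[of s3 z] pb2[of s3 x y] pb2[of s3 y z] pb2[of s3 x z]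
      s3 xyz xz irr
    unfolding split[of "pb s3"] by (simp add: algebra_simps)
  have le: "card (emb P R V (pb s)) \<le> card (emb P R V E)" if "s \<in> {s1, s2, s3}" for s
    by (rule max, rule host) (use that xyz in \<open>auto simp: s1_def s2_def s3_def\<close>)
  have up: "c E {x, y} \<le> pF * N" "c E {y, z} \<le> pF * N" "c E {x, z} \<le> pT * N"
    using card_hits_pair_le[OF finP V xyz(4), of R E ?Q] card_hits_pair_le[OF finP V xyz(5), of R E ?Q]
      card_hits_pair_le[OF finP V xyz(6), of R E ?Q] xyz xz by (simp_all add: c_def N_def)
  \<comment> \<open>The pairs of three copies of \<open>E\<close> contribute at most
    \<open>6 * pF + 3 * pT\<close> in units of \<open>N\<close>, those of the three modifications at
    least \<open>5 * pF + 4 * pT\<close> in units of \<open>L\<close>. Triples are discarded for the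
    modifications and kept for \<open>E\<close>.\<close>
  have "(5 * pF + 4 * pT) * L \<le> (6 * pF + 3 * pT) * N + 3 * c E {x, y, z}"
    using G1 G2 G3 le[of s1] le[of s2] le[of s3] up unfolding split[of E]
    by (simp add: algebra_simps)
  then have main: "(5 * real pF + 4 * real pT) * real L \<le> (6 * real pF + 3 * real pT) * real N + 3 * real (c E {x, y, z})"
    using of_nat_mono[where 'a = real, of "(5 * pF + 4 * pT) * L" "(6 * pF + 3 * pT) * N + 3 * c E {x, y, z}"]
    by simp
  have h0: "0 < h" using edge finP by (auto simp: card_gt_0_iff)
  have n0: "0 < card V" using V xyz(1) by (auto simp: card_gt_0_iff)
  have N0: "0 < N" using n0 by (simp add: N_def)
  have "20 * h ^ 3 \<le> card V" by (rule order_trans[OF _ n]) simp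
  then have "20 * (card V * c E {x, y, z}) \<le> card V * N"
  proof -
    have "card V * c E {x, y, z} \<le> h ^ 3 * N"
      unfolding c_def N_def by (rule card_hits_triple_le[OF finP V xyz(4-6)])
    then have "20 * (card V * c E {x, y, z}) \<le> 20 * h ^ 3 * N" by simp
    also have "\<dots> \<le> card V * N" by (rule mult_le_mono1) fact
    finally show ?thesis .
  qed
  then have "card V * (20 * c E {x, y, z}) \<le> card V * N" by (simp add: algebra_simps)
  then have c3: "20 * real (c E {x, y, z}) \<le> real N"
    using n0 of_nat_mono[where 'a = real, of "20 * c E {x, y, z}" N] by simp
  have "20 * h ^ 2 * N \<le> 20 * h ^ 2 * L + N"
    unfolding N_def L_def by (rule power_diff_approx[OF n n0])
  then have NL: "20 * real h ^ 2 * (real N - real L) \<le> real N"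
    using of_nat_mono[where 'a = real, of "20 * h ^ 2 * N" "20 * h ^ 2 * L + N"] by (simp add: algebra_simps)
  have LN: "real L \<le> real N" unfolding L_def N_def by (simp add: power_mono)
  have "real pT \<le> real h ^ 2" using of_nat_mono[where 'a = real, OF pT_le] by simp
  moreover have pp: "real pF + 1 \<le> real pT" using pF_less_pT by linarith
  ultimately have "5 * real pF + 4 * real pT \<le> 9 * real h ^ 2" by linarith
  \<comment> \<open>The gain \<open>(pT - pF) * N\<close> is at least \<open>N\<close>, whereas
    passing from \<open>N\<close> to \<open>L\<close> costs at most \<open>9/20 * N\<close> and the
    triples at most \<open>3/20 * N\<close>: a contradiction.\<close>
  then have "(5 * real pF + 4 * real pT) * (real N - real L) \<le> 9 * real h ^ 2 * (real N - real L)"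
    using LN by (intro mult_right_mono) auto
  moreover have "(real pF + 1) * real N \<le> real pT * real N" using pp by (intro mult_right_mono) auto
  moreover note NL main c3 N0
  ultimately show False by (simp add: algebra_simps)
qed

text \<open>Replacing \<open>x\<close> by a clone of \<open>y\<close> shows that \<open>x\<close> lies in nearly as many embeddings as \<open>y\<close>, hence in
  nearly the average number of them; but each non-neighbour of \<open>x\<close> costs about \<open>n\<^bsup>h-2\<^esup>\<close> embeddings.\<close>

lemma codegree_bound:
  assumes V: "finite V" and E: "host r V E"
    and max: "\<And>E'. host r V E' \<Longrightarrow> card (emb P R V E') \<le> card (emb P R V E)"
    and x: "x \<in> V"
  shows "card {w \<in> V. \<not> E x w} * card V ^ (h - 1) + h * card (emb P R V E)
    \<le> h * card V ^ h + h ^ 2 * card V ^ (h - 1)"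
proof -
  define n where "n = card V"
  define L where "L = (\<lambda>v. card {f \<in> emb P R V E. v \<in> f ` P})"
  have symE: "symp E" and irrE: "irreflp E" using E by (auto simp: host_def)
  have fe: "finite (emb P R V E)" by (rule finite_emb[OF finP V])
  obtain a0 b0 where ab: "a0 \<in> P" "b0 \<in> P" "R a0 b0" using edge by blast
  then have ab': "a0 \<noteq> b0" using irrR by (auto dest: irreflpD)
  have h2: "2 \<le> h" using card_mono[OF finP, of "{a0, b0}"] ab ab' by simp
  have n0: "0 < n" using V x by (auto simp: n_def card_gt_0_iff)
  have nh: "n * n ^ (h - 2) = n ^ (h - 1)" "n * n ^ (h - 1) = n ^ h"
  proof -
    have "Suc (h - 2) = h - 1" "Suc (h - 1) = h" using h2 by simp_all
    then show "n * n ^ (h - 2) = n ^ (h - 1)" "n * n ^ (h - 1) = n ^ h" by (metis power_Suc)+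
  qed
  have L_le: "L y \<le> L x + h ^ 2 * n ^ (h - 2)" if y: "y \<in> V" for y
  proof (cases "x = y")
    case False
    define s where "s = id(x := y)"
    define E' where "E' = (\<lambda>u v. E (s u) (s v))"
    define c where "c = (\<lambda>E T. card (hits P R V E {x, y} T))"
    have "host r V E'" unfolding E'_def by (rule host_pullback[OF E]) (use y in \<open>auto simp: s_def\<close>)
    then have "card (emb P R V E') \<le> card (emb P R V E)" by (rule max)
    moreover have sp: "card (emb P R V E) = c E {} + c E {x} + c E {y} + c E {x, y}" for E
      unfolding c_def by (rule card_emb_split2[OF finP V False])
    moreover have "c E' {} = c E {}"
      unfolding c_def by (subst hits_empty_cong[of V "{x, y}" E' E]) (auto simp: E'_def s_def)
    moreover have symE': "symp E'" using symE by (auto simp: E'_def symp_def)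
    have "c E' {q} = c E {y}" if "q \<in> {x, y}" for q
      unfolding c_def by (rule card_hits_single_eq[OF finP V that _ _ _ irrR symE' symE])
        (use x y that in \<open>auto simp: E'_def s_def\<close>)
    \<comment> \<open>In \<open>E'\<close> both single classes have size \<open>c E {y}\<close>, and
      maximality gives the inequality once \<open>c E' {x, y}\<close> is dropped. Since
      \<open>L v\<close> is the single class of \<open>v\<close> plus the pair class,
      \<open>L y\<close> exceeds \<open>L x\<close> by at most one pair class.\<close>
    ultimately have "c E {y} \<le> c E {x} + c E {x, y}" by simp
    moreover have "c E {x, y} \<le> h ^ 2 * n ^ (h - 2)"
      unfolding c_def n_def
      using order_trans[OF card_hits_pair_le[OF finP V False] mult_le_mono1[OF placements_le[OF finP]]] .
    moreover have "L v = c E {v} + c E {x, y}" if v: "v \<in> {x, y}" for v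
    proof -
      have "{f \<in> emb P R V E. v \<in> f ` P} = hits P R V E {x, y} {v} \<union> hits P R V E {x, y} {x, y}"
        unfolding hits_def using v by blast
      moreover have "hits P R V E {x, y} {v} \<inter> hits P R V E {x, y} {x, y} = {}"
        using False v by (auto simp: hits_def)
      ultimately show ?thesis
        unfolding L_def c_def by (simp add: card_Un_disjoint finite_hits[OF finP V])
    qed
    ultimately show ?thesis by simp
  qed simp
  \<comment> \<open>Double counting of the pairs of an embedding and a vertex in its image.\<close>
  have "h * card (emb P R V E) = (\<Sum>f\<in>emb P R V E. card {v \<in> V. v \<in> f ` P})"
  proof -
    have "card {v \<in> V. v \<in> f ` P} = h" if f: "f \<in> emb P R V E" for f
    proof -
      have "{v \<in> V. v \<in> f ` P} = f ` P" using emb_D(5)[OF f] by blast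
      then show ?thesis using card_image[OF emb_D(3)[OF f]] by simp
    qed
    then show ?thesis by simp
  qed
  also have "\<dots> = (\<Sum>f\<in>emb P R V E. \<Sum>v\<in>V. if v \<in> f ` P then 1 else 0)"
    using V by (simp add: sum.If_cases Int_def)
  also have "\<dots> = (\<Sum>v\<in>V. \<Sum>f\<in>emb P R V E. if v \<in> f ` P then 1 else 0)" by (rule sum.swap)
  also have "\<dots> = (\<Sum>v\<in>V. L v)" using fe by (simp add: sum.If_cases Int_def L_def)
  also have "\<dots> \<le> (\<Sum>v\<in>V. L x + h ^ 2 * n ^ (h - 2))" by (rule sum_mono) (rule L_le)
  also have "\<dots> = n * L x + h ^ 2 * n ^ (h - 1)"
    using nh by (simp add: n_def algebra_simps)
  finally have A: "h * card (emb P R V E) \<le> n * L x + h ^ 2 * n ^ (h - 1)" .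
  define d where "d = card {w \<in> V. \<not> E x w}"
  \<comment> \<open>If \<open>a0\<close> sits at \<open>x\<close>, its neighbour \<open>b0\<close>
    has to avoid the \<open>d\<close> non-neighbours of \<open>x\<close>. For the other labels at
    \<open>x\<close> the trivial bound \<open>n ^ (h - 1)\<close> is enough.\<close>
  have "L x + d * n ^ (h - 2) \<le> h * n ^ (h - 1)"
  proof -
    let ?G = "\<lambda>a. {f \<in> emb P R V E. f a = x}"
    have "L x \<le> card (\<Union>a\<in>P. ?G a)"
      unfolding L_def by (rule card_mono) (use fe finP in auto)
    also have "\<dots> \<le> (\<Sum>a\<in>P. card (?G a))" by (rule card_UN_le[OF finP])
    also have "\<dots> = card (?G a0) + (\<Sum>a\<in>P - {a0}. card (?G a))" using finP ab by (simp add: sum.remove)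
    also have "(\<Sum>a\<in>P - {a0}. card (?G a)) \<le> (\<Sum>a\<in>P - {a0}. n ^ (h - 1))"
    proof (rule sum_mono)
      fix a assume a: "a \<in> P - {a0}"
      have "card (?G a) \<le> card {f \<in> P \<rightarrow>\<^sub>E V. \<forall>p\<in>{a}. f p = x}"
        by (rule card_mono) (use finP V in \<open>auto simp: emb_def intro!: finite_PiE\<close>)
      also have "\<dots> \<le> card V ^ (h - card {a})"
        using card_fixed_le[OF finP V, of "{a}" "\<lambda>_. x"] a by blast
      finally show "card (?G a) \<le> n ^ (h - 1)" by (simp add: n_def)
    qed
    also have "(\<Sum>a\<in>P - {a0}. n ^ (h - 1)) = (h - 1) * n ^ (h - 1)" using finP ab by simp
    finally have 1: "L x \<le> card (?G a0) + (h - 1) * n ^ (h - 1)" by simp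
    let ?T = "\<lambda>p. if p = a0 then {x} else if p = b0 then {w \<in> V. E x w} else V"
    have "card (?G a0) \<le> card (PiE P ?T)"
    proof (rule card_mono)
      show "finite (PiE P ?T)" using finP V by (intro finite_PiE) auto
      show "?G a0 \<subseteq> PiE P ?T" using ab by (auto simp: emb_def PiE_def Pi_def)
    qed
    also have "\<dots> = (\<Prod>p\<in>P. card (?T p))" by (rule card_PiE[OF finP])
    also have "\<dots> = card (?T a0) * (card (?T b0) * (\<Prod>p\<in>P - {a0} - {b0}. card (?T p)))"
      using finP ab ab' by (simp add: prod.remove[of P a0] prod.remove[of "P - {a0}" b0])
    also have "(\<Prod>p\<in>P - {a0} - {b0}. card (?T p)) = (\<Prod>p\<in>P - {a0} - {b0}. n)"
      by (rule prod.cong) (auto simp: n_def)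
    also have "\<dots> = n ^ (h - 2)" using finP ab ab' by (simp add: numeral_2_eq_2)
    finally have 2: "card (?G a0) \<le> card {w \<in> V. E x w} * n ^ (h - 2)" using ab' by simp
    have "card {w \<in> V. E x w} + d = n"
    proof -
      have "card ({w \<in> V. E x w} \<union> {w \<in> V. \<not> E x w}) = card {w \<in> V. E x w} + d"
        unfolding d_def using V by (intro card_Un_disjoint) auto
      moreover have "{w \<in> V. E x w} \<union> {w \<in> V. \<not> E x w} = V" by auto
      ultimately show ?thesis by (simp add: n_def)
    qed
    then have "card {w \<in> V. E x w} * n ^ (h - 2) + d * n ^ (h - 2) = n ^ (h - 1)"
      using nh by (simp flip: add_mult_distrib)
    then have "L x + d * n ^ (h - 2) \<le> n ^ (h - 1) + (h - 1) * n ^ (h - 1)" using 1 2 by linarith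
    also have "\<dots> = h * n ^ (h - 1)" using h2 by (simp flip: mult_Suc)
    finally show ?thesis .
  qed
  then have "n * (L x + d * n ^ (h - 2)) \<le> n * (h * n ^ (h - 1))" by (rule mult_le_mono2)
  then have "n * L x + d * n ^ (h - 1) \<le> h * n ^ h"
    unfolding nh(1,2)[symmetric] by (simp only: algebra_simps)
  then show ?thesis using A unfolding d_def n_def by linarith
qed

end

subsection \<open>Complete multipartite graphs\<close>

definition differ :: "('a \<Rightarrow> 'c) \<Rightarrow> 'a \<Rightarrow> 'a \<Rightarrow> bool" where
  "differ col u v \<longleftrightarrow> col u \<noteq> col v"

lemma host_differ:
  assumes "finite V" "col ` V \<subseteq> C" "finite C" "card C \<le> r"
  shows "host r V (differ col)"
proof -
  have "card K \<le> r" if K: "K \<subseteq> V" "\<forall>a\<in>K. \<forall>b\<in>K. a \<noteq> b \<longrightarrow> col a \<noteq> col b" for K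
  proof -
    have "inj_on col K" using K(2) by (auto simp: inj_on_def)
    then have "card K \<le> card C" using K(1) assms by (intro card_inj_on_le) auto
    then show ?thesis using assms(4) by simp
  qed
  then show ?thesis by (auto simp: host_def differ_def symp_def irreflp_def clique_le_def)
qed

lemma card_emb_differ_eq:
  assumes fin: "finite P" "finite V" "finite V'"
    and col: "col ` V \<subseteq> C" and col': "col' ` V' \<subseteq> C'" and \<pi>: "bij_betw \<pi> C C'"
    and sizes: "\<And>c. c \<in> C \<Longrightarrow> card {v \<in> V. col v = c} = card {v \<in> V'. col' v = \<pi> c}"
  shows "card (emb P R V (differ col)) = card (emb P R V' (differ col'))"
proof -
  have "\<exists>f. bij_betw f {v \<in> V. col v = c} {v \<in> V'. col' v = \<pi> c}" if "c \<in> C" for c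
    using sizes[OF that] fin by (intro finite_same_card_bij) auto
  then obtain F where F: "\<And>c. c \<in> C \<Longrightarrow> bij_betw (F c) {v \<in> V. col v = c} {v \<in> V'. col' v = \<pi> c}"
    by metis
  define \<phi> where "\<phi> v = F (col v) v" for v
  have \<phi>: "\<phi> v \<in> V'" "col' (\<phi> v) = \<pi> (col v)" if "v \<in> V" for v
    using bij_betw_apply[OF F[of "col v"], of v] that col by (auto simp: \<phi>_def)
  have inj\<pi>: "inj_on \<pi> C" using \<pi> by (auto simp: bij_betw_def)
  have same: "\<pi> (col u) = \<pi> (col v) \<longleftrightarrow> col u = col v" if "u \<in> V" "v \<in> V" for u v
    using inj_on_eq_iff[OF inj\<pi>] that col by blast
  have "bij_betw \<phi> V V'"
  proof (rule bij_betw_imageI)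
    show "inj_on \<phi> V"
    proof (rule inj_onI)
      fix u v assume uv: "u \<in> V" "v \<in> V" "\<phi> u = \<phi> v"
      then have eq: "col u = col v" using \<phi>(2) same by metis
      have "inj_on (F (col v)) {w \<in> V. col w = col v}"
        using F[of "col v"] uv col by (auto simp: bij_betw_def)
      then show "u = v" using uv eq by (auto simp: \<phi>_def dest: inj_onD)
    qed
    show "\<phi> ` V = V'"
    proof
      show "\<phi> ` V \<subseteq> V'" using \<phi>(1) by auto
      show "V' \<subseteq> \<phi> ` V"
      proof
        fix v assume v: "v \<in> V'"
        then obtain c where c: "c \<in> C" "\<pi> c = col' v" using col' \<pi> by (force simp: bij_betw_def)
        then have "v \<in> F c ` {w \<in> V. col w = c}" using F[OF c(1)] v by (auto simp: bij_betw_def)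
        then obtain w where "w \<in> V" "col w = c" "v = F c w" by blast
        then show "v \<in> \<phi> ` V" by (auto simp: \<phi>_def)
      qed
    qed
  qed
  then show ?thesis
    by (rule card_emb_host_eq[OF fin(1,2)]) (use \<phi>(2) same in \<open>auto simp: differ_def\<close>)
qed

lemma card_residue_class:
  assumes "c < r"
  shows "card {v \<in> {0..<n}. v mod r = c} = n div r + (if c < n mod r then 1 else 0)"
proof (induction n)
  case (Suc n)
  have "{v \<in> {0..<Suc n}. v mod r = c} =
      (if n mod r = c then insert n {v \<in> {0..<n}. v mod r = c} else {v \<in> {0..<n}. v mod r = c})"
    by (auto simp: less_Suc_eq)
  then have "card {v \<in> {0..<Suc n}. v mod r = c} =
      card {v \<in> {0..<n}. v mod r = c} + (if n mod r = c then 1 else 0)" by simp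
  also have "\<dots> = Suc n div r + (if c < Suc n mod r then 1 else 0)"
    using assms Suc mod_less_divisor[of r n] by (auto simp: div_Suc mod_Suc)
  finally show ?case .
qed simp

text \<open>All parts have size \<open>q\<close> or \<open>q + 1\<close>, where \<open>q\<close> is
  the minimum. A permutation of the colours takes the large parts to the first residues, whose
  classes are the large ones.\<close>

lemma card_emb_balanced_eq:
  fixes col :: "'a \<Rightarrow> nat"
  assumes fin: "finite P" "finite V" and col: "col ` V \<subseteq> {..<r}" and r: "0 < r"
    and bal: "\<And>i j. \<lbrakk>i < r; j < r\<rbrakk> \<Longrightarrow> card {v \<in> V. col v = i} \<le> card {v \<in> V. col v = j} + 1"
  shows "card (emb P R V (differ col)) = card (emb P R {0..<card V} (differ (\<lambda>i. i mod r)))"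
proof -
  define f where "f i = card {v \<in> V. col v = i}" for i
  define q where "q = Min (f ` {..<r})"
  define T where "T = {i \<in> {..<r}. f i \<noteq> q}"
  have ne: "f ` {..<r} \<noteq> {}" using r by auto
  have qmin: "q \<le> f i" if "i < r" for i unfolding q_def using that by (intro Min_le) auto
  obtain i0 where i0: "i0 < r" "f i0 = q" using Min_in[OF _ ne] unfolding q_def by auto
  have val: "f i = q + (if i \<in> T then 1 else 0)" if "i < r" for i
  proof -
    have "f i \<le> q + 1" using bal[OF that i0(1)] i0(2) by (simp add: f_def)
    then show ?thesis using qmin[OF that] that by (auto simp: T_def)
  qed
  \<comment> \<open>A smallest part exists, so \<open>T\<close> misses a colour;
    \<open>card T < r\<close> then makes \<open>q\<close> and \<open>card T\<close> the quotient and
    the remainder of \<open>card V\<close> by \<open>r\<close>.\<close>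
  have "T \<subset> {..<r}" using i0 by (auto simp: T_def)
  then have Tr: "card T < r" using psubset_card_mono[of "{..<r}" T] by simp
  have "card V = (\<Sum>i<r. f i)"
  proof -
    have "V = (\<Union>i\<in>{..<r}. {v \<in> V. col v = i})" using col by auto
    then have "card V = card (\<Union>i\<in>{..<r}. {v \<in> V. col v = i})" by simp
    also have "\<dots> = (\<Sum>i<r. f i)"
      unfolding f_def by (rule card_UN_disjoint) (use fin in auto)
    finally show ?thesis .
  qed
  also have "\<dots> = (\<Sum>i<r. q + (if i \<in> T then 1 else 0))" by (rule sum.cong) (use val in auto)
  also have "\<dots> = r * q + card T"
  proof -
    have "{..<r} \<inter> T = T" by (auto simp: T_def)
    then show ?thesis by (simp add: sum.distrib sum.If_cases)
  qed
  finally have n: "card V = r * q + card T" .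
  have dm: "card V div r = q" "card V mod r = card T" using Tr r by (auto simp: n)
  obtain g1 where g1: "bij_betw g1 T {..<card T}"
    using finite_same_card_bij[of T "{..<card T}"] by (auto simp: T_def)
  have "card ({..<r} - T) = card {card T..<r}" by (subst card_Diff_subset) (auto simp: T_def)
  then obtain g2 where g2: "bij_betw g2 ({..<r} - T) {card T..<r}"
    using finite_same_card_bij[of "{..<r} - T" "{card T..<r}"] by auto
  define \<pi> where "\<pi> i = (if i \<in> T then g1 i else g2 i)" for i
  have "bij_betw \<pi> (T \<union> ({..<r} - T)) ({..<card T} \<union> {card T..<r})"
  proof (rule bij_betw_combine)
    show "bij_betw \<pi> T {..<card T}" using g1 by (subst bij_betw_cong[of T \<pi> g1]) (auto simp: \<pi>_def)
    show "bij_betw \<pi> ({..<r} - T) {card T..<r}"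
      using g2 by (subst bij_betw_cong[of "{..<r} - T" \<pi> g2]) (auto simp: \<pi>_def)
  qed auto
  moreover have "T \<union> ({..<r} - T) = {..<r}" "{..<card T} \<union> {card T..<r} = {..<r}"
    using Tr by (auto simp: T_def)
  ultimately have \<pi>: "bij_betw \<pi> {..<r} {..<r}" by simp
  show ?thesis
  proof (rule card_emb_differ_eq[OF fin _ col _ \<pi>])
    show "(\<lambda>i. i mod r) ` {0..<card V} \<subseteq> {..<r}" using r by auto
    fix c assume c: "c \<in> {..<r}"
    have \<pi>c: "\<pi> c < r" using bij_betw_apply[OF \<pi> c] by simp
    have "\<pi> c < card T \<longleftrightarrow> c \<in> T"
      using bij_betw_apply[OF g1, of c] bij_betw_apply[OF g2, of c] c by (auto simp: \<pi>_def)
    then show "card {v \<in> V. col v = c} = card {v \<in> {0..<card V}. v mod r = \<pi> c}"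
      using val[of c] c by (simp only: card_residue_class[OF \<pi>c] dm f_def[symmetric] lessThan_iff)
  qed simp
qed

text \<open>Non-adjacency is an equivalence relation on \<open>V\<close>, and a transversal of its
  classes is a clique, so at most \<open>r\<close> colours are used.\<close>

lemma complete_multipartite_colouring:
  assumes V: "finite V" and E: "host r V E"
    and trans: "\<And>x y z. \<lbrakk>x \<in> V; y \<in> V; z \<in> V; \<not> E x y; \<not> E y z\<rbrakk> \<Longrightarrow> \<not> E x z"
  obtains col :: "'a \<Rightarrow> nat" where "col ` V \<subseteq> {..<r}"
    "\<And>u v. \<lbrakk>u \<in> V; v \<in> V\<rbrakk> \<Longrightarrow> E u v \<longleftrightarrow> differ col u v"
proof -
  define cl where "cl v = {w \<in> V. \<not> E v w}" for v
  have irr: "\<not> E v v" for v using E by (auto simp: host_def dest: irreflpD)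
  have sym: "E u v \<Longrightarrow> E v u" for u v using E by (auto simp: host_def dest: sympD)
  have cl: "cl u = cl v \<longleftrightarrow> \<not> E u v" if "u \<in> V" "v \<in> V" for u v
  proof
    assume "cl u = cl v"
    moreover have "v \<in> cl v" using that irr by (simp add: cl_def)
    ultimately show "\<not> E u v" by (auto simp: cl_def)
  next
    assume "\<not> E u v"
    then show "cl u = cl v" unfolding cl_def using that trans sym by blast
  qed
  obtain K where K: "K \<subseteq> V" "bij_betw cl K (cl ` V)"
    by (metis subset_image_inj inj_on_imp_bij_betw order_refl)
  have "\<forall>a\<in>K. \<forall>b\<in>K. a \<noteq> b \<longrightarrow> E a b"
  proof (intro ballI impI)
    fix a b assume ab: "a \<in> K" "b \<in> K" "a \<noteq> b"
    have "cl a \<noteq> cl b" using K(2) ab by (auto simp: bij_betw_def dest: inj_onD)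
    then show "E a b" using cl[of a b] ab K(1) by auto
  qed
  then have "card K \<le> r" using E K(1) by (auto simp: host_def clique_le_def)
  then have "card (cl ` V) \<le> card {..<r}" using bij_betw_same_card[OF K(2)] by simp
  then obtain g where g: "inj_on g (cl ` V)" "g ` cl ` V \<subseteq> {..<r}"
    by (metis card_le_inj V finite_imageI finite_lessThan)
  show ?thesis
  proof (rule that[of "g \<circ> cl"])
    show "(g \<circ> cl) ` V \<subseteq> {..<r}" using g(2) by auto
    fix u v assume uv: "u \<in> V" "v \<in> V"
    have "g (cl u) = g (cl v) \<longleftrightarrow> cl u = cl v" using inj_on_eq_iff[OF g(1)] uv by blast
    then show "E u v \<longleftrightarrow> differ (g \<circ> cl) u v" using cl[OF uv] by (simp add: differ_def)
  qed
qed

section \<open>Strict concavity in the sizes of two parts\<close>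

context label_graph begin

text \<open>Colouring the pair \<open>x\<close>, \<open>y\<close> by \<open>i\<close>,
  \<open>i\<close> and by \<open>j\<close>, \<open>j\<close> is compared with colouring it by
  \<open>i\<close>, \<open>j\<close> twice. Embeddings that hit at most one of \<open>x\<close> and
  \<open>y\<close> cancel, and only the mixed colouring makes the pair adjacent. The gap from
  \<open>pF\<close> to \<open>pT\<close> outweighs the loss from \<open>N\<close> to
  \<open>L\<close>.\<close>

lemma recolouring_concave:
  fixes col :: "'a \<Rightarrow> 'c"
  assumes V: "finite V" and xy: "x \<in> V" "y \<in> V" "x \<noteq> y" and ij: "i \<noteq> j"
    and k: "\<And>c. card {v \<in> V. (col(x := i, y := j)) v = c} \<le> k"
    and n: "20 * h ^ 3 * (3 + h * k) \<le> card V"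
  shows "card (emb P R V (differ (col(x := i, y := i)))) + card (emb P R V (differ (col(x := j, y := j))))
    < 2 * card (emb P R V (differ (col(x := i, y := j))))"
proof -
  let ?Q = "{x, y}"
  define E where "E = (\<lambda>i j. differ (col(x := i, y := j)))"
  define c where "c = (\<lambda>E T. card (hits P R V E ?Q T))"
  define N where "N = card V ^ (h - 2)"
  define L where "L = (card V - (3 + h * k)) ^ (h - 2)"
  have sE: "symp (E a b)" "irreflp (E a b)" for a b by (auto simp: E_def differ_def symp_def irreflp_def)
  have split: "card (emb P R V E) = c E {} + c E {x} + c E {y} + c E {x, y}" for E
    unfolding c_def by (rule card_emb_split2[OF finP V xy(3)])
  have e0: "c (E i' j') {} = c (E i j) {}" for i' j'
    unfolding c_def by (subst hits_empty_cong[of V ?Q _ "E i j"]) (auto simp: E_def differ_def)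
  have e1: "c (E a b) {q} = c (E i j) {q'}"
    if "q \<in> ?Q" "q' \<in> ?Q" "(if q = x then a else b) = (if q' = x then i else j)" for a b q q'
    unfolding c_def
    by (rule card_hits_single_eq[OF finP V that(1,2) _ _ irrR sE(1) sE(1)])
      (use xy that in \<open>auto simp: E_def differ_def split: if_splits\<close>)
  \<comment> \<open>Whichever of \<open>x\<close> and \<open>y\<close> carries colour
    \<open>i\<close>, it has the same neighbours outside the pair; likewise for
    \<open>j\<close>.\<close>
  have singles: "c (E i i) {x} = c (E i j) {x}" "c (E i i) {y} = c (E i j) {x}"
    "c (E j j) {x} = c (E i j) {y}" "c (E j j) {y} = c (E i j) {y}"
    using xy(3) by (simp_all add: e1)
  have "c (E a a) {x, y} \<le> pF * N" for a
    using card_hits_pair_le[OF finP V xy(3), of R "E a a" ?Q] xy(3)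
    by (simp add: c_def N_def E_def differ_def)
  also have "pF * N < pT * L"
  proof -
    have n0: "0 < card V" using V xy(1) by (auto simp: card_gt_0_iff)
    have N0: "0 < N" using n0 by (simp add: N_def)
    have "20 * h ^ 2 * N \<le> 20 * h ^ 2 * L + N"
      unfolding N_def L_def by (rule power_diff_approx[OF n n0])
    then have NL: "20 * real h ^ 2 * (real N - real L) \<le> real N"
      using of_nat_mono[where 'a = real, of "20 * h ^ 2 * N" "20 * h ^ 2 * L + N"] by (simp add: algebra_simps)
    have LN: "real L \<le> real N" unfolding L_def N_def by (simp add: power_mono)
    have "real pT \<le> real h ^ 2" using of_nat_mono[where 'a = real, OF pT_le] by simp
    then have "real pT * (real N - real L) \<le> real h ^ 2 * (real N - real L)"
      using LN by (intro mult_right_mono) auto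
    moreover have "real pF + 1 \<le> real pT" using pF_less_pT by linarith
    then have "(real pF + 1) * real N \<le> real pT * real N" by (intro mult_right_mono) auto
    moreover note NL N0
    ultimately have "real pF * real N < real pT * real L" by (simp add: algebra_simps)
    then show ?thesis by (simp flip: of_nat_mult)
  qed
  also have "pT * L \<le> c (E i j) {x, y}"
  proof -
    have "card {w \<in> V - ?Q. \<not> E i j v w} \<le> k" if "v \<in> V" for v
    proof -
      have "card {w \<in> V - ?Q. \<not> E i j v w} \<le> card {w \<in> V. (col(x := i, y := j)) w = (col(x := i, y := j)) v}"
        by (rule card_mono) (use V in \<open>auto simp: E_def differ_def\<close>)
      then show ?thesis using k[of "(col(x := i, y := j)) v"] by (rule le_trans)
    qed
    moreover have "E i j x y" using ij xy(3) by (simp add: E_def differ_def)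
    ultimately show ?thesis
      using hits_pair_ge[OF V _ _ _ xy(3) _ sE, of ?Q i j k] xy by (simp add: c_def L_def)
  qed
  finally have pairs: "c (E a a) {x, y} < c (E i j) {x, y}" for a .
  have "card (emb P R V (E i i)) + card (emb P R V (E j j)) < 2 * card (emb P R V (E i j))"
    using pairs[of i] pairs[of j] unfolding split singles e0[of i i] e0[of j j] by simp
  then show ?thesis by (simp add: E_def)
qed

text \<open>Moving the vertices of two parts one at a time from one to the other gives a strictly concave
  sequence of counts, which takes its maximal value at the given sizes and at the swapped ones.\<close>

lemma extremal_balanced:
  fixes col :: "'a \<Rightarrow> nat"
  assumes V: "finite V" and col: "col ` V \<subseteq> {..<r}"
    and max: "\<And>col' :: 'a \<Rightarrow> nat. col' ` V \<subseteq> {..<r} \<Longrightarrow>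
      card (emb P R V (differ col')) \<le> card (emb P R V (differ col))"
    and k: "\<And>c. card {v \<in> V. col v = c} \<le> k"
    and n: "20 * h ^ 3 * (3 + h * k) \<le> card V"
    and ij: "i < r" "j < r"
  shows "card {v \<in> V. col v = i} \<le> card {v \<in> V. col v = j} + 1"
proof (rule ccontr)
  define A where "A = {v \<in> V. col v = i}"
  define B where "B = {v \<in> V. col v = j}"
  define \<alpha> where "\<alpha> = card A"
  define \<beta> where "\<beta> = card B"
  assume "\<not> ?thesis"
  then have \<alpha>\<beta>: "\<beta> + 2 \<le> \<alpha>" by (simp add: \<alpha>_def \<beta>_def A_def B_def)
  then have ne: "i \<noteq> j" by (auto simp: \<alpha>_def \<beta>_def A_def B_def)
  have fin: "finite A" "finite B" using V by (auto simp: A_def B_def)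
  have "card (A \<union> B) = \<alpha> + \<beta>"
    using fin ne by (subst card_Un_disjoint) (auto simp: A_def B_def \<alpha>_def \<beta>_def)
  then obtain e where e: "bij_betw e {0..<\<alpha> + \<beta>} (A \<union> B)"
    using finite_same_card_bij[of "{0..<\<alpha> + \<beta>}" "A \<union> B"] fin by auto
  \<comment> \<open>The vertices of both parts are lined up by \<open>e\<close>; the first
    \<open>m\<close> get colour \<open>i\<close>, the others colour \<open>j\<close>. Thus
    \<open>m = \<alpha>\<close> reproduces the given sizes and \<open>m = \<beta>\<close> the
    swapped ones.\<close>
  define C where "C m v = (if v \<in> e ` {0..<m} then i else if v \<in> A \<union> B then j else col v)" for m v
  define F where "F m = card (emb P R V (differ (C m)))" for m
  have eAB: "e t \<in> A \<union> B" if "t < \<alpha> + \<beta>" for t using bij_betw_apply[OF e] that by auto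
  have e_inj: "inj_on e {0..<\<alpha> + \<beta>}" using e by (auto simp: bij_betw_def)
  have e_mem: "e t \<in> e ` {0..<m} \<longleftrightarrow> t < m" if "t < \<alpha> + \<beta>" "m \<le> \<alpha> + \<beta>" for t m
    using that e_inj by (subst inj_on_image_mem_iff[OF e_inj]) auto
  have sub: "e ` {0..<m} \<subseteq> A \<union> B" if "m \<le> \<alpha> + \<beta>" for m 
    using eAB that by (auto simp: image_subset_iff)
  have AB: "A \<union> B \<subseteq> V" by (auto simp: A_def B_def)
  have colC: "C m ` V \<subseteq> {..<r}" for m using col ij by (auto simp: C_def)
  have card_e: "card (e ` {0..<m}) = m" if "m \<le> \<alpha> + \<beta>" for m
    using that inj_on_subset[OF e_inj, of "{0..<m}"] by (subst card_image) auto
  have size: "card {v \<in> V. C m v = c} = (if c = i then m else if c = j then \<alpha> + \<beta> - m else card {v \<in> V. col v = c})"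
    if m: "m \<le> \<alpha> + \<beta>" for m c
  proof -
    have "{v \<in> V. C m v = i} = e ` {0..<m}"
      using sub[OF m] AB ne by (auto simp: C_def A_def)
    moreover have "{v \<in> V. C m v = j} = (A \<union> B) - e ` {0..<m}"
      using sub[OF m] AB ne by (auto simp: C_def B_def)
    moreover have "card ((A \<union> B) - e ` {0..<m}) = \<alpha> + \<beta> - m"
      using sub[OF m] card_e[OF m] \<open>card (A \<union> B) = \<alpha> + \<beta>\<close> by (subst card_Diff_subset) auto
    moreover have "{v \<in> V. C m v = c} = {v \<in> V. col v = c}" if "c \<noteq> i" "c \<noteq> j"
      using that sub[OF m] by (auto simp: C_def A_def B_def)
    ultimately show ?thesis using card_e[OF m] by auto
  qed
  define M where "M = card (emb P R V (differ col))"
  have F\<alpha>: "F \<alpha> = M"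
    unfolding F_def M_def
    by (rule card_emb_differ_eq[OF finP V V colC col bij_betw_id])
      (use ne in \<open>auto simp: size \<alpha>_def \<beta>_def A_def B_def\<close>)
  have swap: "bij_betw (id(i := j, j := i)) {..<r} {..<r}"
    by (rule bij_betw_byWitness[where f' = "id(i := j, j := i)"]) (use ij in auto)
  have F\<beta>: "F \<beta> = M"
    unfolding F_def M_def
    by (rule card_emb_differ_eq[OF finP V V colC col swap])
      (use ne in \<open>auto simp: size \<alpha>_def \<beta>_def A_def B_def\<close>)
  have F_le: "F m \<le> M" for m unfolding F_def M_def by (rule max[OF colC])
  have concave: "F (m + 1) + F (m - 1) < 2 * F m" if m: "\<beta> < m" "m < \<alpha>" for m
  proof -
    let ?x = "e (m - 1)" and ?y = "e m"
    have xy: "?x \<in> V" "?y \<in> V" "?x \<noteq> ?y"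
    proof -
      have lt: "m - 1 < \<alpha> + \<beta>" "m < \<alpha> + \<beta>" "m - 1 \<noteq> m" using m by auto
      then show "?x \<in> V" "?y \<in> V" using eAB AB by blast+
      show "?x \<noteq> ?y" using lt inj_on_eq_iff[OF e_inj, of "m - 1" m] by auto
    qed
    have step: "C m' = (C m)(?x := if m - 1 < m' then i else j, ?y := if m < m' then i else j)"
      if m': "m' \<in> {m - 1, m, m + 1}" for m'
    proof
      fix v
      have le: "m' \<le> \<alpha> + \<beta>" using m m' by auto
      show "C m' v = ((C m)(?x := if m - 1 < m' then i else j, ?y := if m < m' then i else j)) v"
      proof (cases "v = ?x \<or> v = ?y")
        case True
        then show ?thesis
          using e_mem[of "m - 1" m'] e_mem[of m m'] le m eAB[of "m - 1"] eAB[of m] xy(3)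
          by (auto simp: C_def)
      next
        case False
        have "v \<in> e ` {0..<m'} \<longleftrightarrow> v \<in> e ` {0..<m}"
        proof (cases "v \<in> A \<union> B")
          case True
          then obtain t where t: "t < \<alpha> + \<beta>" "v = e t" using e by (force simp: bij_betw_def)
          then have "t \<noteq> m - 1" "t \<noteq> m" using False by auto
          then show ?thesis using e_mem[OF t(1), of m'] e_mem[OF t(1), of m] t(2) le m m' by auto
        qed (use sub[of m'] sub[of m] le m in auto)
        then show ?thesis using False by (auto simp: C_def)
      qed
    qed
    have s: "(C m)(?x := i, ?y := j) = C m" "(C m)(?x := i, ?y := i) = C (m + 1)"
      "(C m)(?x := j, ?y := j) = C (m - 1)"
    proof -
      have "m - 1 < m" "m - 1 < m + 1" "m < m + 1" "\<not> m < m - 1" using m by auto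
      then show "(C m)(?x := i, ?y := j) = C m" "(C m)(?x := i, ?y := i) = C (m + 1)"
          "(C m)(?x := j, ?y := j) = C (m - 1)"
        using step[of m] step[of "m + 1"] step[of "m - 1"]
        by (simp_all only: insert_iff less_irrefl simp_thms if_True if_False)
    qed
    \<comment> \<open>For \<open>\<beta> < m < \<alpha>\<close> both changing parts are smaller than
      \<alpha>, which is at most \<open>k\<close>.\<close>
    have "card {v \<in> V. C m v = c} \<le> k" for c
      using m k[of i] k[of c] size[of m c] by (auto simp: \<alpha>_def A_def)
    then show ?thesis
      using recolouring_concave[OF V xy ne, of "C m" k] n unfolding s F_def by simp
  qed
  \<comment> \<open>Strict concavity forbids an interior minimum, so \<open>F\<close> is at least
    its end value \<open>M\<close> on the whole interval; concavity at \<open>\<beta> + 1\<close>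
    would then push \<open>F (\<beta> + 1)\<close> above the maximum \<open>M\<close>.\<close>
  obtain m where m: "m \<in> {\<beta>..\<alpha>}" "\<And>m'. m' \<in> {\<beta>..\<alpha>} \<Longrightarrow> F m \<le> F m'"
    using ex_has_least_nat[of "\<lambda>m. m \<in> {\<beta>..\<alpha>}" \<beta> F] \<alpha>\<beta> by auto
  have "m = \<alpha> \<or> m = \<beta>"
  proof (rule ccontr)
    assume "\<not> ?thesis"
    then have "\<beta> < m" "m < \<alpha>" using m(1) by auto
    then have "m + 1 \<in> {\<beta>..\<alpha>}" "m - 1 \<in> {\<beta>..\<alpha>}" by auto
    then have "F m \<le> F (m + 1)" "F m \<le> F (m - 1)" using m(2) by blast+
    then show False using concave[OF \<open>\<beta> < m\<close> \<open>m < \<alpha>\<close>] by linarith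
  qed
  then have "M \<le> F (\<beta> + 2)" using m(2)[of "\<beta> + 2"] F\<alpha> F\<beta> \<alpha>\<beta> by auto
  then show False using concave[of "\<beta> + 1"] F_le[of "\<beta> + 1"] F\<beta> \<alpha>\<beta> by auto
qed

end

section \<open>Turan graphs maximise embeddings for large \<open>r\<close>\<close>

text \<open>Without label edges only the number of vertices matters, and for
  \<open>n \<le> r\<close> the Turan graph is complete. In the remaining case the threshold on
  \<open>r\<close> makes the bound on non-neighbours small enough for the second-order
  comparisons.\<close>

theorem turan_maximises_embeddings:
  fixes V :: "'a set" and P :: "'b set"
  assumes finP: "finite P" and R: "symp R" "irreflp R" and V: "finite V" and E: "host r V E"
    and r: "120 * card P ^ 7 + 1 \<le> r"
  shows "card (emb P R V E) \<le> card (emb P R {0..<card V} (differ (\<lambda>i. i mod r)))"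
proof -
  define n where "n = card V"
  obtain \<beta> where \<beta>: "bij_betw \<beta> V {0..<n}" using ex_bij_betw_finite_nat[OF V] by (auto simp: n_def)
  consider (edgeless) "\<not> (\<exists>a\<in>P. \<exists>b\<in>P. R a b)" | (small) "n \<le> r"
    | (large) "\<exists>a\<in>P. \<exists>b\<in>P. R a b" "r < n" by linarith
  then show ?thesis
  proof cases
    case edgeless
    then have all: "emb P R X F = emb P R X (\<lambda>_ _. True)" for X :: "'c set" and F by (auto simp: emb_def)
    then have all': "emb P R V E = emb P R V (\<lambda>_ _. True)" using edgeless by (auto simp: emb_def)
    have "card (emb P R V (\<lambda>_ _. True)) = card (emb P R {0..<n} (\<lambda>_ _. True))"
      by (rule card_emb_host_eq[OF finP V \<beta>]) simp
    moreover have "emb P R {0..<n} (differ (\<lambda>i. i mod r)) = emb P R {0..<n} (\<lambda>_ _. True)"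
      using edgeless by (auto simp: emb_def)
    ultimately show ?thesis using all' by (simp add: n_def)
  next
    case small
    have "card (emb P R V E) \<le> card (emb P R {0..<n} (differ (\<lambda>i. i mod r)))"
    proof (rule card_emb_host_le[OF finP _ bij_betw_imp_inj_on[OF \<beta>]])
      show "\<beta> ` V \<subseteq> {0..<n}" using \<beta> by (simp add: bij_betw_def)
      fix x y assume xy: "x \<in> V" "y \<in> V" "E x y"
      then have "x \<noteq> y" using E by (auto simp: host_def dest: irreflpD)
      then have "\<beta> x \<noteq> \<beta> y" using xy \<beta> by (auto simp: bij_betw_def dest: inj_onD)
      moreover have "\<beta> x < r" "\<beta> y < r"
        using bij_betw_apply[OF \<beta>, of x] bij_betw_apply[OF \<beta>, of y] xy small by auto
      ultimately show "differ (\<lambda>i. i mod r) (\<beta> x) (\<beta> y)" by (simp add: differ_def)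
    qed simp
    then show ?thesis by (simp add: n_def)
  next
    case large
    have "label_graph P R" using large(1) finP R by unfold_locales
    then interpret label_graph P R .
    \<comment> \<open>\<kappa> bounds the parts of the Turan graph; \<open>K\<close> will bound the
      number of non-neighbours in an extremal host.\<close>
    define \<kappa> where "\<kappa> = n div r + 1"
    define K where "K = h ^ 3 * \<kappa> + h ^ 2"
    have r0: "0 < r" using r by simp
    have h0: "0 < h" using edge finP by (auto simp: card_gt_0_iff)
    have "\<exists>E0. host r V E0 \<and> (\<forall>E'. host r V E' \<longrightarrow> card (emb P R V E') \<le> card (emb P R V E0))"
    proof (rule ex_has_greatest_nat[where P = "host r V" and f = "\<lambda>E'. card (emb P R V E')"
          and b = "card (P \<rightarrow>\<^sub>E V) + 1", OF E], intro allI impI)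
      fix E' show "card (emb P R V E') < card (P \<rightarrow>\<^sub>E V) + 1"
        using card_mono[of "P \<rightarrow>\<^sub>E V" "emb P R V E'"] finP V by (auto simp: emb_def finite_PiE less_Suc_eq_le)
    qed
    then obtain E0 where E0: "host r V E0"
      and max: "\<And>E'. host r V E' \<Longrightarrow> card (emb P R V E') \<le> card (emb P R V E0)" by blast
    have lower: "(n - h * \<kappa>) ^ h \<le> card (emb P R V E0)"
    proof -
      define col where "col v = \<beta> v mod r" for v
      have host: "host r V (differ col)"
        by (rule host_differ[OF V, of _ "{..<r}"]) (use r0 in \<open>auto simp: col_def\<close>)
      have cls: "card {w \<in> V. \<not> differ col v w} \<le> \<kappa>" if "v \<in> V" for v
      proof -
        have "card {w \<in> V. \<not> differ col v w} \<le> card {i \<in> {0..<n}. i mod r = col v}"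
        proof (rule card_inj_on_le[of \<beta>])
          show "inj_on \<beta> {w \<in> V. \<not> differ col v w}"
            by (rule inj_on_subset[OF bij_betw_imp_inj_on[OF \<beta>]]) auto
          show "\<beta> ` {w \<in> V. \<not> differ col v w} \<subseteq> {i \<in> {0..<n}. i mod r = col v}"
            using bij_betw_apply[OF \<beta>] by (auto simp: differ_def col_def)
        qed simp
        then show ?thesis using card_residue_class[of "col v" r n] r0 by (auto simp: \<kappa>_def col_def split: if_splits)
      qed
      \<comment> \<open>The greedy extension starts from the empty partial embedding, so that all
        labels are placed greedily.\<close>
      have "(card V - h * \<kappa>) ^ card P \<le> card {f \<in> emb ({} \<union> P) R V (differ col). (\<forall>p\<in>{}. f p = undefined) \<and> f ` P \<subseteq> V}"
        by (rule card_emb_extensions_ge) (use V finP cls host irrR in \<open>auto simp: host_def emb_def\<close>)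
      also have "\<dots> \<le> card (emb P R V (differ col))"
        by (rule card_mono[OF finite_emb[OF finP V]]) auto
      also have "\<dots> \<le> card (emb P R V E0)" by (rule max[OF host])
      finally show ?thesis by (simp add: n_def)
    qed
    have k: "card {w \<in> V. \<not> E0 v w} \<le> K" if v: "v \<in> V" for v
    proof -
      define d where "d = card {w \<in> V. \<not> E0 v w}"
      have "d * n ^ (h - 1) + h * card (emb P R V E0) \<le> h * n ^ h + h ^ 2 * n ^ (h - 1)"
        unfolding d_def n_def by (rule codegree_bound[OF V E0 max v])
      \<comment> \<open>The main term \<open>h * n ^ h\<close> cancels against the lower bound up to
        a multiple of \<open>n ^ (h - 1)\<close>, which leaves \<open>d \<le> K\<close>.\<close>
      moreover have "h * n ^ h \<le> h * ((n - h * \<kappa>) ^ h + h * (h * \<kappa>) * n ^ (h - 1))"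
        by (rule mult_le_mono2[OF power_le_power_diff])
      then have "h * n ^ h \<le> h * (n - h * \<kappa>) ^ h + h ^ 3 * \<kappa> * n ^ (h - 1)"
        by (simp add: algebra_simps power3_eq_cube)
      moreover have "h * (n - h * \<kappa>) ^ h \<le> h * card (emb P R V E0)"
        by (rule mult_le_mono2[OF lower])
      ultimately have "d * n ^ (h - 1) \<le> h ^ 3 * \<kappa> * n ^ (h - 1) + h ^ 2 * n ^ (h - 1)" by linarith
      then have "d * n ^ (h - 1) \<le> K * n ^ (h - 1)" by (simp add: K_def add_mult_distrib)
      then show ?thesis using large(2) unfolding d_def[symmetric] by simp
    qed
    \<comment> \<open>Multiplied by \<open>r\<close>, the left side is at most
      \<open>20 * 6 * h ^ 7 * n\<close>, because \<open>r * K \<le> 3 * (h ^ 3 * n)\<close>. This is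
      the origin of the 120 in the threshold.\<close>
    have big: "20 * h ^ 3 * (3 + h * K) \<le> card V"
    proof -
      have "r * \<kappa> \<le> 2 * n"
      proof -
        have "r * (n div r) \<le> n" by simp
        then show ?thesis using large(2) by (simp only: \<kappa>_def add_mult_distrib2)
      qed
      then have "h ^ 3 * (r * \<kappa>) \<le> h ^ 3 * (2 * n)" by (rule mult_le_mono2)
      also have "\<dots> = 2 * (h ^ 3 * n)" by simp
      finally have "h ^ 3 * (r * \<kappa>) \<le> 2 * (h ^ 3 * n)" .
      moreover have "h ^ 2 * r \<le> h ^ 3 * n" using h0 large(2) by (intro mult_le_mono power_increasing) auto
      moreover have "r * K = h ^ 3 * (r * \<kappa>) + h ^ 2 * r" by (simp add: K_def algebra_simps)
      ultimately have rK: "r * K \<le> 3 * (h ^ 3 * n)" by linarith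
      have "r * (20 * h ^ 3 * (3 + h * K)) = 20 * h ^ 3 * (3 * r + h * (r * K))"
        by (simp add: algebra_simps)
      also have "\<dots> \<le> 20 * h ^ 3 * (3 * (h ^ 4 * n) + h * (3 * (h ^ 3 * n)))"
      proof (intro mult_le_mono2 add_mono)
        have "1 * r \<le> h ^ 4 * n" using h0 large(2) by (intro mult_le_mono) auto
        then show "r \<le> h ^ 4 * n" by simp
      qed (rule rK)
      also have "\<dots> = 120 * h ^ 7 * n" by (simp add: algebra_simps eval_nat_numeral)
      also have "\<dots> \<le> r * n" using r by (intro mult_le_mono1) simp
      finally show ?thesis using r0 by (simp add: n_def)
    qed
    have trans: "\<not> E0 x z" if "x \<in> V" "y \<in> V" "z \<in> V" "\<not> E0 x y" "\<not> E0 y z" for x y z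
    proof (cases "x = y \<or> y = z \<or> x = z")
      case True
      then show ?thesis using that E0 by (auto simp: host_def dest: irreflpD)
    next
      case False
      then show ?thesis using nonadjacency_transitive[OF V E0 max k big that(1-3)] that(4,5) by blast
    qed
    obtain col :: "'a \<Rightarrow> nat" where col: "col ` V \<subseteq> {..<r}"
      and E0_col: "\<And>u v. \<lbrakk>u \<in> V; v \<in> V\<rbrakk> \<Longrightarrow> E0 u v \<longleftrightarrow> differ col u v"
    proof (rule complete_multipartite_colouring[OF V E0])
      fix x y z assume "x \<in> V" "y \<in> V" "z \<in> V" "\<not> E0 x y" "\<not> E0 y z"
      then show "\<not> E0 x z" by (rule trans)
    qed (use that in blast)
    have eq: "emb P R V E0 = emb P R V (differ col)" by (rule emb_cong[OF E0_col])
    have cls: "card {v \<in> V. col v = c} \<le> K" for c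
    proof (cases "{v \<in> V. col v = c} = {}")
      case False
      then obtain v where v: "v \<in> V" "col v = c" by blast
      then have "{w \<in> V. col w = c} = {w \<in> V. \<not> E0 v w}" using E0_col[OF v(1)] by (auto simp: differ_def)
      then show ?thesis using k[OF v(1)] by simp
    next
      case True
      then show ?thesis by (metis card.empty le0)
    qed
    have "card (emb P R V (differ col)) = card (emb P R {0..<card V} (differ (\<lambda>i. i mod r)))"
    proof (rule card_emb_balanced_eq[OF finP V col r0])
      fix i j assume ij: "i < r" "j < r"
      show "card {v \<in> V. col v = i} \<le> card {v \<in> V. col v = j} + 1"
      proof (rule extremal_balanced[OF V col _ cls big ij])
        \<comment> \<open>Colourings with \<open>r\<close> colours are hosts, so a maximum over
          hosts is a maximum over colourings.\<close>
        fix col' :: "'a \<Rightarrow> nat" assume "col' ` V \<subseteq> {..<r}"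
        then have "host r V (differ col')" by (rule host_differ[OF V]) auto
        then show "card (emb P R V (differ col')) \<le> card (emb P R V (differ col))"
          using max eq by metis
      qed
    qed
    then show ?thesis using max[OF E] eq by simp
  qed
qed

section \<open>Copies and embeddings\<close>

definition adj :: "'a graph \<Rightarrow> 'a \<Rightarrow> 'a \<Rightarrow> bool" where
  "adj G a b \<longleftrightarrow> {a, b} \<in> edges G"

abbreviation embs :: "'b graph \<Rightarrow> 'a graph \<Rightarrow> ('b \<Rightarrow> 'a) set" where
  "embs H G \<equiv> emb (verts H) (adj H) (verts G) (adj G)"

lemma symp_adj: "symp (adj G)"
  by (auto simp: symp_def adj_def insert_commute)

lemma irreflp_adj: "wf_graph G \<Longrightarrow> irreflp (adj G)"
  by (auto simp: irreflp_def adj_def wf_graph_def)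

lemma wf_edgeE:
  assumes "wf_graph G" "e \<in> edges G"
  obtains a b where "e = {a, b}" "a \<in> verts G" "b \<in> verts G" "a \<noteq> b" "adj G a b"
  using assms by (force simp: wf_graph_def adj_def card_2_iff)

lemma finite_edges: "wf_graph G \<Longrightarrow> finite (edges G)"
  by (rule finite_subset[of _ "Pow (verts G)"]) (auto simp: wf_graph_def)

lemma embs_image_edge:
  assumes "wf_graph H" "f \<in> embs H G" "e \<in> edges H"
  shows "f ` e \<in> edges G"
  using assms(1,3)
proof (rule wf_edgeE)
  fix a b assume "e = {a, b}" "a \<in> verts H" "b \<in> verts H" "adj H a b"
  then show ?thesis using emb_D(4)[OF assms(2), of a b] by (simp add: adj_def)
qed

text \<open>An injective endomorphism of a finite graph maps the finite edge set injectively into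
  itself, hence onto. So \<open>embs H H\<close> consists of the automorphisms.\<close>

lemma embs_self_surj:
  assumes H: "wf_graph H" and f: "f \<in> embs H H"
  shows "f ` verts H = verts H" "(\<lambda>e. f ` e) ` edges H = edges H"
proof -
  show "f ` verts H = verts H"
    by (rule endo_inj_surj) (use H emb_D[OF f] in \<open>auto simp: wf_graph_def\<close>)
  show "(\<lambda>e. f ` e) ` edges H = edges H"
  proof (rule endo_inj_surj[OF finite_edges[OF H]])
    show "(\<lambda>e. f ` e) ` edges H \<subseteq> edges H" using embs_image_edge[OF H f] by auto
    show "inj_on ((`) f) (edges H)"
      by (rule inj_on_subset[OF inj_on_image_Pow[OF emb_D(3)[OF f]]]) (use H in \<open>auto simp: wf_graph_def\<close>)
  qed
qed

lemma card_embs_self_pos: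
  assumes "wf_graph H"
  shows "0 < card (embs H H)"
proof -
  have "restrict id (verts H) \<in> embs H H" by (rule emb_I) (auto simp: inj_on_def)
  then show ?thesis using assms finite_emb[of "verts H" "verts H"] by (auto simp: card_gt_0_iff wf_graph_def)
qed

text \<open>Every copy \<open>K\<close> is the image of as many embeddings as \<open>H\<close> has
  automorphisms: composing a fixed isomorphism \<open>g\<close> from \<open>H\<close> to
  \<open>K\<close> with the automorphisms yields all of them.\<close>

lemma count_copies_mult_automorphisms:
  assumes H: "wf_graph H" and G: "finite (verts G)"
  shows "count_copies H G * card (embs H H) = card (embs H G)"
proof -
  let ?im = "\<lambda>f. (f ` verts H, (\<lambda>e. f ` e) ` edges H)"
  let ?C = "{K \<in> subgraphs G. isomorphic H K}"
  let ?fib = "\<lambda>K. {f \<in> embs H G. ?im f = K}"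
  have finH: "finite (verts H)" using H by (simp add: wf_graph_def)
  have eV: "e \<subseteq> verts H" if "e \<in> edges H" for e using H that by (auto simp: wf_graph_def)
  have finC: "finite ?C"
  proof (rule finite_subset)
    show "?C \<subseteq> Pow (verts G) \<times> Pow (Pow (verts G))"
      unfolding subgraphs_def verts_def edges_def by fastforce
  qed (use G in simp)
  have im: "?im f \<in> ?C" if f: "f \<in> embs H G" for f
  proof -
    have "bij_betw f (verts H) (f ` verts H)" using emb_D(3)[OF f] by (rule inj_on_imp_bij_betw)
    then have "isomorphic H (?im f)" by (auto simp: isomorphic_def verts_def edges_def)
    moreover have "?im f \<in> subgraphs G"
      using emb_D(5)[OF f] embs_image_edge[OF H f] eV by (fastforce simp: subgraphs_def verts_def edges_def)
    ultimately show ?thesis by simp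
  qed
  have fib: "card (?fib K) = card (embs H H)" if K: "K \<in> ?C" for K
  proof -
    obtain g where g: "bij_betw g (verts H) (verts K)" and gE: "edges K = (\<lambda>e. g ` e) ` edges H"
      using K by (auto simp: isomorphic_def)
    have sub: "verts K \<subseteq> verts G" "edges K \<subseteq> edges G" using K by (auto simp: subgraphs_def)
    let ?i = "inv_into (verts H) g"
    have gi: "g (?i v) = v" "?i v \<in> verts H" if "v \<in> verts K" for v
      using that g by (auto simp: bij_betw_def f_inv_into_f inv_into_into)
    have ig: "?i (g v) = v" if "v \<in> verts H" for v
      using that g by (simp add: bij_betw_def)
    have "bij_betw (\<lambda>a. restrict (g \<circ> a) (verts H)) (embs H H) (?fib K)"
    proof (rule bij_betw_byWitness[where f' = "\<lambda>f. restrict (?i \<circ> f) (verts H)"])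
      show "\<forall>a\<in>embs H H. restrict (?i \<circ> restrict (g \<circ> a) (verts H)) (verts H) = a"
      proof
        fix a assume a: "a \<in> embs H H"
        show "restrict (?i \<circ> restrict (g \<circ> a) (verts H)) (verts H) = a"
          by (rule extensionalityI[OF _ emb_D(2)[OF a]]) (use ig emb_D(1)[OF a] in auto)
      qed
      have fK: "f v \<in> verts K" if "f \<in> ?fib K" "v \<in> verts H" for f v
        using that by (auto simp: verts_def)
      have fE: "edges K = (\<lambda>e. f ` e) ` edges H" if "f \<in> ?fib K" for f
        using that by (auto simp: edges_def)
      show "\<forall>f\<in>?fib K. restrict (g \<circ> restrict (?i \<circ> f) (verts H)) (verts H) = f"
      proof
        fix f assume f: "f \<in> ?fib K"
        show "restrict (g \<circ> restrict (?i \<circ> f) (verts H)) (verts H) = f"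
          by (rule extensionalityI[of _ "verts H"]) (use gi fK[OF f] f in \<open>auto dest: emb_D(2)\<close>)
      qed
      show "(\<lambda>a. restrict (g \<circ> a) (verts H)) ` embs H H \<subseteq> ?fib K"
      proof clarify
        fix a assume a: "a \<in> embs H H"
        let ?f = "restrict (g \<circ> a) (verts H)"
        have V: "?f ` verts H = verts K"
        proof -
          have "?f ` verts H = g ` a ` verts H" by (simp add: image_image)
          then show ?thesis using embs_self_surj(1)[OF H a] g by (simp add: bij_betw_def)
        qed
        have fe: "?f ` e = g ` a ` e" if "e \<in> edges H" for e using eV[OF that] by force
        have "(\<lambda>e. ?f ` e) ` edges H = (\<lambda>e. g ` a ` e) ` edges H"
          by (rule image_cong[OF refl fe])
        also have "\<dots> = (\<lambda>e. g ` e) ` (\<lambda>e. a ` e) ` edges H" by (simp add: image_image)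
        finally have "(\<lambda>e. ?f ` e) ` edges H = (\<lambda>e. g ` e) ` (\<lambda>e. a ` e) ` edges H" .
        then have Ed: "(\<lambda>e. ?f ` e) ` edges H = edges K" using embs_self_surj(2)[OF H a] gE by simp
        have "?f \<in> embs H G"
        proof (rule emb_I)
          fix p assume "p \<in> verts H" then show "?f p \<in> verts G" using V sub(1) by blast
        next
          show "inj_on ?f (verts H)"
            using emb_D(1,3)[OF a] g by (auto simp: inj_on_def bij_betw_def)
        next
          fix x y assume xy: "x \<in> verts H" "y \<in> verts H" "adj H x y"
          then have "?f ` {x, y} \<in> edges K" unfolding Ed[symmetric] by (intro imageI) (simp add: adj_def)
          then show "adj G (?f x) (?f y)" using sub(2) xy by (auto simp: adj_def)
        qed simp
        moreover have "?im ?f = K" using V Ed by (simp add: verts_def edges_def prod_eq_iff)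
        ultimately show "?f \<in> embs H G \<and> ?im ?f = K" by blast
      qed
      show "(\<lambda>f. restrict (?i \<circ> f) (verts H)) ` ?fib K \<subseteq> embs H H"
      proof (rule image_subsetI)
        fix f assume f: "f \<in> ?fib K"
        then have f': "f \<in> embs H G" by simp
        show "restrict (?i \<circ> f) (verts H) \<in> embs H H"
        proof (rule emb_I)
          fix p assume "p \<in> verts H" then show "restrict (?i \<circ> f) (verts H) p \<in> verts H" using gi fK[OF f] by auto
        next
          show "inj_on (restrict (?i \<circ> f) (verts H)) (verts H)"
          proof (rule inj_onI)
            fix x y assume xy: "x \<in> verts H" "y \<in> verts H"
              "restrict (?i \<circ> f) (verts H) x = restrict (?i \<circ> f) (verts H) y"
            then have "?i (f x) = ?i (f y)" by simp
            then have "f x = f y" using gi(1) fK[OF f] xy by metis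
            then show "x = y" using emb_D(3)[OF f'] xy by (auto dest: inj_onD)
          qed
        next
          fix x y assume xy: "x \<in> verts H" "y \<in> verts H" "adj H x y"
          then have "f ` {x, y} \<in> edges K" unfolding fE[OF f] by (intro imageI) (simp add: adj_def)
          \<comment> \<open>The image under \<open>f\<close> is an edge of \<open>K\<close>, hence
            also the image of some edge of \<open>H\<close> under \<open>g\<close>; pulling back
            along \<open>g\<close> therefore gives an edge of \<open>H\<close>.\<close>
          then obtain e where e: "e \<in> edges H" "f ` {x, y} = g ` e" unfolding gE by blast
          have "?i ` g ` e = e" using eV[OF e(1)] ig by force
          then have "?i ` f ` {x, y} \<in> edges H" using e by simp
          then show "adj H (restrict (?i \<circ> f) (verts H) x) (restrict (?i \<circ> f) (verts H) y)"
            using xy by (simp add: adj_def)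
        qed simp
      qed
    qed
    then show ?thesis by (rule bij_betw_same_card[symmetric])
  qed
  have "embs H G = (\<Union>K\<in>?C. ?fib K)" using im by blast
  then have "card (embs H G) = card (\<Union>K\<in>?C. ?fib K)" by simp
  also have "\<dots> = (\<Sum>K\<in>?C. card (?fib K))"
    by (rule card_UN_disjoint) (use finC finite_emb[OF finH G] in auto)
  also have "\<dots> = (\<Sum>K\<in>?C. card (embs H H))" by (rule sum.cong) (use fib in auto)
  finally show ?thesis by (simp add: count_copies_def)
qed

section \<open>Turan, complete and split graphs, and freeness in terms of embeddings\<close>

lemma verts_turan [simp]: "verts (turan r n) = {0..<n}"
  by (simp add: turan_def verts_def)

lemma adj_turan: "adj (turan r n) a b \<longleftrightarrow> a < n \<and> b < n \<and> a mod r \<noteq> b mod r"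
  by (auto simp: turan_def edges_def adj_def doubleton_eq_iff)

lemma wf_turan: "wf_graph (turan r n)"
  by (auto simp: turan_def verts_def edges_def wf_graph_def card_2_iff)

lemma verts_complete_graph [simp]: "verts (complete_graph n) = {0..<n}"
  by (simp add: complete_graph_def verts_def)

lemma adj_complete_graph: "adj (complete_graph n) a b \<longleftrightarrow> a < n \<and> b < n \<and> a \<noteq> b"
  by (auto simp: complete_graph_def edges_def adj_def doubleton_eq_iff)

lemma wf_complete_graph: "wf_graph (complete_graph n)"
  by (auto simp: complete_graph_def verts_def edges_def wf_graph_def card_2_iff)

lemma verts_split_graph [simp]: "verts (split_graph u D) = {0..<u + D + 1}"
  by (simp add: split_graph_def verts_def)

lemma adj_split_graph:
  "adj (split_graph u D) a b \<longleftrightarrow> a < u + D + 1 \<and> b < u + D + 1 \<and> a \<noteq> b \<and> (a < u \<or> b < u)"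
  by (auto simp: split_graph_def edges_def adj_def doubleton_eq_iff)

lemma wf_split_graph: "wf_graph (split_graph u D)"
  by (fastforce simp: split_graph_def verts_def edges_def wf_graph_def card_2_iff)

lemma emb_turan: "emb P R {0..<n} (adj (turan r n)) = emb P R {0..<n} (differ (\<lambda>i. i mod r))"
  by (rule emb_cong) (auto simp: adj_turan differ_def)

lemma count_copies_eq_0_iff:
  assumes "wf_graph X" "finite (verts G)"
  shows "count_copies X G = 0 \<longleftrightarrow> embs X G = {}"
proof -
  have "finite (embs X G)" using assms by (intro finite_emb) (auto simp: wf_graph_def)
  then show ?thesis
    using count_copies_mult_automorphisms[OF assms] card_embs_self_pos[OF assms(1)]
    by (metis card_0_eq mult_eq_0_iff not_gr_zero)
qed

lemma complete_graph_free_iff: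
  assumes G: "wf_graph G"
  shows "count_copies (complete_graph (r + 1)) G = 0 \<longleftrightarrow> clique_le r (verts G) (adj G)"
proof -
  have fin: "finite (verts G)" using G by (simp add: wf_graph_def)
  have "embs (complete_graph (r + 1)) G = {} \<longleftrightarrow> clique_le r (verts G) (adj G)"
  proof
    assume empty: "embs (complete_graph (r + 1)) G = {}"
    show "clique_le r (verts G) (adj G)"
      unfolding clique_le_def
    proof (intro allI impI, rule ccontr)
      fix C assume C: "C \<subseteq> verts G" "\<forall>a\<in>C. \<forall>b\<in>C. a \<noteq> b \<longrightarrow> adj G a b" "\<not> card C \<le> r"
      then obtain C' where C': "C' \<subseteq> C" "card C' = r + 1"
        by (metis Suc_eq_plus1 not_less_eq_eq obtain_subset_with_card_n)
      then have "finite C'" by (intro finite_subset[OF _ fin] order_trans[OF C'(1) C(1)])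
      then obtain f where f: "bij_betw f {0..<r + 1} C'"
        using ex_bij_betw_nat_finite[of C'] C'(2) by auto
      have "restrict f {0..<r + 1} \<in> embs (complete_graph (r + 1)) G"
      proof (rule emb_I)
        fix a b assume ab: "a \<in> verts (complete_graph (r + 1))" "b \<in> verts (complete_graph (r + 1))"
          "adj (complete_graph (r + 1)) a b"
        then have "f a \<noteq> f b" using f by (auto simp: adj_complete_graph bij_betw_def dest: inj_onD)
        moreover have "f a \<in> C" "f b \<in> C" using ab f C'(1) bij_betw_apply[OF f] by auto
        ultimately show "adj G (restrict f {0..<r + 1} a) (restrict f {0..<r + 1} b)"
          using C(2) ab by simp
      next
        fix p assume "p \<in> verts (complete_graph (r + 1))"
        then show "restrict f {0..<r + 1} p \<in> verts G" using bij_betw_apply[OF f, of p] C' C(1) by auto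
      qed (use f in \<open>auto simp: bij_betw_def\<close>)
      then show False using empty by simp
    qed
  next
    assume cl: "clique_le r (verts G) (adj G)"
    show "embs (complete_graph (r + 1)) G = {}"
    proof (rule ccontr)
      assume "\<not> ?thesis"
      then obtain f where f: "f \<in> embs (complete_graph (r + 1)) G" by blast
      have "card (f ` {0..<r + 1}) \<le> r"
      proof (rule cl[unfolded clique_le_def, rule_format])
        show "f ` {0..<r + 1} \<subseteq> verts G" using emb_D(5)[OF f] by simp
        fix a b assume "a \<in> f ` {0..<r + 1}" "b \<in> f ` {0..<r + 1}" "a \<noteq> b"
        then obtain i j where "i < r + 1" "j < r + 1" "a = f i" "b = f j" by fastforce
        moreover from this have "i \<noteq> j" using \<open>a \<noteq> b\<close> by blast
        ultimately show "adj G a b" using emb_D(4)[OF f, of i j] by (simp add: adj_complete_graph)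
      qed
      moreover have "card (f ` {0..<r + 1}) = r + 1"
        using card_image[OF emb_D(3)[OF f]] by simp
      ultimately show False by simp
    qed
  qed
  then show ?thesis by (simp only: count_copies_eq_0_iff[OF wf_complete_graph fin])
qed

section \<open>Existence of \<open>omega0\<close> and its transfer to arbitrary hosts\<close>

text \<open>\<open>LEAST\<close> has the defining property only once some number is known to satisfy
  it; the threshold of \<open>turan_maximises_embeddings\<close> is the witness.\<close>

lemma omega0_spec:
  assumes J: "wf_graph J"
  shows "1 \<le> omega0 J"
    and "\<And>r n (G :: nat graph). \<lbrakk>omega0 J \<le> r; 1 \<le> n; wf_graph G; card (verts G) = n;
      free {complete_graph (r + 1)} G\<rbrakk> \<Longrightarrow> count_copies J G \<le> count_copies J (turan r n)"
proof -
  let ?Q = "\<lambda>w. w \<ge> 1 \<and> (\<forall>r\<ge>w. \<forall>n\<ge>1. \<forall>G :: nat graph.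
      wf_graph G \<and> card (verts G) = n \<and> free {complete_graph (r+1)} G \<longrightarrow>
      count_copies J G \<le> count_copies J (turan r n))"
  have "?Q (120 * card (verts J) ^ 7 + 1)"
  proof (intro conjI allI impI)
    fix r n :: nat and G :: "nat graph"
    assume r: "120 * card (verts J) ^ 7 + 1 \<le> r"
      and "wf_graph G \<and> card (verts G) = n \<and> free {complete_graph (r + 1)} G"
    then have G: "wf_graph G" "card (verts G) = n" "count_copies (complete_graph (r + 1)) G = 0"
      by (auto simp: free_def)
    have fin: "finite (verts J)" "finite (verts G)" using J G(1) by (auto simp: wf_graph_def)
    have "host r (verts G) (adj G)"
      using G symp_adj[of G] irreflp_adj[OF G(1)] complete_graph_free_iff[OF G(1)] by (auto simp: host_def)
    then have "card (embs J G) \<le> card (embs J (turan r n))"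
      using turan_maximises_embeddings[OF fin(1) symp_adj irreflp_adj[OF J] fin(2) _ r] G(2)
      by (simp add: emb_turan)
    then have "count_copies J G * card (embs J J) \<le> count_copies J (turan r n) * card (embs J J)"
      using fin by (simp add: count_copies_mult_automorphisms[OF J])
    then show "count_copies J G \<le> count_copies J (turan r n)"
      using card_embs_self_pos[OF J] by simp
  qed simp
  then have "?Q (omega0 J)" unfolding omega0_def by (rule LeastI)
  then show "1 \<le> omega0 J" and "\<And>r n (G :: nat graph). \<lbrakk>omega0 J \<le> r; 1 \<le> n; wf_graph G; card (verts G) = n;
      free {complete_graph (r + 1)} G\<rbrakk> \<Longrightarrow> count_copies J G \<le> count_copies J (turan r n)"
    by blast+
qed

text \<open>\<open>omega0\<close> speaks of graphs on \<open>nat\<close> with an exact and positive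
  number of vertices. So the host is transported along an enumeration and the empty host is treated
  apart; the step from \<open>n\<close> to \<open>m\<close> uses that \<open>turan r n\<close> is
  the part of \<open>turan r m\<close> on the first \<open>n\<close> vertices.\<close>

lemma card_emb_le_turan:
  fixes V :: "'a set"
  assumes J: "wf_graph J" and r: "omega0 J \<le> r" and V: "finite V" "card V \<le> m" and E: "host r V E"
  shows "card (emb (verts J) (adj J) V E) \<le> card (embs J (turan r m))"
proof (cases "V = {}")
  case True
  have "card (emb (verts J) (adj J) {} E) \<le> card (embs J (turan r m))"
    by (rule card_emb_host_le[where \<phi> = "\<lambda>_. 0"]) (use J in \<open>auto simp: wf_graph_def\<close>)
  then show ?thesis by (simp only: True)
next
  case False
  have finJ: "finite (verts J)" using J by (simp add: wf_graph_def)
  have irr: "\<not> E x x" and sym: "E x y \<Longrightarrow> E y x" for x y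
    using E by (auto simp: host_def dest: irreflpD sympD)
  define n where "n = card V"
  have n1: "1 \<le> n" using V False by (simp add: n_def Suc_le_eq card_gt_0_iff)
  obtain \<beta> where \<beta>: "bij_betw \<beta> V {0..<n}" using ex_bij_betw_finite_nat[OF V(1)] by (auto simp: n_def)
  have \<beta>V: "\<beta> x < n" if "x \<in> V" for x using bij_betw_apply[OF \<beta> that] by simp
  have \<beta>eq: "\<beta> x = \<beta> y \<longleftrightarrow> x = y" if "x \<in> V" "y \<in> V" for x y
    using inj_on_eq_iff[OF bij_betw_imp_inj_on[OF \<beta>] that] .
  define G :: "nat graph" where "G = ({0..<n}, {{\<beta> x, \<beta> y} | x y. x \<in> V \<and> y \<in> V \<and> E x y})"
  have vG: "verts G = {0..<n}" by (simp add: G_def verts_def)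
  have aG: "adj G (\<beta> x) (\<beta> y) \<longleftrightarrow> E x y" if "x \<in> V" "y \<in> V" for x y
    using that sym by (auto simp: G_def adj_def edges_def doubleton_eq_iff \<beta>eq)
  have wf: "wf_graph G"
    unfolding wf_graph_def vG
  proof (intro conjI ballI)
    fix e assume "e \<in> edges G"
    then obtain x y where "x \<in> V" "y \<in> V" "E x y" "e = {\<beta> x, \<beta> y}" by (auto simp: G_def edges_def)
    then show "e \<subseteq> {0..<n}" "card e = 2" using \<beta>V \<beta>eq[of x y] irr[of x] by auto
  qed simp
  have "clique_le r (verts G) (adj G)"
    unfolding clique_le_def
  proof (intro allI impI)
    fix C assume C: "C \<subseteq> verts G" "\<forall>a\<in>C. \<forall>b\<in>C. a \<noteq> b \<longrightarrow> adj G a b"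
    then obtain C' where C': "C' \<subseteq> V" "C = \<beta> ` C'" using \<beta> by (metis vG bij_betw_def subset_imageE)
    have "\<forall>a\<in>C'. \<forall>b\<in>C'. a \<noteq> b \<longrightarrow> E a b"
      using C(2) C' aG \<beta>eq by (metis imageI subsetD)
    then have "card C' \<le> r" using E C'(1) by (auto simp: host_def clique_le_def)
    then show "card C \<le> r" using card_image_le[OF finite_subset[OF C'(1) V(1)], of \<beta>] C'(2) by simp
  qed
  then have "free {complete_graph (r + 1)} G" using complete_graph_free_iff[OF wf] by (simp add: free_def)
  then have "count_copies J G \<le> count_copies J (turan r n)"
    using omega0_spec(2)[OF J r n1 wf] vG by simp
  then have "card (embs J G) \<le> card (embs J (turan r n))"
    using count_copies_mult_automorphisms[OF J] vG by (metis finite_atLeastLessThan mult_le_mono1 verts_turan)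
  moreover have "card (emb (verts J) (adj J) V E) = card (embs J G)"
    unfolding vG by (rule card_emb_host_eq[OF finJ V(1) \<beta>]) (rule aG)
  moreover have "card (embs J (turan r n)) \<le> card (embs J (turan r m))"
    using finJ V(2) by (intro card_mono finite_emb emb_mono) (auto simp: adj_turan n_def)
  ultimately show ?thesis by simp
qed

section \<open>Splitting off a clique of dominating vertices\<close>

definition common_nbrs :: "'a set \<Rightarrow> ('a \<Rightarrow> 'a \<Rightarrow> bool) \<Rightarrow> 'a set \<Rightarrow> 'a set" where
  "common_nbrs V E K = {v \<in> V. \<forall>k\<in>K. E k v}"

text \<open>An embedding of a graph is an embedding of a clique of dominating vertices together with an
  embedding of the rest into the common neighbourhood of the image of that clique.\<close>

lemma card_emb_dominating:
  assumes fin: "finite P" "finite V" and S: "S \<subseteq> P"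
    and dom: "\<And>s p. \<lbrakk>s \<in> S; p \<in> P; p \<noteq> s\<rbrakk> \<Longrightarrow> R s p"
    and R: "symp R" "irreflp R" and E: "symp E" "irreflp E"
  shows "card (emb P R V E) =
    (\<Sum>g\<in>emb S (\<noteq>) V E. card (emb (P - S) R (common_nbrs V E (g ` S)) E))"
    and "\<And>g k. \<lbrakk>g \<in> emb S (\<noteq>) V E; k \<in> emb (P - S) R (common_nbrs V E (g ` S)) E\<rbrakk> \<Longrightarrow>
      (\<lambda>p. if p \<in> S then g p else k p) \<in> emb P R V E"
proof -
  let ?fib = "\<lambda>g. {f \<in> emb P R V E. restrict f S = g}"
  let ?join = "\<lambda>g k p. if p \<in> S then g p else k p"
  have finS: "finite S" using S fin(1) by (rule finite_subset)
  have irr: "\<not> E x x" and sym: "E x y \<Longrightarrow> E y x" for x y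
    using E by (auto dest: irreflpD sympD)
  have Rirr: "\<not> R x x" and Rsym: "R x y \<Longrightarrow> R y x" for x y
    using R by (auto dest: irreflpD sympD)
  show join: "?join g k \<in> emb P R V E"
    if g: "g \<in> emb S (\<noteq>) V E" and k: "k \<in> emb (P - S) R (common_nbrs V E (g ` S)) E" for g k
  proof (rule emb_I)
    have kC: "k p \<in> V" "E (g s) (k p)" if "p \<in> P - S" "s \<in> S" for p s
      using emb_D(1)[OF k that(1)] that(2) by (auto simp: common_nbrs_def)
    show "?join g k \<in> extensional P"
      using emb_D(2)[OF g] emb_D(2)[OF k] S by (auto simp: extensional_def)
    \<comment> \<open>\<open>k\<close> avoids the image of \<open>g\<close>, because a common
      neighbour lying in that image would be adjacent to itself.\<close>
    show "inj_on (?join g k) P"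
    proof (rule inj_onI)
      fix a b assume ab: "a \<in> P" "b \<in> P" "?join g k a = ?join g k b"
      then show "a = b"
        using emb_D(3)[OF g] emb_D(3)[OF k] kC irr
        by (cases "a \<in> S"; cases "b \<in> S") (auto dest: inj_onD, metis Diff_iff, metis Diff_iff)
    qed
    fix a assume a: "a \<in> P"
    show "?join g k a \<in> V"
      using emb_D(1)[OF g, of a] emb_D(1)[OF k, of a] a by (auto simp: common_nbrs_def)
    fix b assume b: "b \<in> P" and ab: "R a b"
    have "a \<noteq> b" using ab Rirr by auto
    then show "E (?join g k a) (?join g k b)"
      using emb_D(4)[OF g, of a b] emb_D(4)[OF k, of a b] kC sym a b ab by auto
  qed
  have res: "restrict f S \<in> emb S (\<noteq>) V E" if f: "f \<in> emb P R V E" for f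
  proof (rule emb_I)
    fix a b assume "a \<in> S" "b \<in> S" "a \<noteq> b"
    then show "E (restrict f S a) (restrict f S b)"
      using emb_D(4)[OF f, of a b] dom S by (simp add: subset_iff)
  qed (use emb_D[OF f] S in \<open>auto intro: inj_on_subset\<close>)
  have fib: "card (?fib g) = card (emb (P - S) R (common_nbrs V E (g ` S)) E)"
    if g: "g \<in> emb S (\<noteq>) V E" for g
  proof (rule bij_betw_same_card, rule bij_betw_byWitness[where f = "\<lambda>f. restrict f (P - S)" and f' = "?join g"])
    show "\<forall>f\<in>?fib g. ?join g (restrict f (P - S)) = f"
    proof (clarify, rule ext)
      fix f p assume f: "f \<in> emb P R V E"
      show "(if p \<in> S then restrict f S p else restrict f (P - S) p) = f p"
        using emb_D(2)[OF f] S by (auto simp: extensional_def)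
    qed
    show "\<forall>k\<in>emb (P - S) R (common_nbrs V E (g ` S)) E. restrict (?join g k) (P - S) = k"
    proof
      fix k assume k: "k \<in> emb (P - S) R (common_nbrs V E (g ` S)) E"
      show "restrict (?join g k) (P - S) = k"
        by (rule extensionalityI[of _ "P - S"]) (use emb_D(2)[OF k] in auto)
    qed
    show "(\<lambda>f. restrict f (P - S)) ` ?fib g \<subseteq> emb (P - S) R (common_nbrs V E (g ` S)) E"
    proof clarify
      fix f assume f: "f \<in> emb P R V E"
      show "restrict f (P - S) \<in> emb (P - S) R (common_nbrs V E (restrict f S ` S)) E"
      proof (rule emb_I)
        fix p assume p: "p \<in> P - S"
        have "E (f s) (f p)" if "s \<in> S" for s
          using emb_D(4)[OF f, of s p] dom[OF that, of p] p that S by auto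
        then show "restrict f (P - S) p \<in> common_nbrs V E (restrict f S ` S)"
          using emb_D(1)[OF f, of p] p by (auto simp: common_nbrs_def)
      qed (use emb_D[OF f] in \<open>auto intro: inj_on_subset\<close>)
    qed
    show "?join g ` emb (P - S) R (common_nbrs V E (g ` S)) E \<subseteq> ?fib g"
    proof (rule image_subsetI)
      fix k assume k: "k \<in> emb (P - S) R (common_nbrs V E (g ` S)) E"
      have "restrict (?join g k) S = g"
        by (rule extensionalityI[of _ S]) (use emb_D(2)[OF g] in auto)
      then show "?join g k \<in> ?fib g" using join[OF g k] by simp
    qed
  qed
  have "emb P R V E = (\<Union>g\<in>emb S (\<noteq>) V E. ?fib g)" using res by blast
  then have "card (emb P R V E) = card (\<Union>g\<in>emb S (\<noteq>) V E. ?fib g)" by simp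
  also have "\<dots> = (\<Sum>g\<in>emb S (\<noteq>) V E. card (?fib g))"
    by (rule card_UN_disjoint) (use finite_emb[OF finS fin(2)] finite_emb[OF fin] in auto)
  also have "\<dots> = (\<Sum>g\<in>emb S (\<noteq>) V E. card (emb (P - S) R (common_nbrs V E (g ` S)) E))"
    by (rule sum.cong) (use fib in auto)
  finally show "card (emb P R V E) =
    (\<Sum>g\<in>emb S (\<noteq>) V E. card (emb (P - S) R (common_nbrs V E (g ` S)) E))" .
qed

text \<open>With \<open>(\<noteq>)\<close> as both relations, \<open>emb\<close> consists of plain
  injections. An image of size \<open>card S\<close> is chosen, and each image is reached by as many
  injections as \<open>S\<close> has permutations.\<close>

lemma card_injections:
  assumes "finite S" "finite D"
  shows "card (emb S (\<noteq>) D (\<noteq>)) = (card D choose card S) * card (emb S (\<noteq>) S (\<noteq>))"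
proof -
  let ?I = "{T. T \<subseteq> D \<and> card T = card S}"
  let ?F = "\<lambda>T. {g \<in> emb S (\<noteq>) D (\<noteq>). g ` S = T}"
  have F: "card (?F T) = card (emb S (\<noteq>) S (\<noteq>))" if T: "T \<in> ?I" for T
  proof -
    have finT: "finite T" by (rule finite_subset[OF _ assms(2)]) (use T in simp)
    have "?F T = emb S (\<noteq>) T (\<noteq>)"
    proof
      show "?F T \<subseteq> emb S (\<noteq>) T (\<noteq>)" by (auto simp: emb_def PiE_def Pi_def)
      have "g ` S = T" if g: "g \<in> emb S (\<noteq>) T (\<noteq>)" for g
        using card_subset_eq[OF finT emb_D(5)[OF g]] card_image[OF emb_D(3)[OF g]] T by simp
      moreover have "emb S (\<noteq>) T (\<noteq>) \<subseteq> emb S (\<noteq>) D (\<noteq>)" using T by (intro emb_mono) auto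
      ultimately show "emb S (\<noteq>) T (\<noteq>) \<subseteq> ?F T" by blast
    qed
    moreover obtain \<phi> where \<phi>: "bij_betw \<phi> S T"
      using finite_same_card_bij[OF assms(1) finT] T by auto
    have "card (emb S (\<noteq>) S (\<noteq>)) = card (emb S (\<noteq>) T (\<noteq>))"
      by (rule card_emb_host_eq[OF assms(1,1) \<phi>])
        (use inj_on_eq_iff[OF bij_betw_imp_inj_on[OF \<phi>]] in auto)
    ultimately show ?thesis by simp
  qed
  have "emb S (\<noteq>) D (\<noteq>) = (\<Union>T\<in>?I. ?F T)"
  proof
    show "emb S (\<noteq>) D (\<noteq>) \<subseteq> (\<Union>T\<in>?I. ?F T)"
    proof
      fix g assume g: "g \<in> emb S (\<noteq>) D (\<noteq>)"
      then have "g ` S \<in> ?I" using emb_D(5)[OF g] card_image[OF emb_D(3)[OF g]] by simp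
      then show "g \<in> (\<Union>T\<in>?I. ?F T)" using g by auto
    qed
  qed auto
  then have "card (emb S (\<noteq>) D (\<noteq>)) = card (\<Union>T\<in>?I. ?F T)" by simp
  also have "\<dots> = (\<Sum>T\<in>?I. card (?F T))"
    by (rule card_UN_disjoint) (use assms finite_emb[OF assms] in auto)
  also have "\<dots> = (\<Sum>T\<in>?I. card (emb S (\<noteq>) S (\<noteq>)))" by (rule sum.cong) (use F in auto)
  finally show ?thesis using assms by (simp add: n_subsets)
qed

text \<open>The case of a clique in \<open>count_copies_mult_automorphisms\<close>, relabelled by
  \<open>S\<close> so that cliques can be indexed by the dominating vertices to be deleted.\<close>

lemma kcount_mult_automorphisms:
  assumes G: "finite (verts G)" and S: "finite S" "card S = u"
  shows "kcount u G * card (emb S (\<noteq>) S (\<noteq>)) = card (emb S (\<noteq>) (verts G) (adj G))"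
proof -
  obtain \<sigma> where \<sigma>: "bij_betw \<sigma> {0..<u} S" using ex_bij_betw_nat_finite[OF S(1)] S(2) by auto
  have adj\<sigma>: "\<sigma> a \<noteq> \<sigma> b \<longleftrightarrow> adj (complete_graph u) a b" if "a \<in> {0..<u}" "b \<in> {0..<u}" for a b
    using inj_on_eq_iff[OF bij_betw_imp_inj_on[OF \<sigma>] that] that by (auto simp: adj_complete_graph)
  have lab: "card (emb S (\<noteq>) V E) = card (emb {0..<u} (adj (complete_graph u)) V E)" if "finite V" for V :: "'c set" and E
    by (rule card_emb_label_eq[OF S(1) that \<sigma>]) (rule adj\<sigma>)
  have "card (emb {0..<u} (adj (complete_graph u)) {0..<u} (adj (complete_graph u)))
      = card (emb {0..<u} (adj (complete_graph u)) S (\<noteq>))"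
    by (rule card_emb_host_eq[OF _ _ \<sigma>]) (use adj\<sigma> in auto)
  also have "\<dots> = card (emb S (\<noteq>) S (\<noteq>))" using lab[OF S(1)] by simp
  finally have "kcount u G * card (emb S (\<noteq>) S (\<noteq>)) = card (embs (complete_graph u) G)"
    using count_copies_mult_automorphisms[OF wf_complete_graph[of u] G]
    unfolding kcount_def verts_complete_graph by simp
  also have "\<dots> = card (emb S (\<noteq>) (verts G) (adj G))"
  proof -
    obtain \<tau> where \<tau>: "bij_betw \<tau> S {0..<u}" using \<sigma> bij_betw_inv_into by blast
    show ?thesis
      unfolding verts_complete_graph
      by (rule card_emb_label_eq[OF _ G \<tau>])
        (use inj_on_eq_iff[OF bij_betw_imp_inj_on[OF \<tau>]] bij_betw_apply[OF \<tau>] in \<open>auto simp: adj_complete_graph\<close>)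
  qed
  finally show ?thesis .
qed

lemma verts_delete_verts [simp]: "verts (delete_verts H S) = verts H - S"
  by (simp add: delete_verts_def verts_def)

lemma adj_delete_verts: "adj (delete_verts H S) a b \<longleftrightarrow> adj H a b \<and> a \<notin> S \<and> b \<notin> S"
  by (auto simp: delete_verts_def edges_def adj_def)

lemma wf_delete_verts: "wf_graph H \<Longrightarrow> wf_graph (delete_verts H S)"
  by (auto simp: wf_graph_def delete_verts_def verts_def edges_def)

lemma emb_cong_label:
  assumes "\<And>a b. \<lbrakk>a \<in> P; b \<in> P\<rbrakk> \<Longrightarrow> R a b \<longleftrightarrow> R' a b"
  shows "emb P R V E = emb P R' V E"
  using assms by (auto simp: emb_def)

lemma emb_delete_verts: "emb (verts H - S) (adj (delete_verts H S)) V E = emb (verts H - S) (adj H) V E"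
  by (rule emb_cong_label) (auto simp: adj_delete_verts)

lemma dominating_adj:
  "\<lbrakk>s \<in> dominating_vertices H; p \<in> verts H; p \<noteq> s\<rbrakk> \<Longrightarrow> adj H s p"
  by (auto simp: dominating_vertices_def adj_def)

text \<open>A bijection from \<open>T - S\<close> to \<open>S - T\<close>, extended by the identity,
  is an isomorphism between the two remainders, since the exchanged vertices are adjacent to
  everything. So the choice of the deleted dominating vertices does not affect the isomorphism
  type.\<close>

lemma card_emb_delete_dominating_eq:
  assumes H: "wf_graph H" and S: "S \<subseteq> dominating_vertices H" and T: "T \<subseteq> dominating_vertices H"
    and eq: "card S = card T"
  shows "card (emb (verts H - S) (adj H) (verts H - T) (adj H)) =
    card (emb (verts H - S) (adj H) (verts H - S) (adj H))"
proof -
  have fin: "finite (verts H)" using H by (simp add: wf_graph_def)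
  have sub: "S \<subseteq> verts H" "T \<subseteq> verts H" using S T by (auto simp: dominating_vertices_def)
  then have finST: "finite S" "finite T" using finite_subset[OF _ fin] by auto
  have "card (T - S) = card (S - T)"
    using eq finST by (metis card_Diff_subset_Int Int_commute finite_Int)
  then obtain \<beta> where \<beta>: "bij_betw \<beta> (T - S) (S - T)"
    using finite_same_card_bij[of "T - S" "S - T"] finST by auto
  define \<phi> where "\<phi> v = (if v \<in> T then \<beta> v else v)" for v
  have bij: "bij_betw \<phi> ((T - S) \<union> (verts H - (S \<union> T))) ((S - T) \<union> (verts H - (S \<union> T)))"
  proof (rule bij_betw_combine)
    show "bij_betw \<phi> (T - S) (S - T)"
      using \<beta> by (subst bij_betw_cong[of _ \<phi> \<beta>]) (auto simp: \<phi>_def)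
    show "bij_betw \<phi> (verts H - (S \<union> T)) (verts H - (S \<union> T))"
      by (subst bij_betw_cong[of _ \<phi> id]) (auto simp: \<phi>_def)
  qed auto
  have "(T - S) \<union> (verts H - (S \<union> T)) = verts H - S" "(S - T) \<union> (verts H - (S \<union> T)) = verts H - T"
    using sub by auto
  with bij have bij': "bij_betw \<phi> (verts H - S) (verts H - T)" by simp
  have sym: "adj H a b \<longleftrightarrow> adj H b a" for a b by (auto simp: adj_def insert_commute)
  have irr: "\<not> adj H a a" for a using irreflp_adj[OF H] by (auto dest: irreflpD)
  have dom: "adj H (\<phi> x) (\<phi> y) \<longleftrightarrow> adj H x y" if xy: "x \<in> verts H - S" "y \<in> verts H - S" for x y
  proof (cases "x = y")
    case False
    have ne: "\<phi> x \<noteq> \<phi> y" using inj_on_eq_iff[OF bij_betw_imp_inj_on[OF bij'] xy] False by simp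
    have mem: "\<phi> x \<in> verts H" "\<phi> y \<in> verts H" using bij_betw_apply[OF bij'] xy by auto
    have \<phi>T: "\<phi> v \<in> S" if "v \<in> verts H - S" "v \<in> T" for v
      using bij_betw_apply[OF \<beta>, of v] that by (auto simp: \<phi>_def)
    consider "x \<in> T" | "y \<in> T" | "x \<notin> T" "y \<notin> T" by blast
    then show ?thesis
    proof cases
      case 1
      have "adj H x y" using dominating_adj[of x H y] 1 T xy False by auto
      moreover have "adj H (\<phi> x) (\<phi> y)" using dominating_adj[of "\<phi> x" H "\<phi> y"] \<phi>T[OF xy(1) 1] S mem ne by auto
      ultimately show ?thesis by simp
    next
      case 2
      have "adj H y x" using dominating_adj[of y H x] 2 T xy False by auto
      moreover have "adj H (\<phi> y) (\<phi> x)" using dominating_adj[of "\<phi> y" H "\<phi> x"] \<phi>T[OF xy(2) 2] S mem ne by auto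
      ultimately show ?thesis using sym by blast
    qed (simp add: \<phi>_def)
  qed (simp add: irr)
  show ?thesis
    by (rule card_emb_host_eq[symmetric, OF _ _ bij']) (use fin dom in auto)
qed

text \<open>\<open>card_emb_dominating\<close> is applied with \<open>H\<close> as its own host.
  Automorphisms preserve the dominating vertices, so only injections of \<open>S\<close> into these
  extend, and all of them extend in the same number of ways. The binomial coefficient of the final
  bound comes from here.\<close>

lemma card_automorphisms_dominating:
  assumes H: "wf_graph H" and S: "S \<subseteq> dominating_vertices H"
  shows "card (embs H H) = (dom_num H choose card S) * card (emb S (\<noteq>) S (\<noteq>)) *
    card (embs (delete_verts H S) (delete_verts H S))"
proof -
  let ?P = "verts H" and ?R = "adj H" and ?D = "dominating_vertices H"
  let ?N = "\<lambda>g. card (emb (?P - S) ?R (common_nbrs ?P ?R (g ` S)) ?R)"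
  have fin: "finite ?P" using H by (simp add: wf_graph_def)
  have DP: "?D \<subseteq> ?P" by (auto simp: dominating_vertices_def)
  have finD: "finite ?D" and finS: "finite S" using fin DP S by (meson finite_subset)+
  have SP: "S \<subseteq> ?P" using S DP by blast
  have irr: "\<not> ?R a a" for a using irreflp_adj[OF H] by (auto dest: irreflpD)
  note dom = card_emb_dominating[OF fin fin SP dominating_adj symp_adj irreflp_adj[OF H] symp_adj irreflp_adj[OF H]]
  \<comment> \<open>An extension \<open>k\<close> would combine with \<open>g\<close> to an
    automorphism, which sends dominating vertices to dominating vertices.\<close>
  have zero: "?N g = 0" if g: "g \<in> emb S (\<noteq>) ?P ?R" and nD: "\<not> g ` S \<subseteq> ?D" for g
  proof (rule ccontr)
    assume "?N g \<noteq> 0"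
    then obtain k where k: "k \<in> emb (?P - S) ?R (common_nbrs ?P ?R (g ` S)) ?R" by fastforce
    define f where "f = (\<lambda>p. if p \<in> S then g p else k p)"
    have f: "f \<in> embs H H" unfolding f_def by (rule dom(2)[OF _ _ _ g k]) (use S in auto)
    have "g s \<in> ?D" if s: "s \<in> S" for s
    proof -
      have "f s = g s" using s by (simp add: f_def)
      have "adj H (f s) w" if w: "w \<in> ?P" "w \<noteq> f s" for w
      proof -
        obtain p where "p \<in> ?P" "w = f p" using embs_self_surj(1)[OF H f] w(1) by blast
        then show ?thesis
          using emb_D(4)[OF f, of s p] dominating_adj[of s H p] w(2) s S SP by auto
      qed
      moreover have "f s \<in> ?P" using emb_D(1)[OF f] s SP by blast
      ultimately show ?thesis using \<open>f s = g s\<close> by (auto simp: dominating_vertices_def adj_def)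
    qed
    then show False using nD by blast
  qed
  have const: "?N g = card (emb (?P - S) ?R (?P - S) ?R)" if g: "g \<in> emb S (\<noteq>) ?D (\<noteq>)" for g
  proof -
    have gD: "g ` S \<subseteq> ?D" by (rule emb_D(5)[OF g])
    have "common_nbrs ?P ?R (g ` S) = ?P - g ` S"
    proof
      show "common_nbrs ?P ?R (g ` S) \<subseteq> ?P - g ` S" using irr by (auto simp: common_nbrs_def)
      have "?R k v" if "v \<in> ?P - g ` S" "k \<in> g ` S" for k v
        by (rule dominating_adj) (use that gD in auto)
      then show "?P - g ` S \<subseteq> common_nbrs ?P ?R (g ` S)" by (auto simp: common_nbrs_def)
    qed
    then show ?thesis
      using card_emb_delete_dominating_eq[OF H S gD] card_image[OF emb_D(3)[OF g]] by simp
  qed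
  \<comment> \<open>Dominating vertices are pairwise adjacent, so the injections into their set are
    exactly the clique embeddings with image there.\<close>
  have sub: "emb S (\<noteq>) ?D (\<noteq>) = {g \<in> emb S (\<noteq>) ?P ?R. g ` S \<subseteq> ?D}"
  proof
    show "emb S (\<noteq>) ?D (\<noteq>) \<subseteq> {g \<in> emb S (\<noteq>) ?P ?R. g ` S \<subseteq> ?D}"
    proof
      fix g assume g: "g \<in> emb S (\<noteq>) ?D (\<noteq>)"
      have "g \<in> emb S (\<noteq>) ?P ?R"
        by (rule subsetD[OF emb_mono g]) (use DP in \<open>auto intro: dominating_adj\<close>)
      then show "g \<in> {g \<in> emb S (\<noteq>) ?P ?R. g ` S \<subseteq> ?D}" using emb_D(5)[OF g] by blast
    qed
    show "{g \<in> emb S (\<noteq>) ?P ?R. g ` S \<subseteq> ?D} \<subseteq> emb S (\<noteq>) ?D (\<noteq>)"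
      by (auto simp: emb_def PiE_def Pi_def inj_on_def)
  qed
  have "card (embs H H) = (\<Sum>g\<in>emb S (\<noteq>) ?P ?R. ?N g)"
    by (rule dom(1)) (use S in auto)
  also have "\<dots> = (\<Sum>g\<in>emb S (\<noteq>) ?D (\<noteq>). ?N g)"
    by (rule sum.mono_neutral_right) (use finite_emb[OF finS fin] sub zero in auto)
  also have "\<dots> = (\<Sum>g\<in>emb S (\<noteq>) ?D (\<noteq>). card (emb (?P - S) ?R (?P - S) ?R))"
    by (rule sum.cong) (use const in auto)
  also have "\<dots> = (card ?D choose card S) * card (emb S (\<noteq>) S (\<noteq>)) * card (emb (?P - S) ?R (?P - S) ?R)"
    by (simp add: card_injections[OF finS finD])
  also have "emb (?P - S) ?R (?P - S) ?R = embs (delete_verts H S) (delete_verts H S)"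
    unfolding verts_delete_verts emb_delete_verts by (rule emb_cong) (auto simp: adj_delete_verts)
  finally show ?thesis by (simp add: dom_num_def)
qed

text \<open>Both sides count the embeddings of \<open>H\<close> in \<open>G\<close>: the left one by
  copies, with the number of automorphisms factorised, the right one by the images of
  \<open>S\<close>.\<close>

lemma dominating_copies:
  assumes H: "wf_graph H" and S: "S \<subseteq> dominating_vertices H" "card S = u" and G: "wf_graph G"
  defines "J \<equiv> delete_verts H S"
  shows "count_copies H G * (dom_num H choose u) * card (emb S (\<noteq>) S (\<noteq>)) * card (embs J J) =
    (\<Sum>g\<in>emb S (\<noteq>) (verts G) (adj G).
      card (emb (verts J) (adj J) (common_nbrs (verts G) (adj G) (g ` S)) (adj G)))"
proof -
  have fin: "finite (verts H)" "finite (verts G)" using H G by (auto simp: wf_graph_def)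
  have SP: "S \<subseteq> verts H" using S(1) by (auto simp: dominating_vertices_def)
  have "count_copies H G * card (embs H H) = card (embs H G)"
    by (rule count_copies_mult_automorphisms[OF H fin(2)])
  also have "\<dots> = (\<Sum>g\<in>emb S (\<noteq>) (verts G) (adj G).
      card (emb (verts H - S) (adj H) (common_nbrs (verts G) (adj G) (g ` S)) (adj G)))"
    by (rule card_emb_dominating(1)[OF fin SP dominating_adj symp_adj irreflp_adj[OF H] symp_adj irreflp_adj[OF G]])
      (use S(1) in auto)
  finally show ?thesis
    by (simp add: J_def emb_delete_verts card_automorphisms_dominating[OF H S(1)] S(2) mult.assoc)
qed

section \<open>The upper bound through common neighbourhoods of cliques\<close>

text \<open>The clique and \<open>D + 1\<close> of its common neighbours would contain a split
  graph; edges among the latter do no harm, as copies need not be induced.\<close>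

lemma common_nbrs_card_le:
  assumes G: "wf_graph G" and free: "count_copies (split_graph u D) G = 0"
    and g: "g \<in> emb S (\<noteq>) (verts G) (adj G)" and S: "finite S" "card S = u"
  shows "card (common_nbrs (verts G) (adj G) (g ` S)) \<le> D"
proof (rule ccontr)
  let ?C = "common_nbrs (verts G) (adj G) (g ` S)"
  have fin: "finite (verts G)" using G by (simp add: wf_graph_def)
  have irr: "\<not> adj G a a" and sym: "adj G a b \<longleftrightarrow> adj G b a" for a b
    using irreflp_adj[OF G] by (auto dest: irreflpD simp: adj_def insert_commute)
  assume "\<not> card ?C \<le> D"
  then obtain X where X: "X \<subseteq> ?C" "card X = D + 1"
    by (metis Suc_eq_plus1 not_less_eq_eq obtain_subset_with_card_n)
  have "finite X" using X(1) fin by (auto simp: common_nbrs_def intro: finite_subset)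
  then obtain \<gamma> where \<gamma>: "bij_betw \<gamma> {0..<D + 1} X" using ex_bij_betw_nat_finite[of X] X(2) by auto
  obtain \<sigma> where \<sigma>: "bij_betw \<sigma> {0..<u} S" using ex_bij_betw_nat_finite[OF S(1)] S(2) by auto
  \<comment> \<open>Indices below \<open>u\<close> run through the clique by way of \<sigma>, the
    later ones through the common neighbours by way of \<gamma>, shifted by
    \<open>u\<close>.\<close>
  define f where "f = restrict (\<lambda>i. if i < u then g (\<sigma> i) else \<gamma> (i - u)) {0..<u + D + 1}"
  have f1: "f i = g (\<sigma> i)" "\<sigma> i \<in> S" if "i < u" for i
    using that bij_betw_apply[OF \<sigma>, of i] by (auto simp: f_def)
  have f2: "f i = \<gamma> (i - u)" "f i \<in> ?C" if "u \<le> i" "i < u + D + 1" for i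
    using that bij_betw_apply[OF \<gamma>, of "i - u"] X(1) by (auto simp: f_def)
  have adj12: "adj G (f i) (f j)" if "i < u" "u \<le> j" "j < u + D + 1" for i j
    using f1[OF that(1)] f2(2)[OF that(2,3)] by (auto simp: common_nbrs_def)
  have adj11: "adj G (f i) (f j)" if "i < u" "j < u" "i \<noteq> j" for i j
  proof -
    have "\<sigma> i \<noteq> \<sigma> j" using inj_on_eq_iff[OF bij_betw_imp_inj_on[OF \<sigma>], of i j] that by simp
    then show ?thesis using emb_D(4)[OF g, of "\<sigma> i" "\<sigma> j"] f1 that by simp
  qed
  have "f \<in> embs (split_graph u D) G"
  proof (rule emb_I)
    show "f \<in> extensional (verts (split_graph u D))" by (simp add: f_def)
    fix i assume i: "i \<in> verts (split_graph u D)"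
    show "f i \<in> verts G"
      using f1[of i] emb_D(1)[OF g, of "\<sigma> i"] f2(2)[of i] i by (cases "i < u") (auto simp: common_nbrs_def)
  next
    show "inj_on f (verts (split_graph u D))"
    proof (rule inj_onI, rule ccontr)
      fix i j assume ij: "i \<in> verts (split_graph u D)" "j \<in> verts (split_graph u D)" "f i = f j" "i \<noteq> j"
      consider "i < u" "j < u" | "i < u" "u \<le> j" | "u \<le> i" "j < u" | "u \<le> i" "u \<le> j" by linarith
      then show False
      proof cases
        case 4
        then have "i - u = j - u"
          using f2(1)[of i] f2(1)[of j] ij(1-3) inj_on_eq_iff[OF bij_betw_imp_inj_on[OF \<gamma>], of "i - u" "j - u"]
          by auto
        then show False using 4 ij(4) by linarith
      qed (use ij irr adj11[of i j] adj12[of i j] adj12[of j i] in auto)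
    qed
  next
    fix i j assume ij: "adj (split_graph u D) i j"
    then consider "i < u" "j < u" | "i < u" "u \<le> j" | "u \<le> i" "j < u" unfolding adj_split_graph by linarith
    then show "adj G (f i) (f j)"
      by cases (use ij adj11[of i j] adj12[of i j] adj12[of j i] sym in \<open>auto simp: adj_split_graph\<close>)
  qed
  then show False using free count_copies_eq_0_iff[OF wf_split_graph fin] by auto
qed

text \<open>A clique among the common neighbours is disjoint from the given \<open>u\<close>
  vertices and adjacent to all of them, so together they form a clique with \<open>u\<close> more
  vertices.\<close>

lemma common_nbrs_host:
  assumes G: "wf_graph G" and free: "count_copies (complete_graph (w + 1)) G = 0"
    and g: "g \<in> emb S (\<noteq>) (verts G) (adj G)" and S: "finite S" "card S = u"
  shows "host (w - u) (common_nbrs (verts G) (adj G) (g ` S)) (adj G)"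
proof -
  let ?C = "common_nbrs (verts G) (adj G) (g ` S)"
  have fin: "finite (verts G)" using G by (simp add: wf_graph_def)
  have irr: "\<not> adj G a a" and sym: "adj G a b \<longleftrightarrow> adj G b a" for a b
    using irreflp_adj[OF G] by (auto dest: irreflpD simp: adj_def insert_commute)
  have cl: "clique_le w (verts G) (adj G)" using free complete_graph_free_iff[OF G] by simp
  have "clique_le (w - u) ?C (adj G)"
    unfolding clique_le_def
  proof (intro allI impI)
    fix K assume K: "K \<subseteq> ?C" "\<forall>a\<in>K. \<forall>b\<in>K. a \<noteq> b \<longrightarrow> adj G a b"
    have CV: "?C \<subseteq> verts G" by (auto simp: common_nbrs_def)
    then have finK: "finite K" using K(1) fin by (meson finite_subset)
    have KC: "adj G (g s) k" if "s \<in> S" "k \<in> K" for s k using that K(1) by (auto simp: common_nbrs_def)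
    have "\<forall>a\<in>K \<union> g ` S. \<forall>b\<in>K \<union> g ` S. a \<noteq> b \<longrightarrow> adj G a b"
    proof (intro ballI impI)
      fix a b assume ab: "a \<in> K \<union> g ` S" "b \<in> K \<union> g ` S" "a \<noteq> b"
      then show "adj G a b" using K(2) KC sym emb_D(4)[OF g] by blast
    qed
    moreover have "K \<union> g ` S \<subseteq> verts G" using K(1) CV emb_D(5)[OF g] by blast
    ultimately have "card (K \<union> g ` S) \<le> w" using cl by (auto simp: clique_le_def)
    moreover have "K \<inter> g ` S = {}" using KC irr by blast
    then have "card (K \<union> g ` S) = card K + u"
      using finK S card_image[OF emb_D(3)[OF g]] by (subst card_Un_disjoint) auto
    ultimately show "card K \<le> w - u" by simp
  qed
  then show ?thesis using symp_adj[of G] irreflp_adj[OF G] by (simp add: host_def)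
qed

text \<open>Each term of the sum in \<open>dominating_copies\<close> is at most the Turan value. The
  common factor \<open>?a\<close>, permutations of \<open>S\<close> times automorphisms of
  \<open>J\<close>, is cancelled at the end.\<close>

lemma copies_bound:
  assumes H: "wf_graph H" and S: "S \<subseteq> dominating_vertices H" "card S = u"
    and w: "omega0 (delete_verts H S) + u \<le> w" and G: "wf_graph G"
    and free: "count_copies (split_graph u D) G = 0" "count_copies (complete_graph (w + 1)) G = 0"
  shows "count_copies H G * (dom_num H choose u) \<le>
    kcount u G * count_copies (delete_verts H S) (turan (w - u) D)"
proof -
  define J where "J = delete_verts H S"
  let ?a = "card (emb S (\<noteq>) S (\<noteq>)) * card (embs J J)"
  have fin: "finite (verts H)" "finite (verts G)" using H G by (auto simp: wf_graph_def)
  have finS: "finite S" using S(1) fin(1) by (auto simp: dominating_vertices_def intro: finite_subset)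
  have J: "wf_graph J" unfolding J_def by (rule wf_delete_verts[OF H])
  let ?N = "\<lambda>g. card (emb (verts J) (adj J) (common_nbrs (verts G) (adj G) (g ` S)) (adj G))"
  have "count_copies H G * (dom_num H choose u) * ?a = (\<Sum>g\<in>emb S (\<noteq>) (verts G) (adj G). ?N g)"
    using dominating_copies[OF H S G] by (simp add: J_def mult.assoc)
  also have "\<dots> \<le> (\<Sum>g\<in>emb S (\<noteq>) (verts G) (adj G). card (embs J (turan (w - u) D)))"
  proof (rule sum_mono)
    fix g assume g: "g \<in> emb S (\<noteq>) (verts G) (adj G)"
    show "?N g \<le> card (embs J (turan (w - u) D))"
    proof (rule card_emb_le_turan[OF J])
      show "omega0 J \<le> w - u" using w by (simp add: J_def)
      show "finite (common_nbrs (verts G) (adj G) (g ` S))" using fin by (simp add: common_nbrs_def)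
      show "card (common_nbrs (verts G) (adj G) (g ` S)) \<le> D"
        by (rule common_nbrs_card_le[OF G free(1) g finS S(2)])
      show "host (w - u) (common_nbrs (verts G) (adj G) (g ` S)) (adj G)"
        by (rule common_nbrs_host[OF G free(2) g finS S(2)])
    qed
  qed
  also have "\<dots> = card (emb S (\<noteq>) (verts G) (adj G)) * card (embs J (turan (w - u) D))"
    by simp
  also have "\<dots> = (kcount u G * card (emb S (\<noteq>) S (\<noteq>))) *
      (count_copies J (turan (w - u) D) * card (embs J J))"
    using kcount_mult_automorphisms[OF fin(2) finS S(2)]
      count_copies_mult_automorphisms[OF J, of "turan (w - u) D"] by simp
  also have "\<dots> = kcount u G * count_copies J (turan (w - u) D) * ?a"
    by (simp only: mult_ac)
  finally have "count_copies H G * (dom_num H choose u) * ?a \<le> kcount u G * count_copies J (turan (w - u) D) * ?a" .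
  moreover have "0 < ?a"
  proof -
    have "restrict id S \<in> emb S (\<noteq>) S (\<noteq>)" by (rule emb_I) (auto simp: inj_on_def)
    then have "0 < card (emb S (\<noteq>) S (\<noteq>))" using finite_emb[OF finS finS] by (auto simp: card_gt_0_iff)
    then show ?thesis using card_embs_self_pos[OF J] by simp
  qed
  ultimately show ?thesis by (simp add: J_def)
qed

subsection \<open>Turan graphs with equal parts\<close>

lemma card_residue_classes:
  assumes "C \<subseteq> {..<w}"
  shows "card {v \<in> {0..<w * m}. v mod w \<in> C} = card C * m"
proof -
  have "card {v \<in> {0..<w * m}. v mod w \<in> C} = card (\<Union>c\<in>C. {v \<in> {0..<w * m}. v mod w = c})"
    by (rule arg_cong[where f = card]) auto
  also have "\<dots> = (\<Sum>c\<in>C. card {v \<in> {0..<w * m}. v mod w = c})"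
    by (rule card_UN_disjoint) (use finite_subset[OF assms] in auto)
  also have "\<dots> = (\<Sum>c\<in>C. m)"
  proof (rule sum.cong)
    fix c assume "c \<in> C"
    then have "c < w" using assms by auto
    then show "card {v \<in> {0..<w * m}. v mod w = c} = m" using card_residue_class[of c w "w * m"] by simp
  qed simp
  finally show ?thesis by simp
qed

text \<open>A clique of \<open>u\<close> vertices meets \<open>u\<close> different residue classes,
  and its common neighbours fill exactly the other classes, which are collected in
  \<open>C\<close>.\<close>

lemma turan_common_nbrs:
  fixes w m :: nat
  defines "T \<equiv> turan w (w * m)"
  assumes g: "g \<in> emb S (\<noteq>) (verts T) (adj T)" and S: "finite S" "card S = u" and w: "0 < w"
  obtains C where "C \<subseteq> {..<w}" "card C = w - u"
    "common_nbrs (verts T) (adj T) (g ` S) = {v \<in> {0..<w * m}. v mod w \<in> C}"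
proof -
  let ?A = "(\<lambda>s. g s mod w) ` S"
  have gT: "g s < w * m" if "s \<in> S" for s using emb_D(1)[OF g that] by (simp add: T_def)
  have "inj_on (\<lambda>s. g s mod w) S"
    using emb_D(4)[OF g] by (auto simp: inj_on_def T_def adj_turan)
  then have A: "card ?A = u" using S by (simp add: card_image)
  have "?A \<subseteq> {..<w}" using w by auto
  then have "card ({..<w} - ?A) = w - u" using A S by (subst card_Diff_subset) auto
  moreover have "common_nbrs (verts T) (adj T) (g ` S) = {v \<in> {0..<w * m}. v mod w \<in> {..<w} - ?A}"
    using w gT by (auto simp: common_nbrs_def T_def adj_turan image_iff)
  ultimately show ?thesis using that[of "{..<w} - ?A"] by auto
qed

text \<open>Here every term of the sum in \<open>dominating_copies\<close> equals the Turan value: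
  each common neighbourhood consists of \<open>w - u\<close> full parts of size \<open>m\<close>.
  For \<open>D = (w - u) * m\<close> the host has \<open>w * m\<close> vertices, which is
  \<open>w * D / (w - u)\<close>.\<close>

lemma turan_copies:
  assumes H: "wf_graph H" and S: "S \<subseteq> dominating_vertices H" "card S = u" and w: "u < w"
  shows "count_copies H (turan w (w * m)) * (dom_num H choose u) =
    kcount u (turan w (w * m)) * count_copies (delete_verts H S) (turan (w - u) ((w - u) * m))"
proof -
  define J where "J = delete_verts H S"
  define T where "T = turan w (w * m)"
  let ?a = "card (emb S (\<noteq>) S (\<noteq>)) * card (embs J J)"
  have fin: "finite (verts H)" "finite (verts T)" using H by (auto simp: wf_graph_def T_def)
  have finS: "finite S" using S(1) fin(1) by (auto simp: dominating_vertices_def intro: finite_subset)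
  have J: "wf_graph J" unfolding J_def by (rule wf_delete_verts[OF H])
  have finJ: "finite (verts J)" using J by (simp add: wf_graph_def)
  let ?N = "\<lambda>g. card (emb (verts J) (adj J) (common_nbrs (verts T) (adj T) (g ` S)) (adj T))"
  have "count_copies H T * (dom_num H choose u) * ?a = (\<Sum>g\<in>emb S (\<noteq>) (verts T) (adj T). ?N g)"
    using dominating_copies[OF H S, of T] wf_turan by (simp add: J_def T_def mult.assoc)
  also have "\<dots> = (\<Sum>g\<in>emb S (\<noteq>) (verts T) (adj T). card (embs J (turan (w - u) ((w - u) * m))))"
  proof (rule sum.cong[OF refl])
    fix g assume g: "g \<in> emb S (\<noteq>) (verts T) (adj T)"
    obtain C where C: "C \<subseteq> {..<w}" "card C = w - u"
      and CN: "common_nbrs (verts T) (adj T) (g ` S) = {v \<in> {0..<w * m}. v mod w \<in> C}"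
      using turan_common_nbrs[OF g[unfolded T_def] finS S(2)] w unfolding T_def by auto
    have finC: "finite C" by (rule finite_subset[OF C(1)]) simp
    obtain \<pi> where \<pi>: "bij_betw \<pi> C {..<w - u}"
      using finite_same_card_bij[OF finC, of "{..<w - u}"] C(2) by auto
    have "?N g = card (emb (verts J) (adj J) {v \<in> {0..<w * m}. v mod w \<in> C} (differ (\<lambda>i. i mod w)))"
      unfolding CN by (rule arg_cong[where f = card], rule emb_cong) (auto simp: T_def adj_turan differ_def)
    also have "\<dots> = card (emb (verts J) (adj J) {0..<(w - u) * m} (differ (\<lambda>i. i mod (w - u))))"
    proof (rule card_emb_differ_eq[OF finJ _ _ _ _ \<pi>])
      fix c assume c: "c \<in> C"
      then have "{v \<in> {v \<in> {0..<w * m}. v mod w \<in> C}. v mod w = c} = {v \<in> {0..<w * m}. v mod w = c}" by auto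
      moreover have "c < w" "\<pi> c < w - u" using c C(1) bij_betw_apply[OF \<pi> c] by auto
      ultimately show "card {v \<in> {v \<in> {0..<w * m}. v mod w \<in> C}. v mod w = c} =
          card {v \<in> {0..<(w - u) * m}. v mod (w - u) = \<pi> c}"
        using card_residue_class[of c w "w * m"] card_residue_class[of "\<pi> c" "w - u" "(w - u) * m"] by simp
    qed (use w in auto)
    finally show "?N g = card (embs J (turan (w - u) ((w - u) * m)))" by (simp add: emb_turan)
  qed
  also have "\<dots> = card (emb S (\<noteq>) (verts T) (adj T)) * card (embs J (turan (w - u) ((w - u) * m)))"
    by simp
  also have "\<dots> = (kcount u T * card (emb S (\<noteq>) S (\<noteq>))) *
      (count_copies J (turan (w - u) ((w - u) * m)) * card (embs J J))"
    using kcount_mult_automorphisms[OF fin(2) finS S(2)]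
      count_copies_mult_automorphisms[OF J, of "turan (w - u) ((w - u) * m)"] by simp
  also have "\<dots> = kcount u T * count_copies J (turan (w - u) ((w - u) * m)) * ?a"
    by (simp only: mult_ac)
  finally have "count_copies H T * (dom_num H choose u) * ?a =
    kcount u T * count_copies J (turan (w - u) ((w - u) * m)) * ?a" .
  moreover have "0 < ?a"
  proof -
    have "restrict id S \<in> emb S (\<noteq>) S (\<noteq>)" by (rule emb_I) (auto simp: inj_on_def)
    then have "0 < card (emb S (\<noteq>) S (\<noteq>))" using finite_emb[OF finS finS] by (auto simp: card_gt_0_iff)
    then show ?thesis using card_embs_self_pos[OF J] by simp
  qed
  ultimately show ?thesis by (simp add: J_def T_def)
qed

text \<open>The \<open>w\<close> parts exclude a larger clique, and the independent side of a split
  graph would be \<open>(w - u) * m + 1\<close> vertices inside a common neighbourhood of size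
  \<open>(w - u) * m\<close>.\<close>

lemma turan_free:
  assumes w: "u < w"
  shows "free {split_graph u ((w - u) * m), complete_graph (w + 1)} (turan w (w * m))"
proof -
  define T where "T = turan w (w * m)"
  define D where "D = (w - u) * m"
  have T: "wf_graph T" "finite (verts T)" by (auto simp: T_def wf_turan)
  have "host w {0..<w * m} (differ (\<lambda>i. i mod w))"
    by (rule host_differ[of _ _ "{..<w}"]) (use w in auto)
  then have "clique_le w (verts T) (adj T)"
    unfolding host_def clique_le_def by (simp add: T_def adj_turan differ_def)
  then have 1: "count_copies (complete_graph (w + 1)) T = 0" using complete_graph_free_iff[OF T(1)] by simp
  have "embs (split_graph u D) T = {}"
  proof (rule ccontr)
    assume "\<not> ?thesis"
    then obtain f where f: "f \<in> embs (split_graph u D) T" by blast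
    let ?S = "{0..<u}"
    have g: "restrict f ?S \<in> emb ?S (\<noteq>) (verts T) (adj T)"
    proof (rule emb_I)
      show "inj_on (restrict f ?S) ?S" using emb_D(3)[OF f] by (auto simp: inj_on_def)
    qed (use emb_D(1,4)[OF f] in \<open>auto simp: adj_split_graph\<close>)
    obtain C where C: "C \<subseteq> {..<w}" "card C = w - u"
      and CN: "common_nbrs (verts T) (adj T) (restrict f ?S ` ?S) = {v \<in> {0..<w * m}. v mod w \<in> C}"
      using turan_common_nbrs[OF g[unfolded T_def]] w unfolding T_def by auto
    have "card (f ` {u..<u + D + 1}) \<le> card (common_nbrs (verts T) (adj T) (restrict f ?S ` ?S))"
    proof (rule card_mono)
      show "finite (common_nbrs (verts T) (adj T) (restrict f ?S ` ?S))" using T by (simp add: common_nbrs_def)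
      show "f ` {u..<u + D + 1} \<subseteq> common_nbrs (verts T) (adj T) (restrict f ?S ` ?S)"
        using emb_D(1,4)[OF f] by (auto simp: common_nbrs_def adj_split_graph)
    qed
    also have "\<dots> = D" unfolding CN card_residue_classes[OF C(1)] by (simp add: C(2) D_def)
    also have "card (f ` {u..<u + D + 1}) = D + 1"
      using inj_on_subset[OF emb_D(3)[OF f], of "{u..<u + D + 1}"] by (subst card_image) auto
    finally show False by simp
  qed
  then have "count_copies (split_graph u D) T = 0" using count_copies_eq_0_iff[OF wf_split_graph T(2)] by simp
  then show ?thesis using 1 by (simp add: free_def T_def D_def)
qed

lemma turan_kcount_pos:
  assumes "u < w" "0 < m"
  shows "0 < kcount u (turan w (w * m))"
proof -
  have "w \<le> w * m" using assms(2) by simp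
  then have lt: "i < w * m" if "i < u" for i using assms(1) that by linarith
  have "restrict id {0..<u} \<in> embs (complete_graph u) (turan w (w * m))"
    by (rule emb_I) (use assms(1) lt in \<open>auto simp: adj_complete_graph adj_turan inj_on_def\<close>)
  then show ?thesis
    using count_copies_eq_0_iff[OF wf_complete_graph, of "turan w (w * m)" u] by (auto simp: kcount_def)
qed

section \<open>The limit\<close>

text \<open>Even and odd numbers separate the two sides, so the union stays on \<open>nat\<close>,
  the vertex type of the graphs in \<open>ex_u\<close>.\<close>

definition disjoint_union :: "nat graph \<Rightarrow> nat graph \<Rightarrow> nat graph" where
  "disjoint_union G1 G2 = ((\<lambda>i. 2 * i) ` verts G1 \<union> (\<lambda>i. 2 * i + 1) ` verts G2,
    (\<lambda>e. (\<lambda>i. 2 * i) ` e) ` edges G1 \<union> (\<lambda>e. (\<lambda>i. 2 * i + 1) ` e) ` edges G2)"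

lemma verts_disjoint_union:
  "verts (disjoint_union G1 G2) = (\<lambda>i. 2 * i) ` verts G1 \<union> (\<lambda>i. 2 * i + 1) ` verts G2"
  by (simp add: disjoint_union_def verts_def)

lemma inj_double: "inj (\<lambda>i :: nat. 2 * i)" "inj (\<lambda>i :: nat. 2 * i + 1)"
  by (auto simp: inj_def)

lemma wf_disjoint_union:
  assumes "wf_graph G1" "wf_graph G2"
  shows "wf_graph (disjoint_union G1 G2)"
proof -
  have card: "card ((\<lambda>i. 2 * i) ` e) = card e" "card ((\<lambda>i. 2 * i + 1) ` e) = card e" for e :: "nat set"
    by (rule card_image[OF inj_on_subset[OF inj_double(1) subset_UNIV]],
      rule card_image[OF inj_on_subset[OF inj_double(2) subset_UNIV]])
  show ?thesis
    unfolding wf_graph_def verts_disjoint_union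
  proof (intro conjI ballI)
    fix e assume "e \<in> edges (disjoint_union G1 G2)"
    then consider e' where "e' \<in> edges G1" "e = (\<lambda>i. 2 * i) ` e'"
      | e' where "e' \<in> edges G2" "e = (\<lambda>i. 2 * i + 1) ` e'"
      by (auto simp: disjoint_union_def edges_def)
    then have "e \<subseteq> (\<lambda>i. 2 * i) ` verts G1 \<union> (\<lambda>i. 2 * i + 1) ` verts G2 \<and> card e = 2"
    proof cases
      case 1
      then have "e' \<subseteq> verts G1" "card e' = 2" using assms(1) by (auto simp: wf_graph_def)
      then show ?thesis unfolding 1(2) card by blast
    next
      case 2
      then have "e' \<subseteq> verts G2" "card e' = 2" using assms(2) by (auto simp: wf_graph_def)
      then show ?thesis unfolding 2(2) card by blast
    qed
    then show "e \<subseteq> (\<lambda>i. 2 * i) ` verts G1 \<union> (\<lambda>i. 2 * i + 1) ` verts G2" "card e = 2" by simp_all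
  qed (use assms in \<open>simp add: wf_graph_def\<close>)
qed

lemma adj_disjoint_union:
  "adj (disjoint_union G1 G2) (2 * i) (2 * j) \<longleftrightarrow> adj G1 i j"
  "adj (disjoint_union G1 G2) (2 * i + 1) (2 * j + 1) \<longleftrightarrow> adj G2 i j"
  "adj (disjoint_union G1 G2) x y \<Longrightarrow> even x \<longleftrightarrow> even y"
proof -
  have ev: "even z" if "z \<in> (\<lambda>i. 2 * i) ` e" for z and e :: "nat set" using that by auto
  have od: "odd z" if "z \<in> (\<lambda>i. 2 * i + 1) ` e" for z and e :: "nat set" using that by auto
  have E: "edges (disjoint_union G1 G2) =
      (\<lambda>e. (\<lambda>i. 2 * i) ` e) ` edges G1 \<union> (\<lambda>e. (\<lambda>i. 2 * i + 1) ` e) ` edges G2"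
    by (simp add: disjoint_union_def edges_def)
  have i0: "(\<lambda>i. 2 * i) ` {i, j} \<in> (\<lambda>e. (\<lambda>i. 2 * i) ` e) ` F \<longleftrightarrow> {i, j} \<in> F" for F
    by (rule inj_image_mem_iff) (simp add: inj_double(1) inj_image_eq_iff inj_def)
  have i1: "(\<lambda>i. 2 * i + 1) ` {i, j} \<in> (\<lambda>e. (\<lambda>i. 2 * i + 1) ` e) ` F \<longleftrightarrow> {i, j} \<in> F" for F
    by (rule inj_image_mem_iff) (use inj_image_eq_iff[OF inj_double(2)] in \<open>auto simp: inj_def\<close>)
  show "adj (disjoint_union G1 G2) (2 * i) (2 * j) \<longleftrightarrow> adj G1 i j"
  proof -
    have "{2 * i, 2 * j} \<notin> (\<lambda>e. (\<lambda>i. 2 * i + 1) ` e) ` edges G2"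
      using od[of "2 * i"] by (metis dvd_triv_left imageE insertI1)
    then show ?thesis using i0[of "edges G1"] unfolding adj_def E by simp
  qed
  show "adj (disjoint_union G1 G2) (2 * i + 1) (2 * j + 1) \<longleftrightarrow> adj G2 i j"
  proof -
    have "{2 * i + 1, 2 * j + 1} \<notin> (\<lambda>e. (\<lambda>i. 2 * i) ` e) ` edges G1"
      using ev[of "2 * i + 1"] by (metis odd_two_times_div_two_succ dvd_triv_left even_add odd_one imageE insertI1)
    then show ?thesis using i1[of "edges G2"] unfolding adj_def E by simp
  qed
  assume "adj (disjoint_union G1 G2) x y"
  then consider e where "{x, y} = (\<lambda>i. 2 * i) ` e" | e where "{x, y} = (\<lambda>i. 2 * i + 1) ` e"
    unfolding adj_def E by blast
  then show "even x \<longleftrightarrow> even y"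
  proof cases
    case 1
    then have "even x" "even y" using ev[of x e] ev[of y e] by (simp_all flip: 1)
    then show ?thesis by simp
  next
    case 2
    then have "odd x" "odd y" using od[of x e] od[of y e] by blast+
    then show ?thesis by simp
  qed
qed

text \<open>The dominating vertex keeps an embedding in one side: all other images are adjacent to
  that of \<open>d\<close> and hence have its parity.\<close>

lemma count_copies_disjoint_union:
  assumes X: "wf_graph X" and dom: "d \<in> dominating_vertices X" and G: "wf_graph G1" "wf_graph G2"
  shows "count_copies X (disjoint_union G1 G2) = count_copies X G1 + count_copies X G2"
proof -
  let ?U = "disjoint_union G1 G2"
  let ?e = "\<lambda>V E. emb (verts X) (adj X) V E"
  define V1 where "V1 = (\<lambda>i. 2 * i) ` verts G1"
  define V2 where "V2 = (\<lambda>i. 2 * i + 1) ` verts G2"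
  have fin: "finite (verts X)" "finite (verts G1)" "finite (verts G2)"
    using X G by (auto simp: wf_graph_def)
  have VU: "verts ?U = V1 \<union> V2" by (simp add: verts_disjoint_union V1_def V2_def)
  have finV: "finite V1" "finite V2" using fin by (simp_all add: V1_def V2_def)
  have dX: "d \<in> verts X" using dom by (simp add: dominating_vertices_def)
  have par: "even v" if "v \<in> V1" for v using that by (auto simp: V1_def)
  have par': "odd v" if "v \<in> V2" for v using that by (auto simp: V2_def)
  have "embs X ?U = ?e V1 (adj ?U) \<union> ?e V2 (adj ?U)"
  proof
    show "embs X ?U \<subseteq> ?e V1 (adj ?U) \<union> ?e V2 (adj ?U)"
    proof
      fix f assume f: "f \<in> embs X ?U"
      have same: "even (f p) \<longleftrightarrow> even (f d)" if p: "p \<in> verts X" for p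
        using emb_D(4)[OF f dX p] dominating_adj[OF dom p] adj_disjoint_union(3)[of G1 G2 "f d" "f p"]
        by (cases "p = d") auto
      have mem: "f p \<in> V1 \<union> V2" if "p \<in> verts X" for p using emb_D(1)[OF f that] VU by simp
      show "f \<in> ?e V1 (adj ?U) \<union> ?e V2 (adj ?U)"
      proof (cases "even (f d)")
        case True
        then have "f p \<in> V1" if "p \<in> verts X" for p using same[OF that] mem[OF that] par' by blast
        then have "f \<in> ?e V1 (adj ?U)" by (intro emb_I) (use emb_D[OF f] in auto)
        then show ?thesis by simp
      next
        case False
        then have "f p \<in> V2" if "p \<in> verts X" for p using same[OF that] mem[OF that] par by blast
        then have "f \<in> ?e V2 (adj ?U)" by (intro emb_I) (use emb_D[OF f] in auto)
        then show ?thesis by simp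
      qed
    qed
    show "?e V1 (adj ?U) \<union> ?e V2 (adj ?U) \<subseteq> embs X ?U"
      using VU by (intro Un_least emb_mono) auto
  qed
  moreover have "?e V1 (adj ?U) \<inter> ?e V2 (adj ?U) = {}"
    using emb_D(1)[OF _ dX] par par' by blast
  ultimately have "card (embs X ?U) = card (?e V1 (adj ?U)) + card (?e V2 (adj ?U))"
    by (simp only: card_Un_disjoint[OF finite_emb[OF fin(1) finV(1)] finite_emb[OF fin(1) finV(2)]])
  moreover have "card (embs X G1) = card (?e V1 (adj ?U))"
    by (rule card_emb_host_eq[where \<phi> = "\<lambda>i. 2 * i"])
      (use fin inj_double(1) in \<open>auto simp: V1_def adj_disjoint_union(1) intro!: inj_on_imp_bij_betw inj_on_subset[OF inj_double(1)]\<close>)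
  moreover have "card (embs X G2) = card (?e V2 (adj ?U))"
    by (rule card_emb_host_eq[where \<phi> = "\<lambda>i. 2 * i + 1"])
      (use fin adj_disjoint_union(2)[of G1 G2] in \<open>auto simp: V2_def intro!: inj_on_imp_bij_betw inj_onI\<close>)
  ultimately have "card (embs X ?U) = card (embs X G1) + card (embs X G2)" by simp
  then have "count_copies X ?U * card (embs X X) = (count_copies X G1 + count_copies X G2) * card (embs X X)"
    using count_copies_mult_automorphisms[OF X, of ?U] count_copies_mult_automorphisms[OF X fin(2)]
      count_copies_mult_automorphisms[OF X fin(3)] finV VU by (simp only: add_mult_distrib finite_UnI)
  then show ?thesis using card_embs_self_pos[OF X] by simp
qed

lemma count_copies_small:
  assumes "wf_graph X" "finite (verts G)" "card (verts G) < card (verts X)"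
  shows "count_copies X G = 0"
proof -
  have "embs X G = {}"
  proof (rule ccontr)
    assume "embs X G \<noteq> {}"
    then obtain f where f: "f \<in> embs X G" by blast
    then have "card (verts X) \<le> card (verts G)"
      using card_inj_on_le[OF emb_D(3)[OF f] emb_D(5)[OF f] assms(2)] by simp
    then show False using assms(3) by simp
  qed
  then show ?thesis using count_copies_eq_0_iff[OF assms(1,2)] by simp
qed

lemma count_copies_self:
  assumes "wf_graph X"
  shows "count_copies X X = 1"
proof -
  have "finite (verts X)" using assms by (simp add: wf_graph_def)
  from count_copies_mult_automorphisms[OF assms this] show ?thesis
    using card_embs_self_pos[OF assms] by simp
qed

section \<open>Admissible graphs, superadditivity and convergence\<close>

definition admissible :: "nat \<Rightarrow> nat \<Rightarrow> nat \<Rightarrow> nat \<Rightarrow> nat graph set" where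
  "admissible u D w p =
    {G. wf_graph G \<and> kcount u G = p \<and> free {split_graph u D, complete_graph (w + 1)} G}"

lemma dominating_vertex_0:
  "0 < u \<Longrightarrow> 0 \<in> dominating_vertices (complete_graph u)"
  "0 < u \<Longrightarrow> 0 \<in> dominating_vertices (split_graph u D)"
  by (auto simp: dominating_vertices_def adj_complete_graph adj_split_graph simp flip: adj_def)

text \<open>The cliques that are counted and both forbidden graphs have a dominating vertex, so all
  three counts are additive.\<close>

lemma admissible_disjoint_union:
  assumes "0 < u" "G1 \<in> admissible u D w p" "G2 \<in> admissible u D w q"
  shows "disjoint_union G1 G2 \<in> admissible u D w (p + q)"
proof -
  have G: "wf_graph G1" "wf_graph G2" using assms by (auto simp: admissible_def)
  note copies = count_copies_disjoint_union[OF wf_complete_graph dominating_vertex_0(1)[OF assms(1)] G]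
    count_copies_disjoint_union[OF wf_complete_graph dominating_vertex_0(1)[of "w + 1"] G]
    count_copies_disjoint_union[OF wf_split_graph dominating_vertex_0(2)[OF assms(1)] G]
  show ?thesis
    using assms(2,3) wf_disjoint_union[OF G] copies(2)
    by (simp add: admissible_def free_def kcount_def copies(1,3))
qed

text \<open>The witness is a union of \<open>p\<close> disjoint \<open>u\<close>-cliques; a
  \<open>u\<close>-clique has too few vertices to contain a forbidden graph.\<close>

lemma admissible_nonempty:
  assumes u: "0 < u" "u \<le> w"
  shows "admissible u D w p \<noteq> {}"
proof (induction p)
  case 0
  define G0 :: "nat graph" where "G0 = ({}, {})"
  have "verts G0 = {}" "edges G0 = {}" by (simp_all add: G0_def verts_def edges_def)
  then have G0: "wf_graph G0" "finite (verts G0)" "card (verts G0) = 0" by (simp_all add: wf_graph_def)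
  then have "G0 \<in> admissible u D w 0"
    using u by (simp add: admissible_def free_def kcount_def
      count_copies_small wf_complete_graph wf_split_graph)
  then show ?case by blast
next
  case (Suc p)
  then obtain G where G: "G \<in> admissible u D w p" by blast
  have "complete_graph u \<in> admissible u D w 1"
    using u by (simp add: admissible_def free_def kcount_def count_copies_self
      count_copies_small wf_complete_graph wf_split_graph)
  from admissible_disjoint_union[OF u(1) G this] show ?case by auto
qed

text \<open>Take \<open>k\<close> disjoint copies of \<open>G\<close> and a filler with
  \<open>t\<close> cliques; the filler allows any prescribed number of cliques to be hit exactly,
  also when \<open>q\<close> does not divide it.\<close>

lemma admissible_blow_up:
  assumes u: "0 < u" "u \<le> w" and H: "wf_graph H" "d \<in> dominating_vertices H"
    and G: "G \<in> admissible u D w q"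
  shows "\<exists>G'\<in>admissible u D w (k * q + t). k * count_copies H G \<le> count_copies H G'"
proof (induction k)
  case 0
  obtain G0 where "G0 \<in> admissible u D w t" using admissible_nonempty[OF u] by blast
  then show ?case by (intro bexI[of _ G0]) simp_all
next
  case (Suc k)
  then obtain G' where G': "G' \<in> admissible u D w (k * q + t)" "k * count_copies H G \<le> count_copies H G'" by blast
  have "disjoint_union G G' \<in> admissible u D w (q + (k * q + t))"
    by (rule admissible_disjoint_union[OF u(1) G G'(1)])
  moreover have "count_copies H (disjoint_union G G') = count_copies H G + count_copies H G'"
    using G G'(1) by (intro count_copies_disjoint_union[OF H]) (auto simp: admissible_def)
  ultimately show ?case using G'(2) by (intro bexI[of _ "disjoint_union G G'"]) (auto simp: algebra_simps)
qed

lemma ex_u_admissible: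
  "ex_u u p H {split_graph u D, complete_graph (w + 1)} =
    (SUP G\<in>admissible u D w p. ennreal (real (count_copies H G)))"
  by (simp add: ex_u_def admissible_def)

text \<open>A superadditivity argument: each quotient is at most the supremum, and a nearly optimal
  \<open>G\<close> with \<open>q\<close> cliques is repeated \<open>p div q\<close> times, with a
  filler of \<open>p mod q\<close> cliques. Convergence is proved on the way, so \<open>lim\<close>
  in \<open>P_u\<close> is an actual limit.\<close>

lemma P_u_eq_SUP_rho:
  assumes u: "0 < u" "u \<le> w" and H: "wf_graph H" "d \<in> dominating_vertices H"
  shows "P_u u H D w = (SUP G\<in>(\<Union>p\<in>{1..}. admissible u D w p). ennreal (rho u H G))"
  unfolding P_u_def
proof (rule limI, rule order_tendstoI)
  let ?ex = "\<lambda>p. ex_u u p H {split_graph u D, complete_graph (w + 1)}"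
  let ?A = "\<Union>p\<in>{1..}. admissible u D w p"
  let ?L = "SUP G\<in>?A. ennreal (rho u H G)"
  have upper: "?ex p / of_nat p \<le> ?L" if p: "1 \<le> p" for p
  proof (rule divide_le_posI_ennreal)
    show "(0 :: ennreal) < of_nat p" using p by simp
    show "?ex p \<le> of_nat p * ?L"
      unfolding ex_u_admissible
    proof (rule SUP_least)
      fix G assume G: "G \<in> admissible u D w p"
      then have "real (count_copies H G) = real p * rho u H G" using p by (auto simp: rho_def admissible_def)
      then have "ennreal (real (count_copies H G)) = of_nat p * ennreal (rho u H G)"
        by (simp add: ennreal_mult' ennreal_of_nat_eq_real_of_nat)
      also have "\<dots> \<le> of_nat p * ?L"
        by (intro mult_left_mono SUP_upper) (use G p in auto)
      finally show "ennreal (real (count_copies H G)) \<le> of_nat p * ?L" .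
    qed
  qed
  {
    fix a assume "?L < a"
    then show "\<forall>\<^sub>F p in sequentially. ?ex p / of_nat p < a"
      using upper by (intro eventually_sequentiallyI[of 1]) (rule le_less_trans)
  }
  fix a assume "a < ?L"
  then obtain G where "G \<in> ?A" and a: "a < ennreal (rho u H G)" by (auto simp: less_SUP_iff)
  then obtain q where q: "1 \<le> q" and G: "G \<in> admissible u D w q" by auto
  define N where "N = count_copies H G"
  have rho: "rho u H G = real N / real q" using G by (simp add: rho_def admissible_def N_def)
  \<comment> \<open>\<open>real N / real p\<close> is the price of rounding \<open>p / q\<close>
    down; it vanishes in the limit.\<close>
  have "(\<lambda>p. real N / real q - real N / real p) \<longlonglongrightarrow> real N / real q - 0"
    by (intro tendsto_intros lim_const_over_n)
  then have "(\<lambda>p. ennreal (real N / real q - real N / real p)) \<longlonglongrightarrow> ennreal (rho u H G)"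
    by (simp add: rho)
  then have "\<forall>\<^sub>F p in sequentially. a < ennreal (real N / real q - real N / real p)"
    using a by (rule order_tendstoD(1))
  then show "\<forall>\<^sub>F p in sequentially. a < ?ex p / of_nat p"
    using eventually_ge_at_top[of 1]
  proof eventually_elim
    case (elim p)
    obtain G' where G': "G' \<in> admissible u D w (p div q * q + p mod q)" "p div q * N \<le> count_copies H G'"
      using admissible_blow_up[OF u H G, of "p div q" "p mod q"] unfolding N_def by blast
    have "p < (p div q + 1) * q" using q dividend_less_div_times[of q p] by (simp add: algebra_simps)
    then have "real p \<le> (real (p div q) + 1) * real q"
      using of_nat_mono[where 'a = real, of p "(p div q + 1) * q"] by (simp add: algebra_simps)
    then have "real p / real q \<le> real (p div q) + 1" using q by (subst pos_divide_le_eq) auto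
    then have "real p / real q - 1 \<le> real (p div q)" by simp
    then have "(real p / real q - 1) * real N \<le> real (p div q) * real N" by (rule mult_right_mono) simp
    also have "\<dots> \<le> real (count_copies H G')" using of_nat_mono[where 'a = real, OF G'(2)] by simp
    finally have "(real p / real q - 1) * real N / real p \<le> real (count_copies H G') / real p"
      by (rule divide_right_mono) simp
    moreover have "(real p / real q - 1) * real N / real p = real N / real q - real N / real p"
      using elim(2) by (simp add: field_simps)
    ultimately have "ennreal (real N / real q - real N / real p) \<le> ennreal (real (count_copies H G') / real p)"
      by (intro ennreal_leI) simp
    also have "\<dots> = ennreal (real (count_copies H G')) / of_nat p"
      using elim(2) by (simp add: divide_ennreal ennreal_of_nat_eq_real_of_nat)
    also have "\<dots> \<le> ?ex p / of_nat p"
      unfolding ex_u_admissible by (intro divide_right_mono_ennreal SUP_upper) (use G'(1) in simp)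
    finally show ?case using elim(1) by (rule less_le_trans[rotated])
  qed
qed

theorem mainTheorem10:
  fixes H :: "'b graph" and S :: "'b set" and u D w :: nat
  assumes "u \<ge> 1" and "wf_graph H" and "dom_num H \<ge> u"
    and "S \<subseteq> dominating_vertices H" and "card S = u"
    and "D \<ge> w" and "w \<ge> omega0 (delete_verts H S) + u"
  defines "c \<equiv> real (count_copies (delete_verts H S) (turan (w - u) D)) / real (dom_num H choose u)"
  shows "(\<forall>G :: 'a graph. wf_graph G \<and> free {split_graph u D, complete_graph (w+1)} G \<longrightarrow>
            real (count_copies H G) \<le> c * real (kcount u G))
       \<and> P_u u H D w \<le> ennreal c
       \<and> (\<forall>p\<ge>1. ex_u u p H {split_graph u D, complete_graph (w+1)} \<le> ennreal (c * real p))
       \<and> ((w - u) dvd D \<longrightarrow>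
            P_u u H D w = ennreal c \<and> c = rho u H (turan w (w * (D div (w - u)))))"
proof -
  have H: "wf_graph H" and S: "S \<subseteq> dominating_vertices H" "card S = u" by fact+
  \<comment> \<open>\<open>omega0\<close> is at least 1, so \<open>w - u\<close> is
    positive.\<close>
  have w: "u < w"
    using assms(7) omega0_spec(1)[OF wf_delete_verts[OF H], of S] by linarith
  have binom: "0 < dom_num H choose u" using assms(3) by simp
  obtain d where d: "d \<in> dominating_vertices H" using S assms(1) by fastforce
  \<comment> \<open>The vertex type is generic here: the first claim needs graphs on
    \<open>'a\<close>, those about \<open>P_u\<close> and \<open>ex_u\<close> need graphs on
    \<open>nat\<close>.\<close>
  have bound: "real (count_copies H G) \<le> c * real (kcount u G)"
    if G: "wf_graph G" "free {split_graph u D, complete_graph (w+1)} G" for G :: "'c graph"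
  proof -
    have "count_copies H G * (dom_num H choose u) \<le>
        kcount u G * count_copies (delete_verts H S) (turan (w - u) D)"
      by (rule copies_bound[OF H S assms(7) G(1)]) (use G(2) in \<open>simp_all add: free_def\<close>)
    from of_nat_mono[where 'a = real, OF this] show ?thesis
      using binom by (simp add: c_def field_simps)
  qed
  have P: "P_u u H D w = (SUP G\<in>(\<Union>p\<in>{1..}. admissible u D w p). ennreal (rho u H G))"
    by (rule P_u_eq_SUP_rho[OF _ _ H d]) (use assms(1) w in auto)
  have P_le: "P_u u H D w \<le> ennreal c"
    unfolding P
  proof (rule SUP_least)
    fix G assume "G \<in> (\<Union>p\<in>{1..}. admissible u D w p)"
    then have "wf_graph G" "free {split_graph u D, complete_graph (w+1)} G" "1 \<le> kcount u G"
      by (auto simp: admissible_def)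
    then show "ennreal (rho u H G) \<le> ennreal c"
      using bound[of G] by (intro ennreal_leI) (simp add: rho_def divide_le_eq)
  qed
  have ex_le: "ex_u u p H {split_graph u D, complete_graph (w+1)} \<le> ennreal (c * real p)" for p
    unfolding ex_u_admissible
    by (rule SUP_least, rule ennreal_leI) (use bound in \<open>auto simp: admissible_def\<close>)
  have eq: "P_u u H D w = ennreal c \<and> c = rho u H (turan w (w * (D div (w - u))))"
    if dvd: "(w - u) dvd D"
  proof -
    define m where "m = D div (w - u)"
    have D: "D = (w - u) * m" using dvd by (simp add: m_def)
    \<comment> \<open>\<open>D \<ge> w > 0\<close> makes the parts nonempty, so the Turan graph
      contains \<open>u\<close>-cliques and its density enters the supremum.\<close>
    have m: "0 < m" using D assms(6) w by (cases m) auto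
    let ?T = "turan w (w * m)"
    have k: "0 < kcount u ?T" by (rule turan_kcount_pos[OF w m])
    have "count_copies H ?T * (dom_num H choose u) =
        kcount u ?T * count_copies (delete_verts H S) (turan (w - u) D)"
      using turan_copies[OF H S w, of m] unfolding D .
    then have "real (count_copies H ?T) * real (dom_num H choose u) =
        real (kcount u ?T) * real (count_copies (delete_verts H S) (turan (w - u) D))"
      by (metis of_nat_mult)
    then have rho: "c = rho u H ?T" using k binom by (simp add: c_def rho_def field_simps)
    have "?T \<in> (\<Union>p\<in>{1..}. admissible u D w p)"
      using k wf_turan turan_free[OF w, of m] by (auto simp: admissible_def D)
    then have "ennreal c \<le> P_u u H D w" unfolding P rho by (rule SUP_upper)
    then show ?thesis using P_le rho by (auto simp: m_def)
  qed
  show ?thesis using bound P_le ex_le eq by blast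
qed

end
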